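(* Let $(X,X^+)$ be an ordered Banach space such that $(X^*,(X^* )^+)$ is a normally ordered separable Banach space with $\dim X^*\ge2$, and let $\Phi=((U_\omega(t))_{\omega\in\Omega,t\in\mathbb T^+},(\theta_t)_{t\in\mathbb T})$ be a measurable linear skew-product semidynamical system on $X$ whose dual $\Phi^*=((U^*_\omega(t))_{\omega\in\Omega,t\in\mathbb T^+},(\theta_{-t})_{t\in\mathbb T})$ is a measurable linear skew-product semidynamical system on $X^*$ that is dual-integrable, dual-positive and dual-focusing (with data $\mathbf e^*$, $\varkappa^*$). Then there exist an invariant set $\tilde\Omega_1^*\subset\Omega$, $\mathbb P(\tilde\Omega_1^* )=1$, and an $(\mathfrak F,\mathfrak B(X^* ))$-measurable function $w^*:\tilde\Omega_1^*\to X^*$ with $w^*(\omega)\in C_{\mathbf e^*}$ and $\|w^*(\omega)\|=1$ for all $\omega\in\tilde\Omega_1^*$, having the following properties. Put $\tilde E_1^*(\omega)=\mathrm{span}\{w^*(\omega)\}$. (1) $w^*(\theta_{-t}\omega)=\dfrac{U^*_\omega(t)w^*(\omega)}{\|U^*_\omega(t)w^*(\omega)\|}$ for any $\omega\in\tilde\Omega_1^*$ and $t\in\mathbb T^+$. (2) If for some $\omega\in\tilde\Omega_1^*$ a function $v^*_\omega:\mathbb T\to(X^* )^+\setminus\{0\}$ is an entire orbit of $U^*_\omega$, then $v^*_\omega(t)=\|v^*_\omega(0)\|\,w^*_\omega(t)$ for all $t\in\mathbb T$, where $w^*_\omega(t):=(U^*_{\theta_{-t}\omega}(-t)|_{\tilde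 E_1^*(\theta_{-t}\omega)})^{-1}w^*(\omega)$ for $t\in\mathbb T$, $t<0$, and $w^*_\omega(t):=U^*_\omega(t)w^*(\omega)$ for $t\in\mathbb T^+$. (3) There exists $\tilde\lambda_1^*\in[-\infty,\infty)$ such that $$\tilde\lambda_1^*=\lim_{t\to\pm\infty,\ t\in\mathbb T}\frac1t\ln\rho^*_t(\omega)=\int_\Omega\ln\rho_1^*\,d\mathbb P$$ for each $\omega\in\tilde\Omega_1^*$, where $\rho_t^*(\omega):=\|U^*_\omega(t)w^*(\omega)\|$ for $t\ge0$ and $\rho_t^*(\omega):=1/\|U^*_{\theta_{-t}\omega}(-t)w^*(\theta_{-t}\omega)\|$ for $t<0$. (4) If, moreover, $(X,X^+)$ is a normally ordered separable Banach space with $\dim X\ge 2$ and $\Phi$ is integrable, positive and focusing, then $\tilde\lambda_1=\tilde\lambda_1^*$, where $\tilde\lambda_1$ is the exponent of $\Phi$ defined in the context.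
   Context: Let $\mathbb T\in\{\mathbb Z,\mathbb R\}$, $\mathbb T^+=\{t\in\mathbb T:t\ge0\}$. $(\Omega,\mathfrak F,\mathbb P)$ is a probability space; $\mathfrak B(Y)$ is the Borel $\sigma$-algebra of a metric space $Y$. A metric dynamical system $(\theta_t)_{t\in\mathbb T}$ is a $(\mathfrak B(\mathbb T)\otimes\mathfrak F,\mathfrak F)$-measurable map $(t,\omega)\mapsto\theta_t\omega$ with $\theta_0=\mathrm{Id}$, $\theta_{t_1+t_2}=\theta_{t_2}\circ\theta_{t_1}$, each $\theta_t$ preserving $\mathbb P$. $\Omega'\subset\Omega$ is invariant if $\theta_t(\Omega')=\Omega'$ for all $t\in\mathbb T$; the system is ergodic if every invariant $F\in\mathfrak F$ has $\mathbb P(F)\in\{0,1\}$. A measurable linear skew-product semidynamical system $\Phi=((U_\omega(t)),(\theta_t))$ on a real Banach space $X$ covering $(\theta_t)$ is a $(\mathfrak B(\mathbb T^+)\otimes\mathfrak F\otimes\mathfrak B(X),\mathfrak B(X))$-measurable map $(t,\omega,u)\mapsto U_\omega(t)u$ with each $U_\omega(t)$ bounded linear on $X$, $U_\omega(0)=\mathrm{Id}_X$ and $U_{\theta_s\omega}(t)U_\omega(s)=U_\omega(t+s)$. Write $\ln^+x=\max(\ln x,0)$, $\ln^+0=0$. A cone in $X$ is a closed convex set $X^+$ with $\alpha u\in X^+$ for $\alpha\ge0$, $u\in X^+$, and $X^+\cap(-X^+)=\{0\}$; $(X,X^+)$ is then an ordered Banach space and $u\le v$ means $v-u\in X^+$.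 For $u,v\in X^+\setminus\{0\}$, $u\sim v$ means $\underline\alpha v\le u\le\overline\alpha v$ for some $\underline\alpha,\overline\alpha>0$, and $C_u=\{v\in X^+\setminus\{0\}:v\sim u\}$. The cone is normal if for some $K>0$, $0\le u\le v$ implies $\|u\|\le K\|v\|$. A normally ordered Banach space is one with normal cone, and its norm is always assumed monotonic: $0\le u\le v$ implies $\|u\|\le\|v\|$. $X^*$ is the dual with the dual norm and pairing $\langle u,u^*\rangle$; $(X^* )^+=\{u^*:\langle u,u^*\rangle\ge0\ \forall u\in X^+\}$ (saying that $(X^*,(X^* )^+)$ is an ordered Banach space means that this set is a cone; order notions in $X^*$ refer to it). $U^*_\omega(t)$ is defined by $\langle u,U^*_\omega(t)u^*\rangle=\langle U_{\theta_{-t}\omega}(t)u,u^*\rangle$ for all $u\in X$. When $(t,\omega,u^* )\mapsto U^*_\omega(t)u^*$ is $(\mathfrak B(\mathbb T^+)\otimes\mathfrak F\otimes\mathfrak B(X^* ),\mathfrak B(X^* ))$-measurable, $\Phi^*=((U^*_\omega(t)),(\theta_{-t}))$ is a measurable linear skew-product semidynamical system on $X^*$ covering $(\theta_{-t})$, called the dual of $\Phi$. An entire orbit of $U^*_\omega$ is a map $v^*_\omega:\mathbb T\to X^*$ with $v^*_\omega(s+t)=U^*_{\theta_{-s}\omega}(t)v^*_\omega(s)$ for all $s\in\mathbb T$, $t\in\mathbb T^+$. $\Phi$ is integrable if $X$ is separable, $(\theta_t)$ is ergodic, $\mathbb P$ is complete when $\mathbb T=\mathbb R$, and: when $\mathbb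 T=\mathbb Z$, $\omega\mapsto\ln^+\|U_\omega(1)\|$ is in $L_1$; when $\mathbb T=\mathbb R$, $\omega\mapsto\sup_{0\le s\le1}\ln^+\|U_\omega(s)\|$ and $\omega\mapsto\sup_{0\le s\le1}\ln^+\|U_{\theta_s\omega}(1-s)\|$ are in $L_1$. $\Phi$ is positive if $(\theta_t)$ is ergodic and $U_\omega(t)u_1\le U_\omega(t)u_2$ for all $\omega$, all $t\in\mathbb T^+$ and all $u_1\le u_2$. $\Phi$ is focusing if it is positive and there are $\mathbf e\in X^+$, $\|\mathbf e\|=1$, and a measurable $\varkappa:\Omega\to[1,\infty)$ with $\ln^+\ln\varkappa\in L_1$ such that for any $\omega\in\Omega$ and nonzero $u\in X^+$ there is $\beta(\omega,u)>0$ with $\beta(\omega,u)\mathbf e\le U_\omega(1)u\le\varkappa(\omega)\beta(\omega,u)\mathbf e$. Dual-integrable, dual-positive, dual-focusing are the same conditions for $\Phi^*$: the map $(t,\omega,u^* )\mapsto U^*_\omega(t)u^*$ is measurable, $X^*$ is separable, $(\theta_{-t})$ is ergodic, $\mathbb P$ is complete when $\mathbb T=\mathbb R$, and $\ln^+\|U^*_\omega(1)\|\in L_1$ ($\mathbb T=\mathbb Z$), resp. $\sup_{0\le s\le1}\ln^+\|U^*_\omega(s)\|$ and $\sup_{0\le s\le1}\ln^+\|U^*_{\theta_{-s}\omega}(1-s)\|$ are in $L_1$ ($\mathbb T=\mathbb R$); $U^*_\omega(t)u_1^*\le U^*_\omega(t)u_2^*$ whenever $u_1^*\le u_2^*$;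 there are $\mathbf e^*\in(X^* )^+$, $\|\mathbf e^*\|=1$, and a measurable $\varkappa^*:\Omega\to[1,\infty)$ with $\ln^+\ln\varkappa^*\in L_1$ such that for any $\omega$ and nonzero $u^*\in(X^* )^+$ there is $\beta^*(\omega,u^* )>0$ with $\beta^*(\omega,u^* )\mathbf e^*\le U^*_\omega(1)u^*\le\varkappa^*(\omega)\beta^*(\omega,u^* )\mathbf e^*$. Definition of $\tilde\lambda_1$: if $(X,X^+)$ is a normally ordered separable Banach space with $\dim X\ge2$ and $\Phi$ is integrable, positive and focusing, there exist an invariant $\tilde\Omega_1$ with $\mathbb P(\tilde\Omega_1)=1$, a measurable $w:\tilde\Omega_1\to X$ with $w(\omega)\in C_{\mathbf e}$, $\|w(\omega)\|=1$, $w(\theta_t\omega)=U_\omega(t)w(\omega)/\|U_\omega(t)w(\omega)\|$ for all $\omega\in\tilde\Omega_1$, $t\in\mathbb T^+$, and a number $\tilde\lambda_1\in[-\infty,\infty)$ with $\tilde\lambda_1=\lim_{t\to\pm\infty}\frac1t\ln\rho_t(\omega)=\int_\Omega\ln\rho_1\,d\mathbb P$ for all $\omega\in\tilde\Omega_1$, where $\rho_t(\omega)=\|U_\omega(t)w(\omega)\|$ for $t\ge0$ and $\rho_t(\omega)=1/\|U_{\theta_t\omega}(-t)w(\theta_t\omega)\|$ for $t<0$. *)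

theory Defs
  imports "HOL-Probability.Probability"
begin

section \<open>Ordered Banach spaces\<close>

definition dim_ge :: "nat \<Rightarrow> 'x::real_vector set \<Rightarrow> bool" where
  \<comment> \<open>the library's \<^const>\<open>dim\<close> is 0 on infinite-dimensional spaces\<close>
  "dim_ge n S \<longleftrightarrow> (\<exists>B\<subseteq>S. independent B \<and> finite B \<and> card B = n)"

definition ordered_banach :: "'x::banach set \<Rightarrow> bool" where
  "ordered_banach C \<longleftrightarrow> closed C \<and> convex C \<and> cone C \<and> C \<inter> uminus ` C = {0}"

definition cone_le :: "'x::banach set \<Rightarrow> 'x \<Rightarrow> 'x \<Rightarrow> bool" where
  "cone_le C u v \<longleftrightarrow> v - u \<in> C"

definition cone_sim :: "'x::banach set \<Rightarrow> 'x \<Rightarrow> 'x \<Rightarrow> bool" where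
  "cone_sim C u v \<longleftrightarrow>
     (\<exists>a>0. \<exists>b>0. cone_le C (a *\<^sub>R v) u \<and> cone_le C u (b *\<^sub>R v))"

definition cone_component :: "'x::banach set \<Rightarrow> 'x \<Rightarrow> 'x set" where
  "cone_component C u = {v \<in> C - {0}. cone_sim C v u}"

definition normal_cone :: "'x::banach set \<Rightarrow> bool" where
  "normal_cone C \<longleftrightarrow>
     (\<exists>K>0. \<forall>u v. cone_le C 0 u \<and> cone_le C u v \<longrightarrow> norm u \<le> K * norm v)"

definition monotonic_norm :: "'x::banach set \<Rightarrow> bool" where
  "monotonic_norm C \<longleftrightarrow>
     (\<forall>u v. cone_le C 0 u \<and> cone_le C u v \<longrightarrow> norm u \<le> norm v)"

text \<open>The standing convention that the norm of a normally ordered Banach space is monotonic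
  is part of the definition.\<close>

definition normally_ordered_banach :: "'x::banach set \<Rightarrow> bool" where
  "normally_ordered_banach C \<longleftrightarrow> ordered_banach C \<and> normal_cone C \<and> monotonic_norm C"

definition dual_cone :: "'x::banach set \<Rightarrow> ('x \<Rightarrow>\<^sub>L real) set" where
  "dual_cone C = {f. \<forall>u\<in>C. 0 \<le> blinfun_apply f u}"


section \<open>Measurable linear skew-product semidynamical systems\<close>

text \<open>The time set \<open>T\<close> is a set of reals, either \<open>\<int>\<close> or \<open>UNIV\<close>, and its Borel sigma-algebra is
  that of the subspace \<open>T\<close>. The sample space is \<open>space M\<close>. Values of \<open>\<theta> t \<omega>\<close> and \<open>U \<omega> t\<close> for
  \<open>t\<close> outside \<open>T\<close> (for \<open>U\<close>: outside \<open>T \<inter> {0..}\<close>) or \<open>\<omega>\<close> outside \<open>space M\<close> are irrelevant.\<close>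

definition metric_dynamical_system ::
    "real set \<Rightarrow> 'w measure \<Rightarrow> (real \<Rightarrow> 'w \<Rightarrow> 'w) \<Rightarrow> bool" where
  "metric_dynamical_system T M \<theta> \<longleftrightarrow>
     (\<lambda>(t, \<omega>). \<theta> t \<omega>) \<in> measurable (restrict_space borel T \<Otimes>\<^sub>M M) M \<and>
     (\<forall>\<omega>\<in>space M. \<theta> 0 \<omega> = \<omega>) \<and>
     (\<forall>t\<^sub>1\<in>T. \<forall>t\<^sub>2\<in>T. \<forall>\<omega>\<in>space M. \<theta> (t\<^sub>1 + t\<^sub>2) \<omega> = \<theta> t\<^sub>2 (\<theta> t\<^sub>1 \<omega>)) \<and>
     (\<forall>t\<in>T. distr M M (\<theta> t) = M)"

definition invariant_set ::
    "real set \<Rightarrow> 'w measure \<Rightarrow> (real \<Rightarrow> 'w \<Rightarrow> 'w) \<Rightarrow> 'w set \<Rightarrow> bool" where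
  "invariant_set T M \<theta> F \<longleftrightarrow> F \<subseteq> space M \<and> (\<forall>t\<in>T. \<theta> t ` F = F)"

definition ergodic :: "real set \<Rightarrow> 'w measure \<Rightarrow> (real \<Rightarrow> 'w \<Rightarrow> 'w) \<Rightarrow> bool" where
  "ergodic T M \<theta> \<longleftrightarrow>
     (\<forall>F\<in>sets M. invariant_set T M \<theta> F \<longrightarrow> measure M F = 0 \<or> measure M F = 1)"

definition skew_product ::
    "real set \<Rightarrow> 'w measure \<Rightarrow> (real \<Rightarrow> 'w \<Rightarrow> 'w) \<Rightarrow> ('w \<Rightarrow> real \<Rightarrow> 'x::banach \<Rightarrow>\<^sub>L 'x) \<Rightarrow> bool"
where
  "skew_product T M \<theta> U \<longleftrightarrow>
     metric_dynamical_system T M \<theta> \<and>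
     (\<lambda>(t, \<omega>, u). blinfun_apply (U \<omega> t) u)
       \<in> measurable (restrict_space borel (T \<inter> {0..}) \<Otimes>\<^sub>M M \<Otimes>\<^sub>M borel) borel \<and>
     (\<forall>\<omega>\<in>space M. U \<omega> 0 = id_blinfun) \<and>
     (\<forall>\<omega>\<in>space M. \<forall>s\<in>T \<inter> {0..}. \<forall>t\<in>T \<inter> {0..}. U (\<theta> s \<omega>) t o\<^sub>L U \<omega> s = U \<omega> (t + s))"

definition lnplus :: "real \<Rightarrow> real" where
  "lnplus x = (if x \<le> 0 then 0 else max (ln x) 0)"

text \<open>The suprema below are taken in \<open>[0, \<infinity>]\<close>; a \<open>[0, \<infinity>]\<close>-valued function is in \<open>L\<^sub>1\<close> iff it is
  measurable and has finite integral.\<close>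

definition nn_L1 :: "'w measure \<Rightarrow> ('w \<Rightarrow> ennreal) \<Rightarrow> bool" where
  "nn_L1 M f \<longleftrightarrow> f \<in> borel_measurable M \<and> (\<integral>\<^sup>+\<omega>. f \<omega> \<partial>M) < \<infinity>"

definition integrable_system ::
    "real set \<Rightarrow> 'w measure \<Rightarrow> (real \<Rightarrow> 'w \<Rightarrow> 'w) \<Rightarrow> ('w \<Rightarrow> real \<Rightarrow> 'x::banach \<Rightarrow>\<^sub>L 'x) \<Rightarrow> bool"
where
  "integrable_system T M \<theta> U \<longleftrightarrow>
     separable_space (euclidean :: 'x topology) \<and>
     ergodic T M \<theta> \<and>
     (T = \<int> \<longrightarrow> integrable M (\<lambda>\<omega>. lnplus (norm (U \<omega> 1)))) \<and>
     (T = UNIV \<longrightarrow>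
        complete_measure M \<and>
        nn_L1 M (\<lambda>\<omega>. SUP s\<in>{0..1}. ennreal (lnplus (norm (U \<omega> s)))) \<and>
        nn_L1 M (\<lambda>\<omega>. SUP s\<in>{0..1}. ennreal (lnplus (norm (U (\<theta> s \<omega>) (1 - s))))))"

definition positive_system ::
    "real set \<Rightarrow> 'w measure \<Rightarrow> (real \<Rightarrow> 'w \<Rightarrow> 'w) \<Rightarrow> ('w \<Rightarrow> real \<Rightarrow> 'x::banach \<Rightarrow>\<^sub>L 'x) \<Rightarrow>
     'x set \<Rightarrow> bool"
where
  "positive_system T M \<theta> U C \<longleftrightarrow>
     ergodic T M \<theta> \<and>
     (\<forall>\<omega>\<in>space M. \<forall>t\<in>T \<inter> {0..}. \<forall>u\<^sub>1 u\<^sub>2.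
        cone_le C u\<^sub>1 u\<^sub>2 \<longrightarrow> cone_le C (U \<omega> t u\<^sub>1) (U \<omega> t u\<^sub>2))"

definition focusing_system ::
    "real set \<Rightarrow> 'w measure \<Rightarrow> (real \<Rightarrow> 'w \<Rightarrow> 'w) \<Rightarrow> ('w \<Rightarrow> real \<Rightarrow> 'x::banach \<Rightarrow>\<^sub>L 'x) \<Rightarrow>
     'x set \<Rightarrow> 'x \<Rightarrow> ('w \<Rightarrow> real) \<Rightarrow> bool"
where
  "focusing_system T M \<theta> U C e \<kappa> \<longleftrightarrow>
     positive_system T M \<theta> U C \<and>
     e \<in> C \<and> norm e = 1 \<and>
     \<kappa> \<in> borel_measurable M \<and> (\<forall>\<omega>\<in>space M. 1 \<le> \<kappa> \<omega>) \<and>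
     integrable M (\<lambda>\<omega>. lnplus (ln (\<kappa> \<omega>))) \<and>
     (\<forall>\<omega>\<in>space M. \<forall>u\<in>C - {0}. \<exists>\<beta>>0.
        cone_le C (\<beta> *\<^sub>R e) (U \<omega> 1 u) \<and> cone_le C (U \<omega> 1 u) ((\<kappa> \<omega> * \<beta>) *\<^sub>R e))"


section \<open>The dual system\<close>

lift_definition dual_map ::
    "('x::real_normed_vector \<Rightarrow>\<^sub>L 'y::real_normed_vector) \<Rightarrow> ('y \<Rightarrow>\<^sub>L real) \<Rightarrow>\<^sub>L ('x \<Rightarrow>\<^sub>L real)"
  is "\<lambda>A f. f o\<^sub>L A"
  by (rule bounded_linear_intros)+

lemma dual_map_apply: "blinfun_apply (blinfun_apply (dual_map A) f) u = f (A u)"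
  by (simp add: dual_map.rep_eq)

definition dual_flow :: "(real \<Rightarrow> 'w \<Rightarrow> 'w) \<Rightarrow> real \<Rightarrow> 'w \<Rightarrow> 'w" where
  "dual_flow \<theta> t = \<theta> (- t)"

definition dual_cocycle ::
    "(real \<Rightarrow> 'w \<Rightarrow> 'w) \<Rightarrow> ('w \<Rightarrow> real \<Rightarrow> 'x::banach \<Rightarrow>\<^sub>L 'x) \<Rightarrow>
     'w \<Rightarrow> real \<Rightarrow> ('x \<Rightarrow>\<^sub>L real) \<Rightarrow>\<^sub>L ('x \<Rightarrow>\<^sub>L real)"
where
  "dual_cocycle \<theta> U \<omega> t = dual_map (U (\<theta> (- t) \<omega>) t)"

lemma dual_cocycle_pairing:
  "blinfun_apply (blinfun_apply (dual_cocycle \<theta> U \<omega> t) f) u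
     = blinfun_apply f (blinfun_apply (U (\<theta> (- t) \<omega>) t) u)"
  by (simp add: dual_cocycle_def dual_map_apply)


section \<open>Entire orbits and principal exponents\<close>

text \<open>These notions refer to a system covering \<open>\<theta>\<close>; for the dual system, substitute
  \<open>dual_flow \<theta>\<close> and \<open>dual_cocycle \<theta> U\<close>.\<close>

definition entire_orbit ::
    "real set \<Rightarrow> (real \<Rightarrow> 'w \<Rightarrow> 'w) \<Rightarrow> ('w \<Rightarrow> real \<Rightarrow> 'x::banach \<Rightarrow>\<^sub>L 'x) \<Rightarrow>
     'w \<Rightarrow> (real \<Rightarrow> 'x) \<Rightarrow> bool"
where
  "entire_orbit T \<theta> U \<omega> v \<longleftrightarrow>
     (\<forall>s\<in>T. \<forall>t\<in>T \<inter> {0..}. v (s + t) = U (\<theta> s \<omega>) t (v s))"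

definition principal_orbit ::
    "(real \<Rightarrow> 'w \<Rightarrow> 'w) \<Rightarrow> ('w \<Rightarrow> real \<Rightarrow> 'x::banach \<Rightarrow>\<^sub>L 'x) \<Rightarrow>
     ('w \<Rightarrow> 'x) \<Rightarrow> 'w \<Rightarrow> real \<Rightarrow> 'x"
where
  "principal_orbit \<theta> U w \<omega> t =
     (if t < 0 then inv_into (span {w (\<theta> t \<omega>)}) (blinfun_apply (U (\<theta> t \<omega>) (- t))) (w \<omega>)
      else U \<omega> t (w \<omega>))"

definition growth ::
    "(real \<Rightarrow> 'w \<Rightarrow> 'w) \<Rightarrow> ('w \<Rightarrow> real \<Rightarrow> 'x::banach \<Rightarrow>\<^sub>L 'x) \<Rightarrow>
     ('w \<Rightarrow> 'x) \<Rightarrow> real \<Rightarrow> 'w \<Rightarrow> real"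
where
  "growth \<theta> U w t \<omega> =
     (if t \<ge> 0 then norm (U \<omega> t (w \<omega>)) else 1 / norm (U (\<theta> t \<omega>) (- t) (w (\<theta> t \<omega>))))"

text \<open>The integral in \<open>[-\<infinity>, \<infinity>]\<close>, needed because \<open>ln \<rho>\<^sub>1\<close> may have integral \<open>-\<infinity>\<close>. In
  \<^typ>\<open>ereal\<close>, \<open>\<infinity> - \<infinity> = \<infinity>\<close>, so a value below \<open>\<infinity>\<close> means that the positive part is integrable.\<close>

definition ext_integral :: "'w measure \<Rightarrow> ('w \<Rightarrow> real) \<Rightarrow> ereal" where
  "ext_integral M f =
     enn2ereal (\<integral>\<^sup>+\<omega>. ennreal (f \<omega>) \<partial>M) - enn2ereal (\<integral>\<^sup>+\<omega>. ennreal (- f \<omega>) \<partial>M)"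

text \<open>\<open>l \<in> [-\<infinity>, \<infinity>)\<close> is the limit of \<open>ln \<rho>\<^sub>t(\<omega>) / t\<close> as \<open>t \<rightarrow> \<plusminus>\<infinity>\<close> within \<open>T\<close>, for every \<open>\<omega> \<in> F\<close>,
  and equals the integral of \<open>ln \<rho>\<^sub>1\<close>, a function defined on the set \<open>F\<close> of full measure.\<close>

definition growth_exponent ::
    "real set \<Rightarrow> 'w measure \<Rightarrow> (real \<Rightarrow> 'w \<Rightarrow> 'w) \<Rightarrow> ('w \<Rightarrow> real \<Rightarrow> 'x::banach \<Rightarrow>\<^sub>L 'x) \<Rightarrow>
     'w set \<Rightarrow> ('w \<Rightarrow> 'x) \<Rightarrow> ereal \<Rightarrow> bool"
where
  "growth_exponent T M \<theta> U F w l \<longleftrightarrow>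
     l < \<infinity> \<and>
     (\<forall>\<omega>\<in>F.
        ((\<lambda>t. ereal (1 / t * ln (growth \<theta> U w t \<omega>))) \<longlongrightarrow> l) (inf at_top (principal T)) \<and>
        ((\<lambda>t. ereal (1 / t * ln (growth \<theta> U w t \<omega>))) \<longlongrightarrow> l) (inf at_bot (principal T))) \<and>
     l = ext_integral (restrict_space M F) (\<lambda>\<omega>. ln (growth \<theta> U w 1 \<omega>))"

definition principal_exponent ::
    "real set \<Rightarrow> 'w measure \<Rightarrow> (real \<Rightarrow> 'w \<Rightarrow> 'w) \<Rightarrow> ('w \<Rightarrow> real \<Rightarrow> 'x::banach \<Rightarrow>\<^sub>L 'x) \<Rightarrow>
     'x set \<Rightarrow> 'x \<Rightarrow> ereal \<Rightarrow> bool"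
where
  "principal_exponent T M \<theta> U C e l \<longleftrightarrow>
     (\<exists>F w.
        F \<in> sets M \<and> invariant_set T M \<theta> F \<and> measure M F = 1 \<and>
        w \<in> measurable (restrict_space M F) borel \<and>
        (\<forall>\<omega>\<in>F. w \<omega> \<in> cone_component C e \<and> norm (w \<omega>) = 1) \<and>
        (\<forall>\<omega>\<in>F. \<forall>t\<in>T \<inter> {0..}. w (\<theta> t \<omega>) = U \<omega> t (w \<omega>) /\<^sub>R norm (U \<omega> t (w \<omega>))) \<and>
        growth_exponent T M \<theta> U F w l)"

end

theory Submission
  imports Defs
begin

text \<open>The dual system satisfies the hypotheses of an integrable, positive and focusing system over the
  reversed flow, so the first three claims are proved for an arbitrary such system \<open>U\<close> over a flow
  \<open>\<theta>\<close> and then specialised.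

  The direction. A positive operator that sends the cone into the vectors comparable with \<open>e\<close> up to a
  factor \<open>k\<close> shrinks the oscillation of one vector relative to another by the factor \<open>1 - 1/k\<close>
  (\<open>oscillation_contraction\<close>, a form of the Hopf-Birkhoff contraction). Along the past of almost every
  point, \<open>\<kappa>\<close> is infinitely often below a fixed bound (\<open>recurrence\<close>); hence all positive states started
  at time \<open>- n\<close> acquire the same direction at time \<open>0\<close> as \<open>n\<close> grows
  (\<open>contracting_of_recurrent\<close>). A monotone norm turns small oscillation into small distance, so the
  normalised pullbacks of \<open>e\<close> converge. The limit is carried along by the system
  (\<open>direction_flow\<close>), and it is the direction of each state of a positive entire orbit, because such a
  state is a pullback from every past time (\<open>positive_entire_orbit\<close>).

  The exponent. The logarithm of the growth factor along this direction is a real cocycle over the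
  flow whose value at time 1 has an integrable positive part. Its rate of growth is the integral of
  that value: this is Birkhoff's theorem for an ergodic flow, derived from the maximal ergodic
  inequality (\<open>maximal_ergodic\<close>). For real time the map \<open>\<theta> 1\<close> alone may fail to be ergodic, so the
  zero-one law is applied to events defined by all real times; the integrable suprema over the unit
  interval compare them with events at integer times (\<open>eventually_le_slope\<close>). Applying this also to
  the reversed flow gives the limits in both directions. Completeness of the measure makes the
  exceptional sets, which must be invariant under uncountably many times, measurable.

  Equality of the exponents. If \<open>w\<close> and \<open>ws\<close> are the directions of the system and of its dual and
  \<open>p \<omega> = ws \<omega> (w \<omega>)\<close>, then the duality of \<open>U\<close> and its dual cocycle shows that the growth factors over
  \<open>n\<close> steps differ by the quotient of \<open>p\<close> at the two ends. The function \<open>p\<close> is positive, as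
  \<open>es e > 0\<close> (\<open>pairing_pos\<close>), and at infinitely many times it is bounded below by a fixed positive
  number, so the exponents agree (\<open>exponents_equal\<close>).\<close>

section \<open>The order of a cone and the oscillation of one vector relative to another\<close>

locale ordered_cone =
  fixes C :: "'x::banach set"
  assumes ordered: "ordered_banach C"
begin

abbreviation below (infix "\<preceq>" 50) where "u \<preceq> v \<equiv> cone_le C u v"

lemma cone_closed: "closed C" and cone_pointed: "C \<inter> uminus ` C = {0}"
  using ordered by (auto simp: ordered_banach_def)

lemma cone_scale: "x \<in> C \<Longrightarrow> 0 \<le> a \<Longrightarrow> a *\<^sub>R x \<in> C"
  using ordered by (auto simp: ordered_banach_def cone_def)

lemma cone_plus: "x \<in> C \<Longrightarrow> y \<in> C \<Longrightarrow> x + y \<in> C"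
  using ordered convex_cone[of C] by (auto simp: ordered_banach_def)

lemma cone_zero: "0 \<in> C"
  using cone_pointed by auto

lemma cone_antisym: "x \<in> C \<Longrightarrow> - x \<in> C \<Longrightarrow> x = 0"
  using cone_pointed by (metis IntI image_eqI minus_minus singletonD)

lemma below_refl [simp]: "u \<preceq> u"
  by (simp add: cone_le_def cone_zero)

lemma below_trans [trans]: "u \<preceq> v \<Longrightarrow> v \<preceq> w \<Longrightarrow> u \<preceq> w"
  using cone_plus[of "v - u" "w - v"] by (simp add: cone_le_def)

lemma below_add: "u \<preceq> v \<Longrightarrow> u' \<preceq> v' \<Longrightarrow> u + u' \<preceq> v + v'"
  using cone_plus[of "v - u" "v' - u'"] by (simp add: cone_le_def algebra_simps)

lemma below_scale: "u \<preceq> v \<Longrightarrow> 0 \<le> a \<Longrightarrow> a *\<^sub>R u \<preceq> a *\<^sub>R v"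
  using cone_scale[of "v - u" a] by (simp add: cone_le_def algebra_simps)

lemma below_scaleR_left: "v \<in> C \<Longrightarrow> a \<le> b \<Longrightarrow> a *\<^sub>R v \<preceq> b *\<^sub>R v"
  using cone_scale[of v "b - a"] by (simp add: cone_le_def algebra_simps)

lemma zero_below: "0 \<preceq> v \<longleftrightarrow> v \<in> C"
  by (simp add: cone_le_def)

lemma below_imp_cone: "u \<preceq> v \<Longrightarrow> u \<in> C \<Longrightarrow> v \<in> C"
  using below_trans zero_below by blast

lemma below_scaleR_left_cancel:
  assumes "v \<in> C - {0}" "a *\<^sub>R v \<preceq> b *\<^sub>R v"
  shows "a \<le> b"
proof (rule ccontr)
  assume "\<not> a \<le> b"
  then have ab: "a > b" by simp
  have "(b - a) *\<^sub>R v \<in> C"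
    using assms(2) by (simp add: cone_le_def algebra_simps)
  moreover have "(a - b) *\<^sub>R v \<in> C"
    using assms(1) ab by (intro cone_scale) auto
  moreover have "(b - a) *\<^sub>R v = - ((a - b) *\<^sub>R v)" by (simp add: algebra_simps)
  ultimately have "(a - b) *\<^sub>R v = 0" by (metis cone_antisym)
  then show False using assms(1) ab by simp
qed

text \<open>The quotient of \<open>u\<close> by \<open>v\<close> in the sense of the order varies by at most the factor \<open>1 + \<epsilon>\<close>. The
  relation depends on the rays of \<open>u\<close> and \<open>v\<close> only, and it says that their distance in Hilbert's
  projective metric is at most \<open>ln (1 + \<epsilon>)\<close>.\<close>

definition osc_le :: "real \<Rightarrow> 'x \<Rightarrow> 'x \<Rightarrow> bool" where
  "osc_le \<epsilon> u v \<longleftrightarrow> (\<exists>a>0. a *\<^sub>R v \<preceq> u \<and> u \<preceq> ((1 + \<epsilon>) * a) *\<^sub>R v)"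

lemma osc_le_scaleR:
  assumes "osc_le \<epsilon> u v" "0 < p" "0 < q"
  shows "osc_le \<epsilon> (p *\<^sub>R u) (q *\<^sub>R v)"
proof -
  obtain a where a: "a > 0" "a *\<^sub>R v \<preceq> u" "u \<preceq> ((1 + \<epsilon>) * a) *\<^sub>R v"
    using assms(1) by (auto simp: osc_le_def)
  have "(a * p / q) *\<^sub>R (q *\<^sub>R v) \<preceq> p *\<^sub>R u"
    using below_scale[OF a(2), of p] assms by (simp add: ac_simps)
  moreover have "p *\<^sub>R u \<preceq> ((1 + \<epsilon>) * (a * p / q)) *\<^sub>R (q *\<^sub>R v)"
    using below_scale[OF a(3), of p] assms by (simp add: ac_simps)
  ultimately show ?thesis
    using a(1) assms unfolding osc_le_def by (intro exI[of _ "a * p / q"]) auto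
qed

definition positive_map :: "('x \<Rightarrow>\<^sub>L 'x) \<Rightarrow> bool" where
  "positive_map L \<longleftrightarrow> (\<forall>u v. u \<preceq> v \<longrightarrow> L u \<preceq> L v)"

lemma osc_le_map:
  assumes "osc_le \<epsilon> u v" "positive_map L"
  shows "osc_le \<epsilon> (L u) (L v)"
proof -
  obtain a where a: "a > 0" "a *\<^sub>R v \<preceq> u" "u \<preceq> ((1 + \<epsilon>) * a) *\<^sub>R v"
    using assms(1) by (auto simp: osc_le_def)
  have "a *\<^sub>R L v \<preceq> L u" "L u \<preceq> ((1 + \<epsilon>) * a) *\<^sub>R L v"
    using assms(2) a unfolding positive_map_def by (metis blinfun.scaleR_right)+
  then show ?thesis using a(1) by (auto simp: osc_le_def)
qed

lemma positive_map_cone: "positive_map L \<Longrightarrow> x \<in> C \<Longrightarrow> L x \<in> C"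
  unfolding positive_map_def by (metis blinfun.zero_right zero_below)

text \<open>Monotonicity of the norm forces the lower factor to be at most 1 for unit vectors, so that
  a small relative oscillation becomes a small distance.\<close>

lemma osc_le_imp_norm_diff_le:
  assumes mono: "monotonic_norm C" and osc: "osc_le \<epsilon> u v"
    and v: "v \<in> C" and unit: "norm u = 1" "norm v = 1" and "0 \<le> \<epsilon>"
  shows "norm (u - v) \<le> 2 * \<epsilon>"
proof -
  obtain a where a: "a > 0" "a *\<^sub>R v \<preceq> u" "u \<preceq> ((1 + \<epsilon>) * a) *\<^sub>R v"
    using osc by (auto simp: osc_le_def)
  have av: "a *\<^sub>R v \<in> C" using v a by (intro cone_scale) auto
  then have u: "u \<in> C" using a(2) below_imp_cone by blast
  have mono': "norm x \<le> norm y" if "x \<in> C" "x \<preceq> y" for x y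
    using mono that by (auto simp: monotonic_norm_def zero_below)
  have a1: "a \<le> 1" using mono'[OF av a(2)] a unit by simp
  have a2: "1 \<le> (1 + \<epsilon>) * a" using mono'[OF u a(3)] a unit assms by simp
  have "norm (u - a *\<^sub>R v) \<le> norm ((\<epsilon> * a) *\<^sub>R v)"
    by (rule mono') (use a(2,3) in \<open>auto simp: cone_le_def algebra_simps\<close>)
  also have "\<dots> \<le> \<epsilon>" using unit a a1 assms mult_left_le[of a \<epsilon>] by simp
  finally have 1: "norm (u - a *\<^sub>R v) \<le> \<epsilon>" .
  have "norm ((1 - a) *\<^sub>R v) = 1 - a" using unit a1 by simp
  also have "\<dots> \<le> \<epsilon> * a" using a2 by (simp add: algebra_simps)
  also have "\<dots> \<le> \<epsilon>" using a1 assms mult_left_le[of a \<epsilon>] by simp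
  finally have 2: "norm ((1 - a) *\<^sub>R v) \<le> \<epsilon>" .
  have "u - v = (u - a *\<^sub>R v) - (1 - a) *\<^sub>R v" by (simp add: algebra_simps)
  then have "norm (u - v) \<le> norm (u - a *\<^sub>R v) + norm ((1 - a) *\<^sub>R v)"
    by (metis norm_triangle_ineq4)
  then show ?thesis using 1 2 by linarith
qed

definition focuses :: "'x \<Rightarrow> real \<Rightarrow> ('x \<Rightarrow>\<^sub>L 'x) \<Rightarrow> bool" where
  "focuses e k L \<longleftrightarrow>
     (\<forall>x\<in>C - {0}. \<exists>\<beta>>0. \<beta> *\<^sub>R e \<preceq> L x \<and> L x \<preceq> (k * \<beta>) *\<^sub>R e)"

lemma focuses_nonzero:
  assumes "focuses e k L" "e \<in> C - {0}" "x \<in> C - {0}"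
  shows "L x \<in> C - {0}"
proof -
  obtain b where b: "b > 0" "b *\<^sub>R e \<preceq> L x" using assms by (auto simp: focuses_def)
  have "b *\<^sub>R e \<in> C" using assms b by (intro cone_scale) auto
  then have "L x \<in> C" using b below_imp_cone by blast
  moreover have "L x \<noteq> 0"
  proof
    assume "L x = 0"
    then have "- (b *\<^sub>R e) \<in> C" using b by (simp add: cone_le_def)
    with \<open>b *\<^sub>R e \<in> C\<close> have "b *\<^sub>R e = 0" using cone_antisym by blast
    then show False using b assms by simp
  qed
  ultimately show ?thesis by simp
qed

text \<open>Both differences \<open>u - a v\<close> and \<open>b v - u\<close> are sent into the narrow cone of the vectors
  comparable with \<open>e\<close> up to the factor \<open>k\<close>, and their sum is \<open>(b - a) v\<close>. Each image therefore
  dominates a multiple of \<open>L v\<close>; the two multiples add up to \<open>(b - a) / k\<close>, and they can be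
  subtracted from the two ends of the interval \<open>[a, b]\<close>.\<close>

lemma oscillation_contraction:
  assumes foc: "focuses e k L" and k: "1 \<le> k" and e: "e \<in> C - {0}" and v: "v \<in> C - {0}"
    and ab: "a *\<^sub>R v \<preceq> u" "u \<preceq> b *\<^sub>R v"
  shows "\<exists>a'\<ge>a. \<exists>b'\<le>b. b' - a' \<le> (1 - 1 / k) * (b - a) \<and> a' *\<^sub>R L v \<preceq> L u \<and> L u \<preceq> b' *\<^sub>R L v"
proof -
  have "a \<le> b" using below_scaleR_left_cancel[OF v] ab below_trans by blast
  have fac: "0 \<le> (1 - 1 / k) * (b - a)" using k \<open>a \<le> b\<close> by simp
  let ?x = "u - a *\<^sub>R v" and ?y = "b *\<^sub>R v - u"
  consider "?x = 0" | "?y = 0" | "?x \<noteq> 0" "?y \<noteq> 0" by blast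
  then show ?thesis
  proof cases
    case 1
    then have "L u = a *\<^sub>R L v" by (simp add: blinfun.scaleR_right)
    then show ?thesis using fac \<open>a \<le> b\<close> by (intro exI[of _ a] conjI) auto
  next
    case 2
    then have "L u = b *\<^sub>R L v" by (metis blinfun.scaleR_right eq_iff_diff_eq_0)
    then show ?thesis using fac \<open>a \<le> b\<close> by (intro exI[of _ b] conjI) auto
  next
    case 3
    then have xy: "?x \<in> C - {0}" "?y \<in> C - {0}" using ab by (auto simp: cone_le_def)
    obtain p where p: "p > 0" "p *\<^sub>R e \<preceq> L ?x" "L ?x \<preceq> (k * p) *\<^sub>R e"
      using foc xy by (metis focuses_def)
    obtain q where q: "q > 0" "q *\<^sub>R e \<preceq> L ?y" "L ?y \<preceq> (k * q) *\<^sub>R e"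
      using foc xy by (metis focuses_def)
    define s where "s = (b - a) / (k * (p + q))"
    have s0: "s \<ge> 0" using \<open>a \<le> b\<close> k p q by (simp add: s_def)
    have sum: "L ?x + L ?y = (b - a) *\<^sub>R L v"
      by (simp add: blinfun.bilinear_simps algebra_simps)
    have "(b - a) *\<^sub>R L v \<preceq> (k * (p + q)) *\<^sub>R e"
      using below_add[OF p(3) q(3)] sum by (simp add: algebra_simps)
    from below_scale[OF this, of "1 / (k * (p + q))"]
    have "s *\<^sub>R L v \<preceq> e" using k p q by (simp add: s_def)
    then have px: "(s * p) *\<^sub>R L v \<preceq> L ?x" and qy: "(s * q) *\<^sub>R L v \<preceq> L ?y"
      using below_trans[OF below_scale[of "s *\<^sub>R L v" e p] p(2)]
        below_trans[OF below_scale[of "s *\<^sub>R L v" e q] q(2)] p(1) q(1)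
      by (simp_all add: ac_simps)
    have 1: "(a + s * p) *\<^sub>R L v \<preceq> L u"
      using px by (simp add: cone_le_def blinfun.bilinear_simps algebra_simps)
    have 2: "L u \<preceq> (b - s * q) *\<^sub>R L v"
      using qy by (simp add: cone_le_def blinfun.bilinear_simps algebra_simps)
    have "s * (p + q) = (b - a) / k" 
      using p q nonzero_mult_divide_mult_cancel_right[of "p + q" "b - a" k] by (simp add: s_def)
    then have 3: "(b - s * q) - (a + s * p) \<le> (1 - 1 / k) * (b - a)"
      by (simp add: algebra_simps)
    show ?thesis
      using 1 2 3 s0 p q by (intro exI[of _ "a + s * p"] exI[of _ "b - s * q"] conjI) auto
  qed
qed

end

section \<open>Measure-preserving flows\<close>

locale measurable_flow = prob_space M
  for M :: "'w measure" +
  fixes T :: "real set" and \<theta> :: "real \<Rightarrow> 'w \<Rightarrow> 'w"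
  assumes time: "T = \<int> \<or> T = UNIV"
    and flow: "metric_dynamical_system T M \<theta>"
begin

lemma time_simps [simp]: "0 \<in> T" "1 \<in> T" "real n \<in> T" "- real n \<in> T"
  using time by auto

lemma time_add [intro, simp]: "s \<in> T \<Longrightarrow> t \<in> T \<Longrightarrow> s + t \<in> T"
  and time_diff [intro, simp]: "s \<in> T \<Longrightarrow> t \<in> T \<Longrightarrow> s - t \<in> T"
  and time_minus [intro, simp]: "t \<in> T \<Longrightarrow> - t \<in> T"
  using time by auto

abbreviation forward :: "real filter" where
  "forward \<equiv> inf at_top (principal T)"

lemma eventually_forward: "eventually P forward \<longleftrightarrow> (\<exists>N. \<forall>t\<in>T. N \<le> t \<longrightarrow> P t)"
  by (auto simp: eventually_inf_principal eventually_at_top_linorder)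

lemma frequently_forward: "frequently P forward \<longleftrightarrow> (\<forall>N. \<exists>t\<in>T. N \<le> t \<and> P t)"
  by (auto simp: frequently_def eventually_forward)

lemma eventually_forward_shift:
  assumes "eventually P forward" "s \<in> T"
  shows "eventually (\<lambda>t. P (t + s)) forward"
proof -
  obtain N where "\<forall>t\<in>T. N \<le> t \<longrightarrow> P t" using assms by (auto simp: eventually_forward)
  then have "\<forall>t\<in>T. N - s \<le> t \<longrightarrow> P (t + s)" using assms by auto
  then show ?thesis by (auto simp: eventually_forward)
qed

lemma flow_measurable [measurable]: "t \<in> T \<Longrightarrow> \<theta> t \<in> measurable M M"
proof -
  assume t: "t \<in> T"
  have 1: "(\<lambda>(t, \<omega>). \<theta> t \<omega>) \<in> measurable (restrict_space borel T \<Otimes>\<^sub>M M) M"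
    using flow by (simp add: metric_dynamical_system_def)
  have "(\<lambda>\<omega>. (t, \<omega>)) \<in> measurable M (restrict_space borel T \<Otimes>\<^sub>M M)"
    using t by (intro measurable_Pair measurable_const) (auto simp: space_restrict_space)
  from measurable_compose[OF this 1] show ?thesis by simp
qed

lemma flow_space [simp, intro]: "t \<in> T \<Longrightarrow> \<omega> \<in> space M \<Longrightarrow> \<theta> t \<omega> \<in> space M"
  using flow_measurable by (rule measurable_space)

lemma flow_zero [simp]: "\<omega> \<in> space M \<Longrightarrow> \<theta> 0 \<omega> = \<omega>"
  using flow by (simp add: metric_dynamical_system_def)

lemma flow_flow: "s \<in> T \<Longrightarrow> t \<in> T \<Longrightarrow> \<omega> \<in> space M \<Longrightarrow> \<theta> s (\<theta> t \<omega>) = \<theta> (t + s) \<omega>"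
  using flow by (simp add: metric_dynamical_system_def)

lemma flow_preserves: "t \<in> T \<Longrightarrow> distr M M (\<theta> t) = M"
  using flow by (simp add: metric_dynamical_system_def)

lemma AE_flow: "AE \<omega> in M. P \<omega> \<Longrightarrow> t \<in> T \<Longrightarrow> AE \<omega> in M. P (\<theta> t \<omega>)"
  by (rule AE_distrD[of "\<theta> t" M M]) (simp_all only: flow_preserves flow_measurable)

lemma nn_integral_flow:
  "t \<in> T \<Longrightarrow> f \<in> borel_measurable M \<Longrightarrow> (\<integral>\<^sup>+\<omega>. f (\<theta> t \<omega>) \<partial>M) = (\<integral>\<^sup>+\<omega>. f \<omega> \<partial>M)"
  using nn_integral_distr[of "\<theta> t" M M f] by (simp add: flow_preserves)

lemma integral_flow:
  fixes f :: "'w \<Rightarrow> real"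
  shows "t \<in> T \<Longrightarrow> f \<in> borel_measurable M \<Longrightarrow> (\<integral>\<omega>. f (\<theta> t \<omega>) \<partial>M) = (\<integral>\<omega>. f \<omega> \<partial>M)"
  using integral_distr[of "\<theta> t" M M f] by (simp add: flow_preserves)

lemma integrable_flow:
  fixes f :: "'w \<Rightarrow> real"
  shows "t \<in> T \<Longrightarrow> integrable M f \<Longrightarrow> integrable M (\<lambda>\<omega>. f (\<theta> t \<omega>))"
  using integrable_distr[of "\<theta> t" M M f] by (simp add: flow_preserves)

lemma invariant_setI:
  assumes "F \<subseteq> space M" "\<And>\<omega> t. \<omega> \<in> F \<Longrightarrow> t \<in> T \<Longrightarrow> \<theta> t \<omega> \<in> F"
  shows "invariant_set T M \<theta> F"
proof -
  have "\<omega> \<in> \<theta> t ` F" if "\<omega> \<in> F" "t \<in> T" for \<omega> t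
  proof (rule image_eqI)
    show "\<omega> = \<theta> t (\<theta> (- t) \<omega>)" using that assms(1) by (auto simp: flow_flow)
    show "\<theta> (- t) \<omega> \<in> F" using that assms(2) by simp
  qed
  then show ?thesis using assms unfolding invariant_set_def by blast
qed

lemma invariant_setD:
  "invariant_set T M \<theta> F \<Longrightarrow> \<omega> \<in> F \<Longrightarrow> t \<in> T \<Longrightarrow> \<theta> t \<omega> \<in> F"
  "invariant_set T M \<theta> F \<Longrightarrow> \<omega> \<in> F \<Longrightarrow> \<omega> \<in> space M"
  unfolding invariant_set_def by blast+

text \<open>A weak form of recurrence: by Fatou's lemma the set on which
  \<open>k\<close> tends to infinity along the times \<open>\<tau> n\<close> has at most the measure of \<open>{k > K}\<close>, for every \<open>K\<close>.\<close>

lemma recurrence: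
  assumes k [measurable]: "k \<in> borel_measurable M" and \<tau>: "\<And>n. \<tau> n \<in> T"
  shows "AE \<omega> in M. \<exists>K::real. \<exists>\<^sub>F n in sequentially. k (\<theta> (\<tau> n) \<omega>) \<le> K"
proof -
  have [measurable]: "\<theta> (\<tau> n) \<in> measurable M M" for n using \<tau> by simp
  define B where "B = {\<omega>\<in>space M. \<forall>K::nat. \<forall>\<^sub>F n in sequentially. k (\<theta> (\<tau> n) \<omega>) > K}"
  have B [measurable]: "B \<in> sets M"
    unfolding B_def eventually_sequentially by measurable
  have bound: "emeasure M B \<le> emeasure M {\<omega>\<in>space M. k \<omega> > real K}" for K :: nat
  proof -
    let ?A = "{\<omega>\<in>space M. k \<omega> > real K}"
    let ?u = "\<lambda>n \<omega>. indicator ?A (\<theta> (\<tau> n) \<omega>) :: ennreal"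
    have "emeasure M B = (\<integral>\<^sup>+\<omega>. indicator B \<omega> \<partial>M)" by simp
    also have "\<dots> \<le> (\<integral>\<^sup>+\<omega>. liminf (\<lambda>n. ?u n \<omega>) \<partial>M)"
    proof (rule nn_integral_mono)
      fix \<omega> assume "\<omega> \<in> space M"
      show "indicator B \<omega> \<le> liminf (\<lambda>n. ?u n \<omega>)"
      proof (cases "\<omega> \<in> B")
        case True
        then have "\<forall>\<^sub>F n in sequentially. k (\<theta> (\<tau> n) \<omega>) > real K" by (simp add: B_def)
        then have "\<forall>\<^sub>F n in sequentially. 1 \<le> ?u n \<omega>"
          by eventually_elim (use \<tau> \<open>\<omega> \<in> space M\<close> in auto)
        then have "1 \<le> liminf (\<lambda>n. ?u n \<omega>)" by (rule Liminf_bounded)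
        then show ?thesis using True by simp
      qed simp
    qed
    also have "\<dots> \<le> liminf (\<lambda>n. \<integral>\<^sup>+\<omega>. ?u n \<omega> \<partial>M)"
      by (intro nn_integral_liminf) measurable
    also have "(\<lambda>n. \<integral>\<^sup>+\<omega>. ?u n \<omega> \<partial>M) = (\<lambda>n. emeasure M ?A)"
      using \<tau> nn_integral_flow[of "\<tau> _" "indicator ?A"] by (intro ext) simp
    finally show ?thesis by (simp add: Liminf_const)
  qed
  have "(\<lambda>K::nat. emeasure M {\<omega>\<in>space M. k \<omega> > real K}) \<longlonglongrightarrow>
      emeasure M (\<Inter>K::nat. {\<omega>\<in>space M. k \<omega> > real K})"
    by (intro Lim_emeasure_decseq) (auto simp: decseq_def)
  moreover have "(\<Inter>K::nat. {\<omega>\<in>space M. k \<omega> > real K}) = {}"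
  proof -
    have False if "\<And>K::nat. k \<omega> > real K" for \<omega>
      using that reals_Archimedean2[of "k \<omega>"] less_asym by blast
    then show ?thesis by auto
  qed
  ultimately have lim: "(\<lambda>K::nat. emeasure M {\<omega>\<in>space M. k \<omega> > real K}) \<longlonglongrightarrow> 0" by simp
  have "emeasure M B \<le> 0"
    by (rule LIMSEQ_le_const[OF lim]) (use bound in auto)
  then have "AE \<omega> in M. \<omega> \<notin> B" using B by (intro AE_not_in) auto
  then show ?thesis
  proof (rule AE_mp, intro AE_I2 impI)
    fix \<omega> assume "\<omega> \<in> space M" "\<omega> \<notin> B"
    then show "\<exists>K. \<exists>\<^sub>F n in sequentially. k (\<theta> (\<tau> n) \<omega>) \<le> K"
      by (auto simp: B_def not_eventually not_less)
  qed
qed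

text \<open>The number of \<open>n\<close> with \<open>c > \<epsilon> n\<close> is at most \<open>\<bar>c\<bar> / \<epsilon> + 1\<close>, an integrable function, so by invariance of the measure the events \<open>c \<circ> \<theta>\<^sub>n > \<epsilon> n\<close> have summable
  probabilities, and the Borel-Cantelli lemma applies.\<close>

lemma integrable_sublinear:
  fixes c :: "'w \<Rightarrow> real"
  assumes c: "integrable M c"
  shows "AE \<omega> in M. \<forall>\<epsilon>>0. \<forall>\<^sub>F n in sequentially. c (\<theta> (real n) \<omega>) \<le> \<epsilon> * real n"
proof -
  have cm [measurable]: "c \<in> borel_measurable M" using c by simp
  have [measurable]: "\<theta> (real n) \<in> measurable M M" for n by simp
  have "AE \<omega> in M. \<forall>\<^sub>F n in sequentially. c (\<theta> (real n) \<omega>) \<le> \<epsilon> * real n" if \<epsilon>: "\<epsilon> > 0" for \<epsilon>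
  proof -
    let ?A = "\<lambda>n. {\<omega>\<in>space M. c \<omega> > \<epsilon> * real n}"
    let ?B = "\<lambda>n. {\<omega>\<in>space M. c (\<theta> (real n) \<omega>) > \<epsilon> * real n}"
    have eq: "emeasure M (?B n) = emeasure M (?A n)" for n
    proof -
      have "emeasure M (?A n) = emeasure (distr M M (\<theta> (real n))) (?A n)"
        by (simp add: flow_preserves)
      also have "\<dots> = emeasure M (\<theta> (real n) -` ?A n \<inter> space M)"
        by (rule emeasure_distr) measurable
      also have "\<theta> (real n) -` ?A n \<inter> space M = ?B n" by auto
      finally show ?thesis by simp
    qed
    have "(\<Sum>n. emeasure M (?B n)) = (\<Sum>n. \<integral>\<^sup>+\<omega>. indicator (?A n) \<omega> \<partial>M)"
      by (simp add: eq)
    also have "\<dots> = (\<integral>\<^sup>+\<omega>. (\<Sum>n. indicator (?A n) \<omega>) \<partial>M)"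
      by (rule nn_integral_suminf[symmetric]) measurable
    also have "\<dots> \<le> (\<integral>\<^sup>+\<omega>. ennreal (\<bar>c \<omega>\<bar> / \<epsilon> + 1) \<partial>M)"
    proof (rule nn_integral_mono)
      fix \<omega>
      define N where "N = nat \<lceil>c \<omega> / \<epsilon>\<rceil>"
      have out: "indicator (?A n) \<omega> = (0::ennreal)" if "n \<notin> {..<N}" for n
      proof -
        have "c \<omega> / \<epsilon> \<le> real n" using that by (simp add: N_def) linarith
        then show ?thesis using \<epsilon> by (simp add: field_simps)
      qed
      have "(\<Sum>n. indicator (?A n) \<omega>) = (\<Sum>n<N. indicator (?A n) \<omega> :: ennreal)"
        using out by (intro suminf_finite) auto
      also have "\<dots> \<le> (\<Sum>n<N. 1)" by (intro sum_mono) (simp add: indicator_def)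
      also have "\<dots> = ennreal (real N)" by (simp add: ennreal_of_nat_eq_real_of_nat)
      also have "\<dots> \<le> ennreal (\<bar>c \<omega>\<bar> / \<epsilon> + 1)"
      proof (rule ennreal_leI)
        have "c \<omega> / \<epsilon> \<le> \<bar>c \<omega>\<bar> / \<epsilon>" "0 \<le> \<bar>c \<omega>\<bar> / \<epsilon>" using \<epsilon> by (auto intro: divide_right_mono)
        then show "real N \<le> \<bar>c \<omega>\<bar> / \<epsilon> + 1" unfolding N_def by linarith
      qed
      finally show "(\<Sum>n. indicator (?A n) \<omega>) \<le> ennreal (\<bar>c \<omega>\<bar> / \<epsilon> + 1)" .
    qed
    also have "\<dots> < \<infinity>"
    proof -
      have "integrable M (\<lambda>\<omega>. \<bar>c \<omega>\<bar> / \<epsilon> + 1)" using c by auto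
      then show ?thesis using \<epsilon> by (subst (asm) integrable_iff_bounded) auto
    qed
    finally have "(\<Sum>n. emeasure M (?B n)) \<noteq> \<infinity>" by simp
    then have "summable (\<lambda>n. measure M (?B n))"
      by (intro summable_suminf_not_top) (simp_all add: emeasure_eq_measure)
    then have "AE \<omega> in M. \<forall>\<^sub>F n in sequentially. \<omega> \<in> space M - ?B n"
      by (intro borel_cantelli_AE1) (auto simp: emeasure_eq_measure)
    then show ?thesis
      by eventually_elim (auto elim!: eventually_mono)
  qed
  then have "AE \<omega> in M. \<forall>m. \<forall>\<^sub>F n in sequentially.
      c (\<theta> (real n) \<omega>) \<le> (1 / real (Suc m)) * real n"
    by (subst AE_all_countable) (simp del: times_divide_eq_left)
  then show ?thesis
  proof eventually_elim
    case (elim \<omega>)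
    show ?case
    proof (intro allI impI)
      fix \<epsilon> :: real assume "\<epsilon> > 0"
      then obtain m where m: "1 / real (Suc m) < \<epsilon>" using nat_approx_posE by blast
      show "\<forall>\<^sub>F n in sequentially. c (\<theta> (real n) \<omega>) \<le> \<epsilon> * real n"
        using spec[OF elim, of m]
      proof eventually_elim
        case (elim n)
        have "1 / real (Suc m) * real n \<le> \<epsilon> * real n" using m by (intro mult_right_mono) auto
        then show ?case using elim by linarith
      qed
    qed
  qed
qed

section \<open>The maximal ergodic inequality\<close>

definition birkhoff_sum :: "('w \<Rightarrow> real) \<Rightarrow> nat \<Rightarrow> 'w \<Rightarrow> real" where
  "birkhoff_sum f n \<omega> = (\<Sum>k<n. f (\<theta> (real k) \<omega>))"

lemma birkhoff_sum_Suc: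
  assumes "\<omega> \<in> space M"
  shows "birkhoff_sum f (Suc n) \<omega> = f \<omega> + birkhoff_sum f n (\<theta> 1 \<omega>)"
proof -
  have "(\<Sum>k<n. f (\<theta> (real (Suc k)) \<omega>)) = (\<Sum>k<n. f (\<theta> (real k) (\<theta> 1 \<omega>)))"
    using assms by (intro sum.cong) (simp_all add: flow_flow)
  then show ?thesis using assms
    unfolding birkhoff_sum_def sum.lessThan_Suc_shift by simp
qed

lemma birkhoff_sum_measurable [measurable]:
  "f \<in> borel_measurable M \<Longrightarrow> birkhoff_sum f n \<in> borel_measurable M"
proof -
  assume [measurable]: "f \<in> borel_measurable M"
  have [measurable]: "\<theta> (real n) \<in> measurable M M" for n by simp
  show ?thesis unfolding birkhoff_sum_def[abs_def] by measurable
qed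

text \<open>This is the maximum of the Birkhoff sums of length at most \<open>N\<close>, the empty one included. The
  recursion replaces the usual manipulation of maxima in Garsia's proof.\<close>

primrec max_sum :: "('w \<Rightarrow> real) \<Rightarrow> nat \<Rightarrow> 'w \<Rightarrow> real" where
  "max_sum f 0 \<omega> = 0"
| "max_sum f (Suc N) \<omega> = max 0 (f \<omega> + max_sum f N (\<theta> 1 \<omega>))"

lemma max_sum_nonneg: "0 \<le> max_sum f N \<omega>"
  by (cases N) auto

lemma max_sum_mono: "max_sum f N \<omega> \<le> max_sum f (Suc N) \<omega>"
proof (induction N arbitrary: \<omega>)
  case (Suc N)
  show ?case using Suc[of "\<theta> 1 \<omega>"] by (simp del: max_sum.simps(2) add: max_sum.simps(2)[of f])
qed simp

lemma birkhoff_sum_le_max_sum: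
  "n \<le> N \<Longrightarrow> \<omega> \<in> space M \<Longrightarrow> birkhoff_sum f n \<omega> \<le> max_sum f N \<omega>"
proof (induction n arbitrary: N \<omega>)
  case 0
  then show ?case by (simp add: birkhoff_sum_def max_sum_nonneg)
next
  case (Suc n)
  then obtain N' where N: "N = Suc N'" "n \<le> N'" by (cases N) auto
  have "birkhoff_sum f n (\<theta> 1 \<omega>) \<le> max_sum f N' (\<theta> 1 \<omega>)" using Suc N by auto
  then show ?case using N Suc.prems by (simp add: birkhoff_sum_Suc)
qed

lemma max_sum_integrable: "integrable M f \<Longrightarrow> integrable M (max_sum f N)"
proof (induction N)
  case (Suc N)
  then have "integrable M (\<lambda>\<omega>. f \<omega> + max_sum f N (\<theta> 1 \<omega>))"
    by (intro Bochner_Integration.integrable_add integrable_flow) auto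
  then have "integrable M (\<lambda>\<omega>. max 0 (f \<omega> + max_sum f N (\<theta> 1 \<omega>)))" by auto
  then show ?case by (simp cong: integrable_cong)
next
  case 0
  then show ?case by (simp cong: integrable_cong)
qed

text \<open>Where the maximum \<open>G\<close> of the sums is positive it is at most \<open>f + G \<circ> \<theta>\<^sub>1\<close>, and \<open>G\<close> and
  \<open>G \<circ> \<theta>\<^sub>1\<close> have the same integral.\<close>

lemma maximal_ergodic:
  assumes f: "integrable M f" and pos: "AE \<omega> in M. \<exists>n. birkhoff_sum f n \<omega> > 0"
  shows "0 \<le> (\<integral>\<omega>. f \<omega> \<partial>M)"
proof -
  have [measurable]: "f \<in> borel_measurable M" using f by simp
  have Gi: "integrable M (max_sum f N)" for N by (rule max_sum_integrable[OF f])
  have [measurable]: "max_sum f N \<in> borel_measurable M" for N using Gi by simp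
  let ?A = "\<lambda>N. {\<omega>\<in>space M. max_sum f (Suc N) \<omega> > 0}"
  let ?h = "\<lambda>N \<omega>. indicator (?A N) \<omega> *\<^sub>R f \<omega>"
  have hi: "integrable M (?h N)" for N
    using f by (intro integrable_mult_indicator) auto
  have step: "0 \<le> (\<integral>\<omega>. ?h N \<omega> \<partial>M)" for N
  proof -
    let ?G = "max_sum f (Suc N)"
    have Gi1: "integrable M (\<lambda>\<omega>. ?G (\<theta> 1 \<omega>))" by (rule integrable_flow[OF _ Gi]) simp
    have "0 = (\<integral>\<omega>. ?G \<omega> \<partial>M) - (\<integral>\<omega>. ?G (\<theta> 1 \<omega>) \<partial>M)"
      by (subst integral_flow) (use Gi in auto)
    also have "\<dots> = (\<integral>\<omega>. ?G \<omega> - ?G (\<theta> 1 \<omega>) \<partial>M)"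
      by (rule Bochner_Integration.integral_diff[symmetric, OF Gi Gi1])
    also have "\<dots> \<le> (\<integral>\<omega>. ?h N \<omega> \<partial>M)"
    proof (rule integral_mono[OF _ hi])
      show "integrable M (\<lambda>\<omega>. ?G \<omega> - ?G (\<theta> 1 \<omega>))"
        by (rule Bochner_Integration.integrable_diff[OF Gi Gi1])
      fix \<omega> assume \<omega>: "\<omega> \<in> space M"
      show "?G \<omega> - ?G (\<theta> 1 \<omega>) \<le> ?h N \<omega>"
      proof (cases "?G \<omega> > 0")
        case True
        then have "?G \<omega> = f \<omega> + max_sum f N (\<theta> 1 \<omega>)" by (auto simp: max_def split: if_splits)
        then show ?thesis using max_sum_mono[of f N "\<theta> 1 \<omega>"] True \<omega> by (simp del: max_sum.simps)
      next
        case False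
        then show ?thesis
          using max_sum_nonneg[of f "Suc N" \<omega>] max_sum_nonneg[of f "Suc N" "\<theta> 1 \<omega>"]
          by (simp del: max_sum.simps)
      qed
    qed
    finally show ?thesis .
  qed
  have "(\<lambda>N. \<integral>\<omega>. ?h N \<omega> \<partial>M) \<longlonglongrightarrow> (\<integral>\<omega>. f \<omega> \<partial>M)"
  proof (rule integral_dominated_convergence[where w = "\<lambda>\<omega>. \<bar>f \<omega>\<bar>"])
    show "AE \<omega> in M. (\<lambda>N. ?h N \<omega>) \<longlonglongrightarrow> f \<omega>"
      using pos
    proof (rule AE_mp, intro AE_I2 impI)
      fix \<omega> assume \<omega>: "\<omega> \<in> space M" and "\<exists>n. birkhoff_sum f n \<omega> > 0"
      then obtain n where n: "birkhoff_sum f n \<omega> > 0" by blast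
      have "?h N \<omega> = f \<omega>" if "N \<ge> n" for N
      proof -
        have "birkhoff_sum f n \<omega> \<le> max_sum f (Suc N) \<omega>"
          using that \<omega> by (intro birkhoff_sum_le_max_sum) auto
        then show ?thesis using n \<omega> by (simp del: max_sum.simps)
      qed
      then show "(\<lambda>N. ?h N \<omega>) \<longlonglongrightarrow> f \<omega>"
        by (intro tendsto_eventually) (auto simp: eventually_sequentially)
    qed
    show "AE \<omega> in M. norm (?h N \<omega>) \<le> \<bar>f \<omega>\<bar>" for N by (simp add: indicator_def)
  qed (use f in \<open>auto simp del: max_sum.simps\<close>)
  then show ?thesis by (rule LIMSEQ_le_const) (use step in auto)
qed

end

section \<open>Ergodic flows and additive cocycles\<close>

lemma (in measurable_flow) measurable_flow_reverse: "measurable_flow M T (dual_flow \<theta>)"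
proof
  show "T = \<int> \<or> T = UNIV" by (rule time)
  have "(\<lambda>(t, \<omega>). \<theta> t \<omega>) \<in> measurable (restrict_space borel T \<Otimes>\<^sub>M M) M"
    using flow by (simp add: metric_dynamical_system_def)
  moreover have "(\<lambda>p. (- fst p, snd p)) \<in>
      measurable (restrict_space borel T \<Otimes>\<^sub>M M) (restrict_space borel T \<Otimes>\<^sub>M M)"
  proof (intro measurable_Pair measurable_snd measurable_restrict_space2)
    show "(\<lambda>x. - fst x) \<in> space (restrict_space borel T \<Otimes>\<^sub>M M) \<rightarrow> T"
      by (auto simp: space_pair_measure space_restrict_space)
    have "fst \<in> measurable (restrict_space borel T \<Otimes>\<^sub>M M) borel"
      using measurable_fst[of "restrict_space borel T" M]
      by (auto simp: measurable_restrict_space2_iff)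
    then show "(\<lambda>x. - fst x) \<in> measurable (restrict_space borel T \<Otimes>\<^sub>M M) borel"
      by (rule borel_measurable_uminus)
  qed
  ultimately have "(\<lambda>p. (\<lambda>(t, \<omega>). \<theta> t \<omega>) (- fst p, snd p))
      \<in> measurable (restrict_space borel T \<Otimes>\<^sub>M M) M"
    by (rule measurable_compose[rotated])
  then show "metric_dynamical_system T M (dual_flow \<theta>)"
    by (auto simp: metric_dynamical_system_def dual_flow_def split_def flow_flow flow_preserves)
qed

lemma (in measurable_flow) invariant_set_reverse:
  "invariant_set T M (dual_flow \<theta>) F \<longleftrightarrow> invariant_set T M \<theta> F"
  unfolding invariant_set_def dual_flow_def by (metis minus_minus time_minus)

locale ergodic_flow = measurable_flow M T \<theta>
  for M :: "'w measure" and T \<theta> +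
  assumes ergodic: "ergodic T M \<theta>"
    and complete: "T = UNIV \<Longrightarrow> complete_measure M"
begin

lemma ergodic_flow_reverse: "ergodic_flow M T (dual_flow \<theta>)"
proof (intro ergodic_flow.intro ergodic_flow_axioms.intro measurable_flow_reverse)
  show "ergodic T M (dual_flow \<theta>)"
    using ergodic by (simp add: ergodic_def invariant_set_reverse)
qed (rule complete)

text \<open>Under continuous time the set itself is measurable by completeness. Under discrete time one
  removes the countably many translates of a measurable null set containing the complement.\<close>

lemma invariant_core:
  assumes G: "G \<subseteq> space M" "AE \<omega> in M. \<omega> \<in> G"
    and inv: "T = UNIV \<Longrightarrow> (\<And>\<omega> t. \<omega> \<in> G \<Longrightarrow> \<theta> t \<omega> \<in> G)"
  obtains F where "F \<in> sets M" "invariant_set T M \<theta> F" "F \<subseteq> G" "measure M F = 1"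
proof (cases "T = UNIV")
  case True
  then interpret complete_measure M by (rule complete)
  have "G \<in> sets M"
    by (rule in_sets_AE[of "space M" G]) (use G in auto)
  moreover have "measure M G = 1"
    using prob_eq_1[OF \<open>G \<in> sets M\<close>] G by simp
  moreover have "invariant_set T M \<theta> G" using inv[OF True] G by (intro invariant_setI) auto
  ultimately show ?thesis using that by blast
next
  case False
  then have Z: "T = \<int>" using time by simp
  obtain N where N: "{\<omega>\<in>space M. \<omega> \<notin> G} \<subseteq> N" "emeasure M N = 0" "N \<in> sets M"
    using G(2) by (rule AE_E)
  define F where "F = {\<omega>\<in>space M. \<forall>i::int. \<theta> (of_int i) \<omega> \<notin> N}"
  have iT: "real_of_int i \<in> T" for i by (simp add: Z)
  have [measurable]: "\<theta> (real_of_int i) \<in> measurable M M" for i using iT by simp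
  have [measurable]: "F \<in> sets M" using N unfolding F_def by measurable
  have "AE \<omega> in M. \<omega> \<notin> N" using N by (intro AE_not_in) auto
  then have "AE \<omega> in M. \<theta> (of_int i) \<omega> \<notin> N" for i :: int
    using AE_flow[of "\<lambda>\<omega>. \<omega> \<notin> N" "of_int i"] iT by auto
  then have "AE \<omega> in M. \<forall>i::int. \<theta> (of_int i) \<omega> \<notin> N" by (subst AE_all_countable) simp
  then have "AE \<omega> in M. \<omega> \<in> F" using AE_space by eventually_elim (auto simp: F_def)
  then have "measure M F = 1" using prob_eq_1[of F] by simp
  moreover have "F \<subseteq> G"
  proof
    fix \<omega> assume "\<omega> \<in> F"
    then have "\<omega> \<in> space M" "\<theta> (of_int 0) \<omega> \<notin> N" unfolding F_def by blast+
    then show "\<omega> \<in> G" using N by auto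
  qed
  moreover have "invariant_set T M \<theta> F"
  proof (rule invariant_setI)
    fix \<omega> t assume "\<omega> \<in> F" "t \<in> T"
    then obtain j where j: "t = of_int j" using Z by (auto elim: Ints_cases)
    have "\<theta> (of_int i) (\<theta> t \<omega>) = \<theta> (of_int (j + i)) \<omega>" for i
      using \<open>\<omega> \<in> F\<close> iT by (simp add: j flow_flow F_def)
    then show "\<theta> t \<omega> \<in> F"
      using \<open>\<omega> \<in> F\<close> \<open>t \<in> T\<close> by (auto simp: F_def simp del: of_int_add)
  qed (auto simp: F_def)
  ultimately show ?thesis using \<open>F \<in> sets M\<close> by (intro that[of F])
qed

text \<open>An event that is invariant only on a set of full measure, and measurable only up to a null
  set, still agrees almost surely with an invariant measurable set. In the application \<open>P\<close>
  refers to all times in \<open>T\<close>, and \<open>Q\<close> is a measurable version that sees integer times only.\<close>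

lemma zero_one_law:
  assumes G: "G \<subseteq> space M" "AE \<omega> in M. \<omega> \<in> G" "\<And>\<omega> t. \<omega> \<in> G \<Longrightarrow> t \<in> T \<Longrightarrow> \<theta> t \<omega> \<in> G"
    and P: "\<And>\<omega> t. \<omega> \<in> G \<Longrightarrow> t \<in> T \<Longrightarrow> P \<omega> \<Longrightarrow> P (\<theta> t \<omega>)"
    and Q: "{\<omega>\<in>space M. Q \<omega>} \<in> sets M" "AE \<omega> in M. P \<omega> \<longleftrightarrow> Q \<omega>"
  shows "(AE \<omega> in M. P \<omega>) \<or> (AE \<omega> in M. \<not> P \<omega>)"
proof -
  have "\<exists>H\<in>sets M. invariant_set T M \<theta> H \<and> (AE \<omega> in M. P \<omega> \<longleftrightarrow> \<omega> \<in> H)"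
  proof (cases "T = UNIV")
    case True
    then interpret complete_measure M by (rule complete)
    let ?H = "{\<omega>\<in>G. P \<omega>}"
    have PH: "AE \<omega> in M. P \<omega> \<longleftrightarrow> \<omega> \<in> ?H" using G(2) by eventually_elim auto
    have "?H \<in> sets M"
    proof (rule in_sets_AE[of "{\<omega>\<in>space M. Q \<omega>}" ?H])
      show "AE \<omega> in M. \<omega> \<in> {\<omega>\<in>space M. Q \<omega>} \<longleftrightarrow> \<omega> \<in> ?H"
        using PH Q(2) AE_space by eventually_elim auto
    qed (use G Q in auto)
    moreover have "invariant_set T M \<theta> ?H" using G P by (intro invariant_setI) auto
    ultimately show ?thesis using PH by blast
  next
    case False
    obtain F where F: "F \<in> sets M" "invariant_set T M \<theta> F" "F \<subseteq> {\<omega>\<in>G. P \<omega> \<longleftrightarrow> Q \<omega>}"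
        "measure M F = 1"
      using invariant_core[of "{\<omega>\<in>G. P \<omega> \<longleftrightarrow> Q \<omega>}"] G Q(2) False by auto
    let ?H = "{\<omega>\<in>F. Q \<omega>}"
    have "?H = F \<inter> {\<omega>\<in>space M. Q \<omega>}" using F sets.sets_into_space by blast
    then have "?H \<in> sets M" using F Q by simp
    moreover have "invariant_set T M \<theta> ?H"
    proof (rule invariant_setI)
      fix \<omega> t assume *: "\<omega> \<in> ?H" "t \<in> T"
      then have "\<theta> t \<omega> \<in> F" using F invariant_setD by blast
      then show "\<theta> t \<omega> \<in> ?H" using * F P by blast
    qed (use F G in blast)
    moreover have "AE \<omega> in M. \<omega> \<in> F" using F prob_eq_1 by blast
    then have "AE \<omega> in M. P \<omega> \<longleftrightarrow> \<omega> \<in> ?H" by eventually_elim (use F in auto)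
    ultimately show ?thesis by blast
  qed
  then obtain H where H: "H \<in> sets M" "invariant_set T M \<theta> H" "AE \<omega> in M. P \<omega> \<longleftrightarrow> \<omega> \<in> H"
    by blast
  then consider "measure M H = 0" | "measure M H = 1" using ergodic by (auto simp: ergodic_def)
  then show ?thesis
  proof cases
    case 1
    then have "AE \<omega> in M. \<omega> \<notin> H" using H prob_eq_0 by blast
    with H(3) have "AE \<omega> in M. \<not> P \<omega>" by eventually_elim simp
    then show ?thesis ..
  next
    case 2
    then have "AE \<omega> in M. \<omega> \<in> H" using H prob_eq_1 by blast
    with H(3) have "AE \<omega> in M. P \<omega>" by eventually_elim simp
    then show ?thesis ..
  qed
qed

text \<open>The truncations \<open>max f (- K)\<close> are integrable and inherit large Birkhoff sums from \<open>f\<close>, so the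
  maximal inequality bounds the integral of the negative part of \<open>f\<close> uniformly in \<open>K\<close>. This covers
  functions whose integral might be minus infinity.\<close>

lemma ext_integral_ge_of_birkhoff_sum:
  assumes f [measurable]: "f \<in> borel_measurable M" and fin: "(\<integral>\<^sup>+\<omega>. ennreal (f \<omega>) \<partial>M) < \<infinity>"
    and big: "AE \<omega> in M. \<exists>n. birkhoff_sum f n \<omega> > r * real n"
  shows "ereal r \<le> ext_integral M f"
proof -
  let ?A = "\<integral>\<^sup>+\<omega>. ennreal (f \<omega>) \<partial>M" and ?B = "\<integral>\<^sup>+\<omega>. ennreal (- f \<omega>) \<partial>M"
  define a where "a = enn2real ?A"
  have A: "?A = ennreal a" using fin by (simp add: a_def less_top)
  have pos: "integrable M (\<lambda>\<omega>. max (f \<omega>) 0)"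
  proof (rule integrableI_nonneg)
    show "(\<integral>\<^sup>+\<omega>. ennreal (max (f \<omega>) 0) \<partial>M) < \<infinity>"
      using fin by (simp add: ennreal_max_0 max.commute cong: nn_integral_cong)
  qed auto
  have posI: "(\<integral>\<omega>. max (f \<omega>) 0 \<partial>M) = a"
    unfolding a_def by (subst integral_eq_nn_integral) (auto simp: max_def intro!: arg_cong[where f=enn2real] nn_integral_cong ennreal_neg)
  have trunc: "(\<integral>\<^sup>+\<omega>. ennreal (min (- f \<omega>) (real K)) \<partial>M) \<le> ennreal (a - r) \<and> r \<le> a" for K :: nat
  proof -
    let ?m = "\<lambda>\<omega>. max 0 (min (- f \<omega>) (real K))"
    have mi: "integrable M ?m"
      by (rule integrable_const_bound[of _ "real K"]) auto
    let ?g = "\<lambda>\<omega>. max (f \<omega>) 0 - ?m \<omega> - r"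
    have gi: "integrable M ?g" using pos mi by auto
    have "0 \<le> (\<integral>\<omega>. ?g \<omega> \<partial>M)"
    proof (rule maximal_ergodic[OF gi])
      show "AE \<omega> in M. \<exists>n. birkhoff_sum ?g n \<omega> > 0"
        using big
      proof eventually_elim
        case (elim \<omega>)
        then obtain n where n: "birkhoff_sum f n \<omega> > r * real n" by blast
        have "birkhoff_sum f n \<omega> - r * real n = (\<Sum>k<n. f (\<theta> (real k) \<omega>) - r)"
          by (simp add: birkhoff_sum_def sum_subtractf)
        also have "\<dots> \<le> birkhoff_sum ?g n \<omega>"
          unfolding birkhoff_sum_def by (intro sum_mono) auto
        finally show ?case using n by (intro exI[of _ n]) simp
      qed
    qed
    also have "(\<integral>\<omega>. ?g \<omega> \<partial>M) = a - (\<integral>\<omega>. ?m \<omega> \<partial>M) - r"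
      using pos mi by (simp add: posI prob_space)
    finally have *: "(\<integral>\<omega>. ?m \<omega> \<partial>M) \<le> a - r" by simp
    have "(\<integral>\<^sup>+\<omega>. ennreal (min (- f \<omega>) (real K)) \<partial>M) = (\<integral>\<^sup>+\<omega>. ennreal (?m \<omega>) \<partial>M)"
      by (intro nn_integral_cong) (simp add: ennreal_max_0)
    also have "\<dots> = ennreal (\<integral>\<omega>. ?m \<omega> \<partial>M)"
      using mi by (intro nn_integral_eq_integral) auto
    also have "\<dots> \<le> ennreal (a - r)" using * by (rule ennreal_leI)
    finally have "(\<integral>\<^sup>+\<omega>. ennreal (min (- f \<omega>) (real K)) \<partial>M) \<le> ennreal (a - r)" .
    moreover have "0 \<le> (\<integral>\<omega>. ?m \<omega> \<partial>M)" by (rule Bochner_Integration.integral_nonneg) simp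
    ultimately show ?thesis using * by linarith
  qed
  have "?B = (\<integral>\<^sup>+\<omega>. (SUP K::nat. ennreal (min (- f \<omega>) (real K))) \<partial>M)"
  proof (rule nn_integral_cong)
    fix \<omega>
    obtain K0 :: nat where K0: "- f \<omega> \<le> real K0" using real_arch_simple by blast
    show "ennreal (- f \<omega>) = (SUP K::nat. ennreal (min (- f \<omega>) (real K)))"
      by (rule antisym) (use K0 in \<open>auto intro!: SUP_least SUP_upper2[of K0] ennreal_leI simp: min_def\<close>)
  qed
  also have "\<dots> = (SUP K::nat. \<integral>\<^sup>+\<omega>. ennreal (min (- f \<omega>) (real K)) \<partial>M)"
    by (intro nn_integral_monotone_convergence_SUP)
      (auto simp: incseq_def le_fun_def intro!: ennreal_leI)
  also have "\<dots> \<le> ennreal (a - r)" using trunc by (intro SUP_least) auto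
  finally have B: "?B \<le> ennreal (a - r)" .
  define b where "b = enn2real ?B"
  have Bb: "?B = ennreal b" using B by (simp add: b_def less_top le_less_trans[OF B])
  have "0 \<le> a" "0 \<le> b" by (simp_all add: a_def b_def)
  moreover have "b \<le> a - r" using B trunc[of 0] unfolding Bb by (simp add: ennreal_le_iff)
  ultimately show ?thesis unfolding ext_integral_def A Bb by simp
qed

lemma ext_integral_flow:
  "f \<in> borel_measurable M \<Longrightarrow> t \<in> T \<Longrightarrow> ext_integral M (\<lambda>\<omega>. f (\<theta> t \<omega>)) = ext_integral M f"
  unfolding ext_integral_def
  by (simp add: nn_integral_flow[of t "\<lambda>\<omega>. ennreal (f \<omega>)"]
      nn_integral_flow[of t "\<lambda>\<omega>. ennreal (- f \<omega>)"])

end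

text \<open>A cocycle of real numbers over a flow; \<open>F\<close> is the domain on which the cocycle identity holds,
  \<open>f\<close> a measurable version of the value at time 1, and \<open>c\<close> controls the cocycle between
  consecutive integer times.\<close>

locale flow_cocycle = ergodic_flow M T \<theta>
  for M :: "'w measure" and T \<theta> +
  fixes F :: "'w set" and g :: "real \<Rightarrow> 'w \<Rightarrow> real" and f c :: "'w \<Rightarrow> real"
  assumes F_space: "F \<subseteq> space M" and F_full: "AE \<omega> in M. \<omega> \<in> F"
    and F_flow: "\<And>\<omega> t. \<omega> \<in> F \<Longrightarrow> t \<in> T \<Longrightarrow> \<theta> t \<omega> \<in> F"
    and cocycle: "\<And>s t \<omega>. s \<in> T \<Longrightarrow> t \<in> T \<Longrightarrow> \<omega> \<in> F \<Longrightarrow> g (s + t) \<omega> = g t \<omega> + g s (\<theta> t \<omega>)"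
    and f_measurable [measurable]: "f \<in> borel_measurable M"
    and f_eq: "\<And>\<omega>. \<omega> \<in> F \<Longrightarrow> g 1 \<omega> = f \<omega>"
    and f_pos: "(\<integral>\<^sup>+\<omega>. ennreal (f \<omega>) \<partial>M) < \<infinity>"
    and c_integrable: "integrable M c"
    and c_bound: "AE \<omega> in M. \<forall>s\<in>T \<inter> {0..1}. g s \<omega> \<le> c \<omega> \<and> g 1 \<omega> - g s \<omega> \<le> c \<omega>"
begin

lemma cocycle_zero: "\<omega> \<in> F \<Longrightarrow> g 0 \<omega> = 0"
  using cocycle[of 0 0 \<omega>] F_space by auto

lemma cocycle_nat: "\<omega> \<in> F \<Longrightarrow> g (real n) \<omega> = birkhoff_sum f n \<omega>"
proof (induction n)
  case (Suc n)
  have "g (1 + real n) \<omega> = g (real n) \<omega> + g 1 (\<theta> (real n) \<omega>)"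
    using Suc by (intro cocycle) auto
  then show ?case using Suc by (simp add: birkhoff_sum_def f_eq F_flow)
qed (simp add: cocycle_zero birkhoff_sum_def)

text \<open>The event that \<open>g\<close> exceeds a line of slope larger than \<open>r\<^sub>0\<close> at arbitrarily late times is
  invariant, because a shift of time changes \<open>g\<close> by a constant only. If it had positive measure,
  the zero-one law would make it almost sure, and the maximal inequality would give an integral of
  at least \<open>r\<^sub>0\<close>.\<close>

lemma eventually_le_slope:
  assumes r: "ext_integral M f < ereal r"
  shows "AE \<omega> in M. \<forall>\<^sub>F t in forward. g t \<omega> \<le> r * t"
proof -
  obtain r0 where r0: "ext_integral M f < ereal r0" "r0 < r"
    using ereal_dense2[OF r] by auto
  define P where "P \<omega> \<longleftrightarrow> (\<exists>p>r0. \<exists>\<^sub>F t in forward. g t \<omega> > p * t)" for \<omega>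
  define Q where "Q \<omega> \<longleftrightarrow> (\<exists>m::nat. \<forall>N. \<exists>n\<ge>N. birkhoff_sum f n \<omega> > (r0 + 1 / real (Suc m)) * real n)" for \<omega>
  have P_inv: "P (\<theta> s \<omega>)" if \<omega>: "\<omega> \<in> F" and s: "s \<in> T" and P: "P \<omega>" for \<omega> s
  proof -
    obtain p where p: "p > r0" "\<exists>\<^sub>F t in forward. g t \<omega> > p * t" using P by (auto simp: P_def)
    define q where "q = (p + r0) / 2"
    have q: "q > r0" "q < p" using p by (auto simp: q_def)
    have "\<exists>t\<in>T. N \<le> t \<and> q * t < g t (\<theta> s \<omega>)" for N
    proof -
      \<comment> \<open>beyond the second bound the constant \<open>g s \<omega> - p s\<close> is absorbed by the smaller slope \<open>q\<close>\<close>
      define N' where "N' = max (N + s) (s + (g s \<omega> - p * s) / (p - q))"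
      obtain t where t: "t \<in> T" "N' \<le> t" "g t \<omega> > p * t" using p(2) by (auto simp: frequently_forward)
      have "g ((t - s) + s) \<omega> = g s \<omega> + g (t - s) (\<theta> s \<omega>)"
        using t s \<omega> by (intro cocycle) auto
      then have "g (t - s) (\<theta> s \<omega>) > p * t - g s \<omega>" using t by simp
      moreover have "(g s \<omega> - p * s) / (p - q) \<le> t - s" using t(2) by (simp add: N'_def)
      then have "g s \<omega> - p * s \<le> (t - s) * (p - q)" using q by (simp add: divide_le_eq)
      ultimately have "q * (t - s) < g (t - s) (\<theta> s \<omega>)" by (simp add: algebra_simps)
      then show ?thesis using t s by (intro bexI[of _ "t - s"]) (auto simp: N'_def)
    qed
    then show ?thesis using q by (auto simp: P_def frequently_forward)
  qed
  have sub: "AE \<omega> in M. \<forall>n. \<forall>s\<in>T \<inter> {0..1}. g s (\<theta> (real n) \<omega>) \<le> c (\<theta> (real n) \<omega>)"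
  proof (subst AE_all_countable, intro allI)
    fix n :: nat
    from AE_flow[OF c_bound time_simps(3)[of n]]
    show "AE \<omega> in M. \<forall>s\<in>T \<inter> {0..1}. g s (\<theta> (real n) \<omega>) \<le> c (\<theta> (real n) \<omega>)"
      by eventually_elim blast
  qed
  have PQ: "AE \<omega> in M. P \<omega> \<longleftrightarrow> Q \<omega>"
    using F_full sub integrable_sublinear[OF c_integrable]
  proof eventually_elim
    case (elim \<omega>)
    show ?case
    proof
      assume "Q \<omega>"
      then obtain m where m: "\<forall>N. \<exists>n\<ge>N. birkhoff_sum f n \<omega> > (r0 + 1 / real (Suc m)) * real n"
        by (auto simp: Q_def)
      have "\<exists>t\<in>T. N \<le> t \<and> (r0 + 1 / real (Suc m)) * t < g t \<omega>" for N
      proof -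
        obtain n0 :: nat where "N \<le> real n0" using real_arch_simple by blast
        moreover obtain n where "n \<ge> n0" "birkhoff_sum f n \<omega> > (r0 + 1 / real (Suc m)) * real n"
          using m by blast
        ultimately show ?thesis using elim(1) by (intro bexI[of _ "real n"]) (auto simp: cocycle_nat)
      qed
      then show "P \<omega>" unfolding P_def frequently_forward
        by (intro exI[of _ "r0 + 1 / real (Suc m)"]) auto
    next
      assume "P \<omega>"
      then obtain p where p: "p > r0" "\<exists>\<^sub>F t in forward. g t \<omega> > p * t" by (auto simp: P_def)
      obtain m where m: "1 / real (Suc m) < (p - r0) / 2" using p nat_approx_posE[of "(p - r0) / 2"] by auto
      \<comment> \<open>one \<open>\<epsilon> n\<close> pays for \<open>c\<close>, another for rounding the time down to an integer\<close>
      define \<epsilon> where "\<epsilon> = (p - r0) / 4"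
      have \<epsilon>: "\<epsilon> > 0" using p by (simp add: \<epsilon>_def)
      have "\<forall>\<^sub>F n in sequentially. c (\<theta> (real n) \<omega>) \<le> \<epsilon> * real n" using elim(3) \<epsilon> by blast
      then obtain N0 where N0: "\<And>n. n \<ge> N0 \<Longrightarrow> c (\<theta> (real n) \<omega>) \<le> \<epsilon> * real n"
        by (auto simp: eventually_sequentially)
      have "\<exists>n\<ge>N. birkhoff_sum f n \<omega> > (r0 + 1 / real (Suc m)) * real n" for N
      proof -
        obtain t where t: "t \<in> T" "max (real (max N N0) + 1) (\<bar>p\<bar> / \<epsilon> + 2) \<le> t" "g t \<omega> > p * t"
          using p(2) unfolding frequently_forward by blast
        define n where "n = nat \<lfloor>t\<rfloor>"
        have n: "real n \<le> t" "t < real n + 1" using t(2) by (auto simp: n_def)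
        have n': "n \<ge> N" "n \<ge> N0" "\<bar>p\<bar> / \<epsilon> \<le> real n" using t(2) n by auto
        have "g ((t - real n) + real n) \<omega> = g (real n) \<omega> + g (t - real n) (\<theta> (real n) \<omega>)"
          using t elim(1) by (intro cocycle) auto
        moreover have "g (t - real n) (\<theta> (real n) \<omega>) \<le> c (\<theta> (real n) \<omega>)"
          using elim(2) t n by auto
        ultimately have "p * t < birkhoff_sum f n \<omega> + \<epsilon> * real n"
          using t(3) N0[OF n'(2)] elim(1) by (simp add: cocycle_nat)
        moreover have "p * t \<ge> p * real n - \<bar>p\<bar>"
        proof -
          have "\<bar>p * (t - real n)\<bar> \<le> \<bar>p\<bar> * 1" unfolding abs_mult using n by (intro mult_left_mono) auto
          then show ?thesis by (simp add: algebra_simps abs_le_iff)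
        qed
        moreover have "\<bar>p\<bar> \<le> \<epsilon> * real n" using n'(3) \<epsilon> by (simp add: divide_le_eq mult.commute)
        moreover have "(r0 + 1 / real (Suc m)) * real n \<le> (p - 2 * \<epsilon>) * real n"
          using m by (intro mult_right_mono) (auto simp: \<epsilon>_def field_simps)
        ultimately have "birkhoff_sum f n \<omega> > (r0 + 1 / real (Suc m)) * real n"
          by (simp add: algebra_simps)
        then show ?thesis using n' by blast
      qed
      then show "Q \<omega>" by (auto simp: Q_def)
    qed
  qed
  have "{\<omega>\<in>space M. Q \<omega>} \<in> sets M" unfolding Q_def by measurable
  then consider "AE \<omega> in M. P \<omega>" | "AE \<omega> in M. \<not> P \<omega>"
    using zero_one_law[of F P Q] F_space F_full F_flow P_inv PQ by blast
  then show ?thesis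
  proof cases
    case 1
    have "AE \<omega> in M. \<exists>n. birkhoff_sum f n \<omega> > r0 * real n"
      using 1 PQ
    proof eventually_elim
      case (elim \<omega>)
      then obtain m n where "birkhoff_sum f n \<omega> > (r0 + 1 / real (Suc m)) * real n"
        by (auto simp: Q_def)
      moreover have "(r0 + 1 / real (Suc m)) * real n \<ge> r0 * real n" by (intro mult_right_mono) auto
      ultimately show ?case by (intro exI[of _ n]) linarith
    qed
    then have "ereal r0 \<le> ext_integral M f"
      using f_pos by (intro ext_integral_ge_of_birkhoff_sum) auto
    with r0 show ?thesis by simp
  next
    case 2
    then show ?thesis
    proof eventually_elim
      case (elim \<omega>)
      then have "\<not> (\<exists>\<^sub>F t in forward. g t \<omega> > r * t)" using r0 unfolding P_def by blast
      then show ?case by (simp add: not_frequently not_less)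
    qed
  qed
qed

end

context measurable_flow
begin

lemma forward_pos: "\<forall>\<^sub>F t in forward. 0 < t"
  unfolding eventually_forward by (intro exI[of _ 1]) auto

text \<open>This trades a limit in the extended reals, possibly minus infinity, for linear bounds with
  real slopes, which behave well under shifts of time and countable exceptional sets.\<close>

lemma growth_rate_iff:
  "((\<lambda>t. ereal (1 / t * h t)) \<longlongrightarrow> l) forward \<longleftrightarrow>
     (\<forall>r. l < ereal r \<longrightarrow> (\<forall>\<^sub>F t in forward. h t \<le> r * t)) \<and>
     (\<forall>r. ereal r < l \<longrightarrow> (\<forall>\<^sub>F t in forward. r * t \<le> h t))"
  (is "?L \<longleftrightarrow> ?U \<and> ?D")
proof (intro iffI conjI allI impI)
  fix r assume "?L" "l < ereal r"
  then have "\<forall>\<^sub>F t in forward. ereal (1 / t * h t) < ereal r" by (rule order_tendstoD(2))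
  with forward_pos show "\<forall>\<^sub>F t in forward. h t \<le> r * t"
    by eventually_elim (simp add: field_simps)
next
  fix r assume "?L" "ereal r < l"
  then have "\<forall>\<^sub>F t in forward. ereal r < ereal (1 / t * h t)" by (rule order_tendstoD(1))
  with forward_pos show "\<forall>\<^sub>F t in forward. r * t \<le> h t"
    by eventually_elim (simp add: field_simps)
next
  assume UD: "?U \<and> ?D"
  show ?L
  proof (rule order_tendstoI)
    fix a assume "l < a"
    then obtain r where r: "l < ereal r" "ereal r < a" using ereal_dense2 by blast
    then have "\<forall>\<^sub>F t in forward. h t \<le> r * t" using UD by blast
    with forward_pos show "\<forall>\<^sub>F t in forward. ereal (1 / t * h t) < a"
    proof eventually_elim
      case (elim t)
      then have "1 / t * h t \<le> r" by (simp add: field_simps)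
      then show ?case using r(2) le_less_trans ereal_less_eq(3) by blast
    qed
  next
    fix a assume "a < l"
    then obtain r where r: "ereal r < l" "a < ereal r" using ereal_dense2 by blast
    then have "\<forall>\<^sub>F t in forward. r * t \<le> h t" using UD by blast
    with forward_pos show "\<forall>\<^sub>F t in forward. a < ereal (1 / t * h t)"
    proof eventually_elim
      case (elim t)
      then have "r \<le> 1 / t * h t" by (simp add: field_simps)
      then show ?case using r(2) less_le_trans ereal_less_eq(3) by blast
    qed
  qed
qed

lemma growth_rate_shift:
  assumes lim: "((\<lambda>t. ereal (1 / t * h t)) \<longlongrightarrow> l) forward" and s: "s \<in> T"
  shows "((\<lambda>t. ereal (1 / t * (h (t + s) + d))) \<longlongrightarrow> l) forward"
  unfolding growth_rate_iff
proof (intro conjI allI impI)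
  have large: "\<forall>\<^sub>F t in forward. K \<le> t" for K by (auto simp: eventually_forward)
  fix r assume "l < ereal r"
  then obtain q where q: "l < ereal q" "q < r" using ereal_dense2 by fastforce
  then have "\<forall>\<^sub>F t in forward. h t \<le> q * t" using lim growth_rate_iff by blast
  from eventually_forward_shift[OF this s] large[of "(q * s + d) / (r - q)"]
  show "\<forall>\<^sub>F t in forward. h (t + s) + d \<le> r * t"
    by eventually_elim (use q in \<open>simp add: divide_le_eq algebra_simps\<close>)
next
  have large: "\<forall>\<^sub>F t in forward. K \<le> t" for K by (auto simp: eventually_forward)
  fix r assume "ereal r < l"
  then obtain q where q: "ereal q < l" "r < q" using ereal_dense2 by fastforce
  then have "\<forall>\<^sub>F t in forward. q * t \<le> h t" using lim growth_rate_iff by blast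
  from eventually_forward_shift[OF this s] large[of "(- q * s - d) / (q - r)"]
  show "\<forall>\<^sub>F t in forward. r * t \<le> h (t + s) + d"
    by eventually_elim (use q in \<open>simp add: divide_le_eq algebra_simps\<close>)
qed

lemma tendsto_backward_iff:
  fixes h :: "real \<Rightarrow> 'b::topological_space"
  shows "(h \<longlongrightarrow> l) (inf at_bot (principal T)) \<longleftrightarrow> ((\<lambda>t. h (- t)) \<longlongrightarrow> l) forward"
proof -
  have "eventually P (inf at_bot (principal T)) \<longleftrightarrow> (\<forall>\<^sub>F t in forward. P (- t))" for P
  proof -
    have "eventually P (inf at_bot (principal T)) \<longleftrightarrow> (\<exists>N. \<forall>t\<le>N. t \<in> T \<longrightarrow> P t)"
      by (simp add: eventually_inf_principal eventually_at_bot_linorder)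
    also have "\<dots> \<longleftrightarrow> (\<exists>N. \<forall>t\<in>T. N \<le> t \<longrightarrow> P (- t))"
      by (metis minus_le_iff minus_minus time_minus)
    finally show ?thesis by (simp add: eventually_forward)
  qed
  then show ?thesis unfolding tendsto_def by simp
qed

end

context flow_cocycle
begin

lemma AE_upper_slopes:
  "AE \<omega> in M. \<forall>r. ext_integral M f < ereal r \<longrightarrow> (\<forall>\<^sub>F t in forward. g t \<omega> \<le> r * t)"
proof -
  let ?l = "ext_integral M f"
  have "AE \<omega> in M. ?l < ereal (of_rat q) \<longrightarrow> (\<forall>\<^sub>F t in forward. g t \<omega> \<le> of_rat q * t)" for q
    using eventually_le_slope[of "of_rat q"] by (cases "?l < ereal (of_rat q)") auto
  then have "AE \<omega> in M. \<forall>q. ?l < ereal (of_rat q) \<longrightarrow> (\<forall>\<^sub>F t in forward. g t \<omega> \<le> of_rat q * t)"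
    by (subst AE_all_countable) simp
  then show ?thesis
  proof eventually_elim
    case (elim \<omega>)
    show ?case
    proof (intro allI impI)
      fix r assume "?l < ereal r"
      then obtain p where p: "?l < ereal p" "p < r" using ereal_dense2 by fastforce
      then obtain q where q: "p < of_rat q" "of_rat q < r" using of_rat_dense by blast
      have "?l < ereal (of_rat q)" using p q less_trans[of ?l "ereal p"] by simp
      then have "\<forall>\<^sub>F t in forward. g t \<omega> \<le> of_rat q * t" using elim by blast
      with forward_pos show "\<forall>\<^sub>F t in forward. g t \<omega> \<le> r * t"
      proof eventually_elim
        case (elim t)
        have "of_rat q * t \<le> r * t" using elim q by (intro mult_right_mono) auto
        then show ?case using elim by linarith
      qed
    qed
  qed
qed

text \<open>Lower slopes come from upper slopes of the negated cocycle. This requires an integrable \<open>f\<close>; if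
  the integral is minus infinity, lower slopes are a vacuous condition.\<close>

lemma negative_cocycle:
  assumes "integrable M f"
  shows "flow_cocycle M T \<theta> F (\<lambda>t \<omega>. - g t \<omega>) (\<lambda>\<omega>. - f \<omega>) (\<lambda>\<omega>. c \<omega> + \<bar>f \<omega>\<bar>)"
proof (intro flow_cocycle.intro flow_cocycle_axioms.intro ergodic_flow_axioms)
  show "(\<integral>\<^sup>+\<omega>. ennreal (- f \<omega>) \<partial>M) < \<infinity>"
    using assms unfolding real_integrable_def by (auto simp: less_top)
  show "integrable M (\<lambda>\<omega>. c \<omega> + \<bar>f \<omega>\<bar>)" using c_integrable assms by auto
  show "AE \<omega> in M. \<forall>s\<in>T \<inter> {0..1}. - g s \<omega> \<le> c \<omega> + \<bar>f \<omega>\<bar> \<and> - g 1 \<omega> - - g s \<omega> \<le> c \<omega> + \<bar>f \<omega>\<bar>"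
    using c_bound F_full
  proof eventually_elim
    case (elim \<omega>)
    show ?case
    proof
      fix s assume "s \<in> T \<inter> {0..1}"
      then have "g s \<omega> \<le> c \<omega>" "g 1 \<omega> - g s \<omega> \<le> c \<omega>" using elim by blast+
      moreover have "g 1 \<omega> = f \<omega>" using elim f_eq by simp
      ultimately show "- g s \<omega> \<le> c \<omega> + \<bar>f \<omega>\<bar> \<and> - g 1 \<omega> - - g s \<omega> \<le> c \<omega> + \<bar>f \<omega>\<bar>" by linarith
    qed
  qed
qed (use F_space F_full F_flow cocycle f_eq in auto)

lemma AE_forward_rate:
  "AE \<omega> in M. ((\<lambda>t. ereal (1 / t * g t \<omega>)) \<longlongrightarrow> ext_integral M f) forward"
proof -
  let ?l = "ext_integral M f"
  let ?A = "\<integral>\<^sup>+\<omega>. ennreal (f \<omega>) \<partial>M" and ?B = "\<integral>\<^sup>+\<omega>. ennreal (- f \<omega>) \<partial>M"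
  have "AE \<omega> in M. \<forall>r. ereal r < ?l \<longrightarrow> (\<forall>\<^sub>F t in forward. r * t \<le> g t \<omega>)"
  proof (cases "?B = \<infinity>")
    case True
    have "enn2ereal ?A \<noteq> \<infinity>" using f_pos by (metis enn2ereal_top enn2ereal_inject infinity_ennreal_def less_irrefl top_ennreal.rep_eq)
    then have "?l = - \<infinity>"
      unfolding ext_integral_def True by (cases "enn2ereal ?A") auto
    then show ?thesis by simp
  next
    case False
    then have int: "integrable M f"
      using f_pos unfolding real_integrable_def by auto
    interpret N: flow_cocycle M T \<theta> F "\<lambda>t \<omega>. - g t \<omega>" "\<lambda>\<omega>. - f \<omega>" "\<lambda>\<omega>. c \<omega> + \<bar>f \<omega>\<bar>"
      by (rule negative_cocycle[OF int])
    have "?A = ennreal (enn2real ?A)" "?B = ennreal (enn2real ?B)"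
      using f_pos False by (simp_all add: less_top)
    then obtain a b where "0 \<le> a" "0 \<le> b" "?A = ennreal a" "?B = ennreal b"
      by (metis enn2real_nonneg)
    then have neg: "ext_integral M (\<lambda>\<omega>. - f \<omega>) = - ?l" by (simp add: ext_integral_def)
    show ?thesis
      using N.AE_upper_slopes
    proof eventually_elim
      case (elim \<omega>)
      show ?case
      proof (intro allI impI)
        fix r assume "ereal r < ?l"
        then have "- ?l < ereal (- r)" by (metis ereal_minus_less_minus uminus_ereal.simps(1))
        then have "\<forall>\<^sub>F t in forward. - g t \<omega> \<le> - r * t" using elim neg by metis
        then show "\<forall>\<^sub>F t in forward. r * t \<le> g t \<omega>" by eventually_elim simp
      qed
    qed
  qed
  with AE_upper_slopes show ?thesis
    unfolding growth_rate_iff by eventually_elim blast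
qed

text \<open>Time reversal turns the limit at minus infinity into one at infinity. The two bounds on the
  cocycle within the unit interval exchange their roles, which is why both are demanded.\<close>

lemma reverse_cocycle:
  "flow_cocycle M T (dual_flow \<theta>) F (\<lambda>t \<omega>. - g (- t) \<omega>) (\<lambda>\<omega>. f (\<theta> (- 1) \<omega>)) (\<lambda>\<omega>. c (\<theta> (- 1) \<omega>))"
proof (intro flow_cocycle.intro flow_cocycle_axioms.intro ergodic_flow_reverse)
  have m1: "- 1 \<in> T" using time_minus[of 1] by simp
  then have [measurable]: "\<theta> (- 1) \<in> measurable M M" by simp
  show "(\<lambda>\<omega>. f (\<theta> (- 1) \<omega>)) \<in> borel_measurable M" by measurable
  show "(\<integral>\<^sup>+\<omega>. ennreal (f (\<theta> (- 1) \<omega>)) \<partial>M) < \<infinity>"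
    using f_pos nn_integral_flow[OF m1, of "\<lambda>\<omega>. ennreal (f \<omega>)"] by simp
  show "integrable M (\<lambda>\<omega>. c (\<theta> (- 1) \<omega>))" using c_integrable m1 by (intro integrable_flow)
  show "dual_flow \<theta> t \<omega> \<in> F" if "\<omega> \<in> F" "t \<in> T" for t \<omega>
    using that F_flow by (simp add: dual_flow_def)
  show "- g (- (s + t)) \<omega> = - g (- t) \<omega> + - g (- s) (dual_flow \<theta> t \<omega>)"
    if "s \<in> T" "t \<in> T" "\<omega> \<in> F" for s t \<omega>
    using cocycle[of "- s" "- t" \<omega>] that by (simp add: dual_flow_def)
  have reversed: "- g (- s) \<omega> = g 1 (\<theta> (- 1) \<omega>) - g (1 - s) (\<theta> (- 1) \<omega>)"
    if s: "s \<in> T" and \<omega>: "\<omega> \<in> F" for s \<omega>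
  proof -
    have "g (1 + - 1) \<omega> = g (- 1) \<omega> + g 1 (\<theta> (- 1) \<omega>)" using m1 \<omega> by (intro cocycle) auto
    moreover have "g ((1 - s) + - 1) \<omega> = g (- 1) \<omega> + g (1 - s) (\<theta> (- 1) \<omega>)"
      using m1 s \<omega> by (intro cocycle) auto
    ultimately show ?thesis using \<omega> by (simp add: cocycle_zero)
  qed
  show "- g (- 1) \<omega> = f (\<theta> (- 1) \<omega>)" if "\<omega> \<in> F" for \<omega>
    using reversed[of 1 \<omega>] that F_flow[OF that m1] by (simp add: f_eq cocycle_zero)
  show "AE \<omega> in M. \<forall>s\<in>T \<inter> {0..1}. - g (- s) \<omega> \<le> c (\<theta> (- 1) \<omega>) \<and>
      - g (- 1) \<omega> - - g (- s) \<omega> \<le> c (\<theta> (- 1) \<omega>)"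
    using AE_flow[OF c_bound m1] F_full
  proof eventually_elim
    case (elim \<omega>)
    show ?case
    proof
      fix s assume s: "s \<in> T \<inter> {0..1}"
      then have "1 - s \<in> T \<inter> {0..1}" by auto
      then have "g (1 - s) (\<theta> (- 1) \<omega>) \<le> c (\<theta> (- 1) \<omega>)"
        "g 1 (\<theta> (- 1) \<omega>) - g (1 - s) (\<theta> (- 1) \<omega>) \<le> c (\<theta> (- 1) \<omega>)" using elim by blast+
      then show "- g (- s) \<omega> \<le> c (\<theta> (- 1) \<omega>) \<and> - g (- 1) \<omega> - - g (- s) \<omega> \<le> c (\<theta> (- 1) \<omega>)"
        using reversed[of s \<omega>] reversed[of 1 \<omega>] elim s F_flow[OF elim(2) m1] by (simp add: cocycle_zero)
    qed
  qed
qed (use F_space F_full in auto)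

theorem AE_two_sided_rate:
  "AE \<omega> in M. ((\<lambda>t. ereal (1 / t * g t \<omega>)) \<longlongrightarrow> ext_integral M f) forward \<and>
     ((\<lambda>t. ereal (1 / t * g t \<omega>)) \<longlongrightarrow> ext_integral M f) (inf at_bot (principal T))"
proof -
  interpret R: flow_cocycle M T "dual_flow \<theta>" F "\<lambda>t \<omega>. - g (- t) \<omega>" "\<lambda>\<omega>. f (\<theta> (- 1) \<omega>)"
      "\<lambda>\<omega>. c (\<theta> (- 1) \<omega>)"
    by (rule reverse_cocycle)
  have "ext_integral M (\<lambda>\<omega>. f (\<theta> (- 1) \<omega>)) = ext_integral M f"
    using time_minus[of 1] by (intro ext_integral_flow) auto
  with R.AE_forward_rate have "AE \<omega> in M. ((\<lambda>t. ereal (1 / t * (- g (- t) \<omega>))) \<longlongrightarrow> ext_integral M f) forward"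
    by simp
  with AE_forward_rate show ?thesis
    unfolding tendsto_backward_iff by eventually_elim simp
qed

end

section \<open>The attracting direction of a focusing system\<close>

text \<open>Time and state space are abstract here, so that the results apply to a system and to its dual
  alike.\<close>

locale focusing_flow = ergodic_flow M T \<theta> + ordered_cone C
  for M :: "'w measure" and T \<theta> and C :: "'x::banach set" +
  fixes U :: "'w \<Rightarrow> real \<Rightarrow> 'x \<Rightarrow>\<^sub>L 'x" and e :: 'x and \<kappa> :: "'w \<Rightarrow> real"
  assumes skew: "skew_product T M \<theta> U"
    and mono_norm: "monotonic_norm C"
    and integrable_sys: "integrable_system T M \<theta> U"
    and focusing: "focusing_system T M \<theta> U C e \<kappa>"
begin

lemma U_zero: "\<omega> \<in> space M \<Longrightarrow> U \<omega> 0 x = x"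
  using skew by (simp add: skew_product_def)

lemma U_add:
  assumes "\<omega> \<in> space M" "s \<in> T" "0 \<le> s" "t \<in> T" "0 \<le> t"
  shows "U (\<theta> s \<omega>) t (U \<omega> s x) = U \<omega> (s + t) x"
proof -
  have "U (\<theta> s \<omega>) t o\<^sub>L U \<omega> s = U \<omega> (t + s)"
    using skew assms by (auto simp: skew_product_def)
  then show ?thesis by (metis add.commute blinfun_apply_blinfun_compose)
qed

lemma U_positive: "\<omega> \<in> space M \<Longrightarrow> t \<in> T \<Longrightarrow> 0 \<le> t \<Longrightarrow> positive_map (U \<omega> t)"
  using focusing by (auto simp: focusing_system_def positive_system_def positive_map_def)

lemma U_focuses: "\<omega> \<in> space M \<Longrightarrow> focuses e (\<kappa> \<omega>) (U \<omega> 1)"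
  using focusing by (auto simp: focusing_system_def focuses_def)

lemma e_cone: "e \<in> C - {0}" and e_unit: "norm e = 1"
  and \<kappa>_ge_1: "\<omega> \<in> space M \<Longrightarrow> 1 \<le> \<kappa> \<omega>" and \<kappa>_measurable [measurable]: "\<kappa> \<in> borel_measurable M"
  using focusing by (auto simp: focusing_system_def)

lemma U_measurable:
  assumes "t \<in> T" "0 \<le> t" "h \<in> measurable N M" "u \<in> borel_measurable N"
  shows "(\<lambda>x. U (h x) t (u x)) \<in> borel_measurable N"
proof -
  have 1: "(\<lambda>(t, \<omega>, u). blinfun_apply (U \<omega> t) u)
       \<in> measurable (restrict_space borel (T \<inter> {0..}) \<Otimes>\<^sub>M M \<Otimes>\<^sub>M borel) borel"
    using skew by (simp add: skew_product_def)
  have "(\<lambda>x. (t, h x, u x)) \<in> measurable N (restrict_space borel (T \<inter> {0..}) \<Otimes>\<^sub>M M \<Otimes>\<^sub>M borel)"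
    using assms by (intro measurable_Pair measurable_const) (auto simp: space_restrict_space)
  from measurable_compose[OF this 1] show ?thesis by simp
qed

text \<open>At integer times the focusing condition keeps states away from zero; a state that vanished
  earlier would also vanish at the next integer time.\<close>

lemma U_nonzero:
  assumes "\<omega> \<in> space M" "t \<in> T" "0 \<le> t" "x \<in> C - {0}"
  shows "U \<omega> t x \<in> C - {0}"
proof -
  have nat: "U \<omega> (real n) x \<in> C - {0}" for n
  proof (induction n)
    case (Suc n)
    have "U (\<theta> (real n) \<omega>) 1 (U \<omega> (real n) x) \<in> C - {0}"
      using assms Suc by (intro focuses_nonzero[OF U_focuses e_cone]) auto
    then show ?case using assms U_add[of \<omega> "real n" 1 x] by (simp add: add.commute)
  qed (use assms in \<open>simp add: U_zero\<close>)
  obtain n :: nat where n: "t \<le> real n" using real_arch_simple by blast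
  have "U (\<theta> t \<omega>) (real n - t) (U \<omega> t x) = U \<omega> (real n) x"
    using U_add[of \<omega> t "real n - t" x] n assms by simp
  then have "U \<omega> t x \<noteq> 0" using nat[of n] by auto
  moreover have "U \<omega> t x \<in> C" using assms by (intro positive_map_cone U_positive) auto
  ultimately show ?thesis by simp
qed

lemma pullback_split:
  assumes "\<omega> \<in> space M" "n \<le> m"
  shows "U (\<theta> (- real m) \<omega>) (real m) x
       = U (\<theta> (- real n) \<omega>) (real n) (U (\<theta> (- real m) \<omega>) (real (m - n)) x)"
  using assms U_add[of "\<theta> (- real m) \<omega>" "real (m - n)" "real n" x]
  by (simp add: flow_flow of_nat_diff)

text \<open>The attraction in \<open>\<omega>\<close> from the past: the directions at time \<open>0\<close> of positive states started
  at time \<open>- N\<close> become indistinguishable as \<open>N\<close> grows.\<close>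

definition contracting :: "'w \<Rightarrow> bool" where
  "contracting \<omega> \<longleftrightarrow> (\<forall>\<epsilon>>0. \<exists>N::nat. \<forall>x\<in>C - {0}. \<forall>y\<in>C - {0}.
     osc_le \<epsilon> (U (\<theta> (- real N) \<omega>) (real N) x) (U (\<theta> (- real N) \<omega>) (real N) y))"

lemma iterated_contraction:
  assumes \<omega>: "\<omega> \<in> space M"
  shows "v \<in> C - {0} \<Longrightarrow> a *\<^sub>R v \<preceq> u \<Longrightarrow> u \<preceq> b *\<^sub>R v \<Longrightarrow>
    \<exists>a'\<ge>a. \<exists>b'. b' - a' \<le> (\<Prod>j<n. 1 - 1 / \<kappa> (\<theta> (- real (Suc j)) \<omega>)) * (b - a) \<and>
      a' *\<^sub>R U (\<theta> (- real n) \<omega>) (real n) v \<preceq> U (\<theta> (- real n) \<omega>) (real n) u \<and>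
      U (\<theta> (- real n) \<omega>) (real n) u \<preceq> b' *\<^sub>R U (\<theta> (- real n) \<omega>) (real n) v"
proof (induction n arbitrary: u v a b)
  case 0
  then show ?case using \<omega> by (auto simp: U_zero)
next
  case (Suc n)
  let ?\<omega>' = "\<theta> (- real (Suc n)) \<omega>" and ?q = "\<lambda>j. 1 - 1 / \<kappa> (\<theta> (- real (Suc j)) \<omega>)"
  have \<omega>': "?\<omega>' \<in> space M" using \<omega> by (intro flow_space time_simps)
  have q: "0 \<le> ?q j" for j using \<kappa>_ge_1[of "\<theta> (- real (Suc j)) \<omega>"] \<omega> time_simps(4)[of "Suc j"] by (simp del: of_nat_Suc)
  obtain a1 b1 where ab: "a1 \<ge> a" "b1 - a1 \<le> ?q n * (b - a)"
      "a1 *\<^sub>R U ?\<omega>' 1 v \<preceq> U ?\<omega>' 1 u" "U ?\<omega>' 1 u \<preceq> b1 *\<^sub>R U ?\<omega>' 1 v"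
    using oscillation_contraction[OF U_focuses[OF \<omega>'] \<kappa>_ge_1[OF \<omega>'] e_cone Suc.prems] by blast
  have v1: "U ?\<omega>' 1 v \<in> C - {0}" using Suc.prems \<omega>' by (intro U_nonzero) auto
  have split: "U ?\<omega>' (real (Suc n)) x = U (\<theta> (- real n) \<omega>) (real n) (U ?\<omega>' 1 x)" for x
    using pullback_split[OF \<omega>, of n "Suc n" x] by simp
  obtain a' b' where a'b': "a' \<ge> a1" "b' - a' \<le> (\<Prod>j<n. ?q j) * (b1 - a1)"
      "a' *\<^sub>R U ?\<omega>' (real (Suc n)) v \<preceq> U ?\<omega>' (real (Suc n)) u"
      "U ?\<omega>' (real (Suc n)) u \<preceq> b' *\<^sub>R U ?\<omega>' (real (Suc n)) v"
    using Suc.IH[OF v1 ab(3,4)] unfolding split by blast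
  have "(\<Prod>j<n. ?q j) * (b1 - a1) \<le> (\<Prod>j<n. ?q j) * (?q n * (b - a))"
    using ab q by (intro mult_left_mono prod_nonneg) auto
  also have "\<dots> = (\<Prod>j<Suc n. ?q j) * (b - a)" by simp
  finally have "b' - a' \<le> (\<Prod>j<Suc n. ?q j) * (b - a)" using a'b'(2) by linarith
  then show ?case using a'b' ab(1) by (intro exI[of _ a'] exI[of _ b'] conjI) auto
qed

text \<open>Every visit of the past orbit to the region \<open>\<kappa> \<le> K\<close> contributes a factor at most \<open>1 - 1/K\<close>
  to the oscillation, and the same bound on \<open>\<kappa>\<close> at the starting time bounds the initial
  oscillation by \<open>K\<^sup>2\<close>.\<close>

lemma contracting_of_recurrent:
  assumes \<omega>: "\<omega> \<in> space M" and rec: "\<exists>\<^sub>F n in sequentially. \<kappa> (\<theta> (- real n) \<omega>) \<le> K"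
  shows "contracting \<omega>"
  unfolding contracting_def
proof (intro allI impI)
  fix \<epsilon> :: real assume \<epsilon>: "\<epsilon> > 0"
  have visit: "\<exists>n\<ge>N. \<kappa> (\<theta> (- real (Suc n)) \<omega>) \<le> K" for N
  proof -
    obtain n where "n \<ge> Suc N" "\<kappa> (\<theta> (- real n) \<omega>) \<le> K"
      using rec unfolding frequently_sequentially by blast
    then show ?thesis by (intro exI[of _ "n - 1"]) auto
  qed
  \<comment> \<open>\<open>?k j\<close> belongs to the step from time \<open>- (j + 1)\<close> to time \<open>- j\<close>\<close>
  let ?k = "\<lambda>j. \<kappa> (\<theta> (- real (Suc j)) \<omega>)"
  have k1: "1 \<le> ?k j" for j using \<omega> by (intro \<kappa>_ge_1 flow_space time_simps)
  have K1: "1 \<le> K" using visit[of 0] k1 order_trans by blast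
  define D where "D n = (\<Prod>j<n. 1 - 1 / ?k j)" for n
  have q: "0 \<le> 1 - 1 / ?k j" "1 - 1 / ?k j \<le> 1" for j using k1[of j] by auto
  have D0: "0 \<le> D n" for n unfolding D_def by (intro prod_nonneg ballI q(1))
  have D_Suc: "D (Suc n) = D n * (1 - 1 / ?k n)" for n by (simp add: D_def)
  have "D (Suc n) \<le> D n" for n unfolding D_Suc by (rule mult_left_le[OF q(2) D0])
  then have D_anti: "D m \<le> D n" if "n \<le> m" for n m
    using that by (rule lift_Suc_antimono_le[of D])
  have "\<exists>n. D n \<le> (1 - 1 / K) ^ m" for m
  proof (induction m)
    case 0
    show ?case by (intro exI[of _ 0]) (simp add: D_def)
  next
    case (Suc m)
    then obtain n where n: "D n \<le> (1 - 1 / K) ^ m" by blast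
    obtain n' where n': "n' \<ge> n" "?k n' \<le> K" using visit by blast
    have "1 - 1 / ?k n' \<le> 1 - 1 / K"
      using n'(2) k1[of n'] by (simp add: frac_le)
    then have "D (Suc n') \<le> (1 - 1 / K) ^ m * (1 - 1 / K)"
      unfolding D_Suc using D_anti[OF n'(1)] n q(1)[of n'] K1 by (intro mult_mono) simp_all
    then show ?case by (intro exI[of _ "Suc n'"]) (simp add: mult.commute)
  qed
  moreover have "\<exists>m. (1 - 1 / K) ^ m < \<epsilon> / K\<^sup>2"
    using \<epsilon> K1 by (intro real_arch_pow_inv) auto
  ultimately obtain n0 where n0: "D n0 < \<epsilon> / K\<^sup>2"
    using le_less_trans by blast
  obtain n where n: "n \<ge> n0" "?k n \<le> K" using visit by blast
  let ?\<omega>' = "\<theta> (- real (Suc n)) \<omega>"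
  have \<omega>': "?\<omega>' \<in> space M" using \<omega> by (intro flow_space time_simps)
  show "\<exists>N::nat. \<forall>x\<in>C - {0}. \<forall>y\<in>C - {0}.
     osc_le \<epsilon> (U (\<theta> (- real N) \<omega>) (real N) x) (U (\<theta> (- real N) \<omega>) (real N) y)"
  proof (intro exI[of _ "Suc n"] ballI)
    fix x y assume x: "x \<in> C - {0}" and y: "y \<in> C - {0}"
    let ?x = "U ?\<omega>' 1 x" and ?y = "U ?\<omega>' 1 y"
    obtain p where p: "p > 0" "p *\<^sub>R e \<preceq> ?x" "?x \<preceq> (?k n * p) *\<^sub>R e"
      using U_focuses[OF \<omega>'] x unfolding focuses_def by blast
    obtain q where q: "q > 0" "q *\<^sub>R e \<preceq> ?y" "?y \<preceq> (?k n * q) *\<^sub>R e"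
      using U_focuses[OF \<omega>'] y unfolding focuses_def by blast
    \<comment> \<open>comparing both images with \<open>e\<close> puts their quotient into \<open>[a, a (?k n)\<^sup>2]\<close>\<close>
    define a where "a = p / (?k n * q)"
    have k0: "0 < ?k n" using k1[of n] by linarith
    have a0: "0 < a" using p q k0 by (simp add: a_def)
    have ak: "a * (?k n * q) = p" using q k0 by (simp add: a_def)
    have lo: "a *\<^sub>R ?y \<preceq> ?x"
    proof -
      have "a *\<^sub>R ?y \<preceq> p *\<^sub>R e"
        using below_scale[OF q(3), of a] a0 unfolding scaleR_scaleR ak by simp
      then show ?thesis using p(2) by (rule below_trans)
    qed
    have bk: "(a * (?k n)\<^sup>2) * q = ?k n * p"
      using arg_cong[OF ak, of "\<lambda>z. ?k n * z"] by (simp add: power2_eq_square ac_simps)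
    have hi: "?x \<preceq> (a * (?k n)\<^sup>2) *\<^sub>R ?y"
    proof -
      have "(?k n * p) *\<^sub>R e \<preceq> (a * (?k n)\<^sup>2) *\<^sub>R ?y"
        using below_scale[OF q(2), of "a * (?k n)\<^sup>2"] a0 unfolding scaleR_scaleR bk by simp
      with p(3) show ?thesis by (rule below_trans)
    qed
    have y1: "?y \<in> C - {0}" using y \<omega>' by (intro U_nonzero) auto
    have split: "U ?\<omega>' (real (Suc n)) z = U (\<theta> (- real n) \<omega>) (real n) (U ?\<omega>' 1 z)" for z
      using pullback_split[OF \<omega>, of n "Suc n" z] by simp
    obtain a' b' where ab: "a' \<ge> a" "b' - a' \<le> D n * (a * (?k n)\<^sup>2 - a)"
        "a' *\<^sub>R U ?\<omega>' (real (Suc n)) y \<preceq> U ?\<omega>' (real (Suc n)) x"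
        "U ?\<omega>' (real (Suc n)) x \<preceq> b' *\<^sub>R U ?\<omega>' (real (Suc n)) y"
      using iterated_contraction[OF \<omega> y1 lo hi, of n] unfolding split D_def by blast
    have "D n * (a * (?k n)\<^sup>2 - a) \<le> (\<epsilon> / K\<^sup>2) * (a' * K\<^sup>2)"
    proof (rule mult_mono)
      show "D n \<le> \<epsilon> / K\<^sup>2" using n0 D_anti[OF n(1)] by linarith
      have "(?k n)\<^sup>2 \<le> K\<^sup>2" using n(2) k1[of n] by (intro power_mono) auto
      then have "a * (?k n)\<^sup>2 \<le> a' * K\<^sup>2" using ab(1) a0 by (intro mult_mono) auto
      then show "a * (?k n)\<^sup>2 - a \<le> a' * K\<^sup>2" using a0 by linarith
      have "1 \<le> (?k n)\<^sup>2" using k1[of n] by simp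
      then show "0 \<le> a * (?k n)\<^sup>2 - a" using a0 by simp
    qed (use \<epsilon> in simp)
    also have "\<dots> = \<epsilon> * a'" using K1 by simp
    finally have "b' \<le> (1 + \<epsilon>) * a'" using ab(2) by (simp add: algebra_simps)
    moreover have "U ?\<omega>' (real (Suc n)) y \<in> C"
      using U_nonzero[OF \<omega>', of "real (Suc n)" y] y by (simp del: of_nat_Suc)
    ultimately have "U ?\<omega>' (real (Suc n)) x \<preceq> ((1 + \<epsilon>) * a') *\<^sub>R U ?\<omega>' (real (Suc n)) y"
      using ab(4) below_scaleR_left below_trans by blast
    then show "osc_le \<epsilon> (U ?\<omega>' (real (Suc n)) x) (U ?\<omega>' (real (Suc n)) y)"
      unfolding osc_le_def using ab a0 by (intro exI[of _ a'] conjI) auto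
  qed
qed

lemma contracting_forward:
  assumes \<omega>: "\<omega> \<in> space M" and con: "contracting \<omega>" and s: "s \<in> T" "0 \<le> s"
  shows "contracting (\<theta> s \<omega>)"
  unfolding contracting_def
proof (intro allI impI)
  fix \<epsilon> :: real assume "\<epsilon> > 0"
  then obtain N :: nat where N: "\<And>x y. x \<in> C - {0} \<Longrightarrow> y \<in> C - {0} \<Longrightarrow>
      osc_le \<epsilon> (U (\<theta> (- real N) \<omega>) (real N) x) (U (\<theta> (- real N) \<omega>) (real N) y)"
    using con unfolding contracting_def by blast
  obtain m :: nat where m: "s \<le> real m" using real_arch_simple by blast
  let ?\<omega>' = "\<theta> (- real (N + m)) (\<theta> s \<omega>)"
  have eq: "?\<omega>' = \<theta> (s - real (N + m)) \<omega>"
    using \<omega> s time_simps(4)[of "N + m"] by (subst flow_flow) (auto simp: algebra_simps)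
  have \<omega>': "?\<omega>' \<in> space M" using \<omega> s by (intro flow_space time_simps) 
  have 1: "\<theta> (real m - s) ?\<omega>' = \<theta> (- real N) \<omega>"
    unfolding eq using \<omega> s by (subst flow_flow) auto
  have split: "U ?\<omega>' (real (N + m)) z = U \<omega> s (U (\<theta> (- real N) \<omega>) (real N) (U ?\<omega>' (real m - s) z))" for z
  proof -
    have "U (\<theta> (- real N) \<omega>) (real N) (U ?\<omega>' (real m - s) z) = U ?\<omega>' (real m - s + real N) z"
      using U_add[OF \<omega>', of "real m - s" "real N" z, unfolded 1] m s by simp
    moreover have "\<theta> (real m - s + real N) ?\<omega>' = \<omega>"
      unfolding eq using \<omega> s by (subst flow_flow) (auto simp: algebra_simps)
    then have "U \<omega> s (U ?\<omega>' (real m - s + real N) z) = U ?\<omega>' (real m - s + real N + s) z"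
      using U_add[OF \<omega>', of "real m - s + real N" s z] m s by simp
    ultimately show ?thesis by (simp add: add.commute)
  qed
  show "\<exists>N::nat. \<forall>x\<in>C - {0}. \<forall>y\<in>C - {0}.
     osc_le \<epsilon> (U (\<theta> (- real N) (\<theta> s \<omega>)) (real N) x) (U (\<theta> (- real N) (\<theta> s \<omega>)) (real N) y)"
  proof (intro exI[of _ "N + m"] ballI)
    fix x y assume xy: "x \<in> C - {0}" "y \<in> C - {0}"
    have ms: "real m - s \<in> T" "0 \<le> real m - s" using m s by simp_all
    from xy have "U ?\<omega>' (real m - s) x \<in> C - {0}" "U ?\<omega>' (real m - s) y \<in> C - {0}"
      using U_nonzero[OF \<omega>' ms] by blast+
    then show "osc_le \<epsilon> (U ?\<omega>' (real (N + m)) x) (U ?\<omega>' (real (N + m)) y)"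
      unfolding split using \<omega> s by (intro osc_le_map N U_positive)
  qed
qed

text \<open>Contraction is required along the whole orbit, so that the set is invariant by definition
  under real time as well.\<close>

definition regular :: "'w set" where
  "regular = {\<omega>\<in>space M. \<forall>s\<in>T. contracting (\<theta> s \<omega>)}"

lemma regular_space: "regular \<subseteq> space M"
  by (auto simp: regular_def)

lemma regular_contracting: "\<omega> \<in> regular \<Longrightarrow> contracting \<omega>"
  unfolding regular_def using flow_zero time_simps(1) by (metis (mono_tags, lifting) mem_Collect_eq)

lemma regular_flow: "\<omega> \<in> regular \<Longrightarrow> t \<in> T \<Longrightarrow> \<theta> t \<omega> \<in> regular"
  by (auto simp: regular_def flow_flow)

lemma AE_regular: "AE \<omega> in M. \<omega> \<in> regular"
proof -
  have "AE \<omega> in M. \<exists>K. \<exists>\<^sub>F n in sequentially. \<kappa> (\<theta> (- real n) \<omega>) \<le> K"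
    by (rule recurrence) simp_all
  then show ?thesis
    using AE_space
  proof eventually_elim
    case (elim \<omega>)
    then have \<omega>: "\<omega> \<in> space M" by simp
    from elim obtain K where K: "\<exists>\<^sub>F n in sequentially. \<kappa> (\<theta> (- real n) \<omega>) \<le> K" by blast
    have "contracting (\<theta> s \<omega>)" if s: "s \<in> T" for s
    proof -
      obtain m :: nat where m: "- s \<le> real m" using real_arch_simple by blast
      have "\<exists>\<^sub>F n in sequentially. \<kappa> (\<theta> (- real n) (\<theta> (- real m) \<omega>)) \<le> K"
        unfolding frequently_sequentially
      proof
        fix N
        obtain n where "n \<ge> N + m" "\<kappa> (\<theta> (- real n) \<omega>) \<le> K"
          using K unfolding frequently_sequentially by blast
        then show "\<exists>n\<ge>N. \<kappa> (\<theta> (- real n) (\<theta> (- real m) \<omega>)) \<le> K"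
          using \<omega> by (intro exI[of _ "n - m"]) (auto simp: flow_flow of_nat_diff)
      qed
      then have "contracting (\<theta> (- real m) \<omega>)" using \<omega> by (intro contracting_of_recurrent) auto
      then have "contracting (\<theta> (s + real m) (\<theta> (- real m) \<omega>))"
        using \<omega> s m by (intro contracting_forward[of "\<theta> (- real m) \<omega>"]) auto
      then show ?thesis using \<omega> s by (simp add: flow_flow)
    qed
    then show "\<omega> \<in> regular" using \<omega> by (simp add: regular_def)
  qed
qed

definition direction :: "'w \<Rightarrow> 'x" where
  "direction \<omega> = lim (\<lambda>n. sgn (U (\<theta> (- real n) \<omega>) (real n) e))"

text \<open>A pullback from a time before \<open>- N\<close> factors through time \<open>- N\<close>, so one \<open>N\<close> with small oscillation
  controls all earlier starting times.\<close>

lemma pullback_close: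
  assumes \<omega>: "\<omega> \<in> space M" and con: "contracting \<omega>" and \<epsilon>: "\<epsilon> > 0"
  shows "\<exists>N. \<forall>n\<ge>N. \<forall>m\<ge>N. \<forall>x\<in>C - {0}. \<forall>y\<in>C - {0}.
    norm (sgn (U (\<theta> (- real n) \<omega>) (real n) x) - sgn (U (\<theta> (- real m) \<omega>) (real m) y)) < \<epsilon>"
proof -
  obtain N :: nat where N: "\<And>x y. x \<in> C - {0} \<Longrightarrow> y \<in> C - {0} \<Longrightarrow>
      osc_le (\<epsilon> / 4) (U (\<theta> (- real N) \<omega>) (real N) x) (U (\<theta> (- real N) \<omega>) (real N) y)"
    using con[unfolded contracting_def, rule_format, of "\<epsilon> / 4"] \<epsilon> by auto
  have \<omega>N: "\<theta> (- real N) \<omega> \<in> space M" using \<omega> by (intro flow_space time_simps)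
  have "norm (sgn (U (\<theta> (- real n) \<omega>) (real n) x) - sgn (U (\<theta> (- real m) \<omega>) (real m) y)) < \<epsilon>"
    if nm: "n \<ge> N" "m \<ge> N" and xy: "x \<in> C - {0}" "y \<in> C - {0}" for n m x y
  proof -
    define x' where "x' = U (\<theta> (- real n) \<omega>) (real (n - N)) x"
    define y' where "y' = U (\<theta> (- real m) \<omega>) (real (m - N)) y"
    let ?P = "U (\<theta> (- real N) \<omega>) (real N)"
    have c: "x' \<in> C - {0}" "y' \<in> C - {0}"
      unfolding x'_def y'_def using \<omega> xy by (intro U_nonzero flow_space time_simps; simp)+
    then have P: "?P x' \<in> C - {0}" "?P y' \<in> C - {0}"
      using \<omega>N by (intro U_nonzero; simp)+
    have "osc_le (\<epsilon> / 4) (sgn (?P x')) (sgn (?P y'))"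
      unfolding sgn_div_norm using P by (intro osc_le_scaleR N c) auto
    then have "norm (sgn (?P x') - sgn (?P y')) \<le> 2 * (\<epsilon> / 4)"
      using P \<epsilon> by (intro osc_le_imp_norm_diff_le mono_norm)
        (auto simp: norm_sgn sgn_div_norm intro!: cone_scale)
    then show ?thesis
      using \<epsilon> pullback_split[OF \<omega> nm(1), of x] pullback_split[OF \<omega> nm(2), of y]
      by (simp add: x'_def y'_def)
  qed
  then show ?thesis by blast
qed

lemma direction_limit:
  assumes "\<omega> \<in> space M" "contracting \<omega>"
  shows "(\<lambda>n. sgn (U (\<theta> (- real n) \<omega>) (real n) e)) \<longlonglongrightarrow> direction \<omega>"
proof -
  have "Cauchy (\<lambda>n. sgn (U (\<theta> (- real n) \<omega>) (real n) e))"
  proof (rule metric_CauchyI)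
    fix \<epsilon> :: real assume "0 < \<epsilon>"
    from pullback_close[OF assms this] e_cone
    show "\<exists>N. \<forall>m\<ge>N. \<forall>n\<ge>N. dist (sgn (U (\<theta> (- real m) \<omega>) (real m) e))
        (sgn (U (\<theta> (- real n) \<omega>) (real n) e)) < \<epsilon>"
      unfolding dist_norm by blast
  qed
  then show ?thesis
    unfolding direction_def by (simp add: Cauchy_convergent_iff convergent_LIMSEQ_iff)
qed

lemma direction_attracts:
  assumes \<omega>: "\<omega> \<in> space M" "contracting \<omega>" and x: "\<And>n. x n \<in> C - {0}"
  shows "(\<lambda>n. sgn (U (\<theta> (- real n) \<omega>) (real n) (x n))) \<longlonglongrightarrow> direction \<omega>"
proof -
  have "(\<lambda>n. sgn (U (\<theta> (- real n) \<omega>) (real n) (x n)) - sgn (U (\<theta> (- real n) \<omega>) (real n) e)) \<longlonglongrightarrow> 0"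
  proof (rule LIMSEQ_I)
    fix \<epsilon> :: real assume "0 < \<epsilon>"
    from pullback_close[OF \<omega> this] x e_cone
    show "\<exists>N. \<forall>n\<ge>N. norm (sgn (U (\<theta> (- real n) \<omega>) (real n) (x n))
        - sgn (U (\<theta> (- real n) \<omega>) (real n) e) - 0) < \<epsilon>"
      unfolding diff_zero by blast
  qed
  from tendsto_add[OF this direction_limit[OF \<omega>]] show ?thesis by simp
qed

lemma pullback_nonzero:
  assumes "\<omega> \<in> space M"
  shows "U (\<theta> (- real n) \<omega>) (real n) e \<in> C - {0}"
  by (rule U_nonzero[OF _ _ _ e_cone]) (use assms in \<open>simp_all del: Diff_iff\<close>)

lemma direction_unit: "\<omega> \<in> space M \<Longrightarrow> contracting \<omega> \<Longrightarrow> norm (direction \<omega>) = 1"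
proof -
  assume \<omega>: "\<omega> \<in> space M" "contracting \<omega>"
  have "norm (sgn (U (\<theta> (- real n) \<omega>) (real n) e)) = 1" for n
    using pullback_nonzero[OF \<omega>(1), of n] by (simp add: norm_sgn)
  with tendsto_norm[OF direction_limit[OF \<omega>]]
  have "(\<lambda>n::nat. 1) \<longlonglongrightarrow> norm (direction \<omega>)" by (simp only:)
  then show ?thesis by (simp add: LIMSEQ_const_iff)
qed

lemma direction_cone: "\<omega> \<in> space M \<Longrightarrow> contracting \<omega> \<Longrightarrow> direction \<omega> \<in> C - {0}"
proof -
  assume \<omega>: "\<omega> \<in> space M" "contracting \<omega>"
  have "sgn (U (\<theta> (- real n) \<omega>) (real n) e) \<in> C" for n
    unfolding sgn_div_norm using pullback_nonzero[OF \<omega>(1), of n] by (intro cone_scale) auto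
  then have "direction \<omega> \<in> C"
    by (intro closed_sequentially[OF cone_closed _ direction_limit[OF \<omega>]]) auto
  then show ?thesis using direction_unit[OF \<omega>] by auto
qed

text \<open>Both sides are limits of normalised pullbacks to the time \<open>t\<close>, started from \<open>e\<close> at the time
  \<open>- n\<close> and seen either directly or through the state at time \<open>0\<close>.\<close>

lemma direction_flow:
  assumes \<omega>: "\<omega> \<in> regular" and t: "t \<in> T" "0 \<le> t"
  shows "direction (\<theta> t \<omega>) = sgn (U \<omega> t (direction \<omega>))"
proof -
  have sp: "\<omega> \<in> space M" "contracting \<omega>" "\<theta> t \<omega> \<in> space M" "contracting (\<theta> t \<omega>)"
    using \<omega> t regular_space regular_contracting regular_flow by auto
  let ?x = "\<lambda>n. U (\<theta> (- real n) \<omega>) t e"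
  have x: "?x n \<in> C - {0}" for n using sp t e_cone by (intro U_nonzero flow_space time_simps)
  have "sgn (U (\<theta> (- real n) (\<theta> t \<omega>)) (real n) (?x n)) = sgn (U \<omega> t (sgn (U (\<theta> (- real n) \<omega>) (real n) e)))" for n
  proof -
    let ?\<omega>' = "\<theta> (- real n) \<omega>"
    have \<omega>': "?\<omega>' \<in> space M" using sp by (intro flow_space time_simps)
    have 1: "\<theta> (- real n) (\<theta> t \<omega>) = \<theta> t ?\<omega>'" "\<theta> (real n) ?\<omega>' = \<omega>"
      using sp t by (simp_all add: flow_flow add.commute)
    have "U (\<theta> t ?\<omega>') (real n) (U ?\<omega>' t e) = U ?\<omega>' (t + real n) e"
      using \<omega>' t by (intro U_add) auto
    also have "\<dots> = U \<omega> t (U ?\<omega>' (real n) e)"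
      using U_add[OF \<omega>', of "real n" t e] t by (simp add: 1 add.commute)
    finally have 2: "U (\<theta> (- real n) (\<theta> t \<omega>)) (real n) (?x n) = U \<omega> t (U ?\<omega>' (real n) e)"
      by (simp add: 1)
    have "norm (U ?\<omega>' (real n) e) > 0" using U_nonzero[OF \<omega>', of "real n" e] e_cone by auto
    then show ?thesis unfolding 2 sgn_div_norm[of "U ?\<omega>' (real n) e"] blinfun.scaleR_right
      by (simp add: sgn_scaleR)
  qed
  then have "(\<lambda>n. sgn (U \<omega> t (sgn (U (\<theta> (- real n) \<omega>) (real n) e)))) \<longlonglongrightarrow> direction (\<theta> t \<omega>)"
    using direction_attracts[OF sp(3,4), of ?x] x by simp
  moreover have "(\<lambda>n. sgn (U \<omega> t (sgn (U (\<theta> (- real n) \<omega>) (real n) e)))) \<longlonglongrightarrow> sgn (U \<omega> t (direction \<omega>))"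
    using U_nonzero[OF sp(1) t direction_cone[OF sp(1,2)]]
    by (intro tendsto_sgn blinfun.tendsto tendsto_const direction_limit sp) auto
  ultimately show ?thesis by (rule LIMSEQ_unique)
qed

lemma focused_unit_bounds:
  assumes foc: "focuses e k L" and k: "1 \<le> k" and x: "x \<in> C - {0}"
  shows "(1 / k) *\<^sub>R e \<preceq> sgn (L x)" "sgn (L x) \<preceq> k *\<^sub>R e"
proof -
  obtain b where b: "b > 0" "b *\<^sub>R e \<preceq> L x" "L x \<preceq> (k * b) *\<^sub>R e"
    using foc x unfolding focuses_def by blast
  have Lx: "L x \<in> C - {0}" by (rule focuses_nonzero[OF foc e_cone x])
  then have n0: "norm (L x) > 0" by simp
  have mono': "norm x \<le> norm y" if "x \<in> C" "x \<preceq> y" for x y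
    using mono_norm that by (auto simp: monotonic_norm_def zero_below)
  have "b *\<^sub>R e \<in> C" using b e_cone by (intro cone_scale) auto
  then have n1: "b \<le> norm (L x)" using mono'[of "b *\<^sub>R e" "L x"] b e_unit by simp
  have n2: "norm (L x) \<le> k * b" using mono'[of "L x" "(k * b) *\<^sub>R e"] Lx b e_unit k by simp
  have "1 / k \<le> b / norm (L x)" using n2 n0 k by (simp add: field_simps)
  then have "(1 / k) *\<^sub>R e \<preceq> (b / norm (L x)) *\<^sub>R e" using e_cone by (intro below_scaleR_left) auto
  also have "\<dots> \<preceq> sgn (L x)"
    using below_scale[OF b(2), of "inverse (norm (L x))"] n0 by (simp add: sgn_div_norm divide_inverse_commute)
  finally show "(1 / k) *\<^sub>R e \<preceq> sgn (L x)" .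
  have "sgn (L x) \<preceq> ((k * b) / norm (L x)) *\<^sub>R e"
    using below_scale[OF b(3), of "inverse (norm (L x))"] n0 by (simp add: sgn_div_norm divide_inverse_commute)
  also have "k * b / norm (L x) \<le> k" using n1 n0 k by (simp add: field_simps)
  then have "((k * b) / norm (L x)) *\<^sub>R e \<preceq> k *\<^sub>R e" using e_cone by (intro below_scaleR_left) auto
  finally show "sgn (L x) \<preceq> k *\<^sub>R e" .
qed

text \<open>The state one time unit earlier is pushed into the component of \<open>e\<close> by the focusing condition.\<close>

lemma direction_component:
  assumes "\<omega> \<in> regular"
  shows "direction \<omega> \<in> cone_component C e"
proof -
  let ?\<omega>' = "\<theta> (- 1) \<omega>"
  have m1: "- 1 \<in> T" using time_minus[of 1] by simp
  have \<omega>': "?\<omega>' \<in> regular" "?\<omega>' \<in> space M" and \<omega>: "\<omega> \<in> space M"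
    using assms regular_flow m1 regular_space by blast+
  have eq: "direction \<omega> = sgn (U ?\<omega>' 1 (direction ?\<omega>'))"
    using direction_flow[OF \<omega>'(1), of 1] m1 \<omega> by (simp add: flow_flow)
  have d: "direction ?\<omega>' \<in> C - {0}"
    using direction_cone \<omega>' regular_contracting by blast
  have k: "1 \<le> \<kappa> ?\<omega>'" by (rule \<kappa>_ge_1[OF \<omega>'(2)])
  have "cone_sim C (direction \<omega>) e"
    unfolding cone_sim_def eq
    using focused_unit_bounds[OF U_focuses[OF \<omega>'(2)] k d] k
    by (intro exI[of _ "1 / \<kappa> ?\<omega>'"] exI[of _ "\<kappa> ?\<omega>'"] conjI) auto
  then show ?thesis
    using direction_cone[OF \<omega> regular_contracting[OF assms]] by (simp add: cone_component_def)
qed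

text \<open>A positive entire orbit has an arbitrarily remote past, so each of its states has the
  attracting direction.\<close>

lemma positive_entire_orbit:
  assumes \<omega>: "\<omega> \<in> regular" and v: "\<And>t. t \<in> T \<Longrightarrow> v t \<in> C - {0}"
    and orb: "entire_orbit T \<theta> U \<omega> v" and t: "t \<in> T"
  shows "v t = norm (v 0) *\<^sub>R principal_orbit \<theta> U direction \<omega> t"
proof -
  have \<omega>s: "\<omega> \<in> space M" using \<omega> regular_space by blast
  have orb': "v (s + r) = U (\<theta> s \<omega>) r (v s)" if "s \<in> T" "r \<in> T" "0 \<le> r" for s r
    using orb that by (auto simp: entire_orbit_def)
  have dir: "v s = norm (v s) *\<^sub>R direction (\<theta> s \<omega>)" if s: "s \<in> T" for s
  proof -
    have reg: "\<theta> s \<omega> \<in> regular" using \<omega> s by (rule regular_flow)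
    have "U (\<theta> (- real n) (\<theta> s \<omega>)) (real n) (v (s - real n)) = v s" for n
      using orb'[of "s - real n" "real n"] s \<omega>s by (simp add: flow_flow)
    then have "(\<lambda>n::nat. sgn (v s)) \<longlonglongrightarrow> direction (\<theta> s \<omega>)"
      using direction_attracts[of "\<theta> s \<omega>" "\<lambda>n. v (s - real n)"] reg regular_space
        regular_contracting s v by auto
    then have "direction (\<theta> s \<omega>) = sgn (v s)" by (simp add: LIMSEQ_const_iff)
    then show ?thesis using v[OF s] by (simp add: sgn_div_norm)
  qed
  have v0: "norm (v 0) > 0" using v[of 0] by auto
  have d0: "v 0 = norm (v 0) *\<^sub>R direction \<omega>" using dir[of 0] \<omega>s by simp
  show ?thesis
  proof (cases "t < 0")
    case False
    have "v t = U \<omega> t (v 0)" using orb'[of 0 t] t False \<omega>s by simp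
    also have "\<dots> = norm (v 0) *\<^sub>R U \<omega> t (direction \<omega>)" by (subst d0) (simp add: blinfun.scaleR_right)
    finally show ?thesis using False by (simp add: principal_orbit_def)
  next
    case True
    let ?d = "direction (\<theta> t \<omega>)" and ?L = "U (\<theta> t \<omega>) (- t)"
    define z where "z = (norm (v t) / norm (v 0)) *\<^sub>R ?d"
    have reg: "\<theta> t \<omega> \<in> regular" using \<omega> t by (rule regular_flow)
    then have "?L ?d \<in> C - {0}"
      using t True regular_space direction_cone regular_contracting
      by (intro U_nonzero direction_cone) auto
    then have inj: "inj_on ?L (span {?d})"
      by (auto simp: inj_on_def span_singleton blinfun.scaleR_right)
    have "?L (v t) = v 0" using orb'[of t "- t"] t True by simp
    then have "norm (v t) *\<^sub>R ?L ?d = norm (v 0) *\<^sub>R direction \<omega>"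
      using dir[OF t] d0 by (metis blinfun.scaleR_right)
    from arg_cong[OF this, of "\<lambda>y. (1 / norm (v 0)) *\<^sub>R y"]
    have "?L z = direction \<omega>" using v0 by (simp add: z_def blinfun.scaleR_right)
    then have "inv_into (span {?d}) ?L (direction \<omega>) = z"
      using inv_into_f_f[OF inj, of z] by (simp add: z_def span_base span_scale)
    moreover have "norm (v 0) *\<^sub>R z = v t"
      using v0 dir[OF t, symmetric] by (simp add: z_def)
    ultimately show ?thesis using True by (simp add: principal_orbit_def)
  qed
qed

end

section \<open>Measurability and growth of the attracting direction\<close>

lemma sgn_borel_measurable: "(sgn :: 'x::real_normed_vector \<Rightarrow> 'x) \<in> borel_measurable borel"
proof -
  have "(\<lambda>x::'x. if x \<in> {0} then 0 else sgn x) \<in> borel_measurable borel"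
    by (intro borel_measurable_continuous_on_if continuous_intros) auto
  moreover have "(\<lambda>x::'x. if x \<in> {0} then 0 else sgn x) = sgn" by auto
  ultimately show ?thesis by simp
qed

lemma ln_le_lnplus: "0 < x \<Longrightarrow> x \<le> y \<Longrightarrow> ln x \<le> lnplus y"
  by (auto simp: lnplus_def intro: order_trans[of _ "ln y"])

lemma lnplus_nonneg: "0 \<le> lnplus x"
  by (simp add: lnplus_def)

lemma lnplus_le_1: "x \<le> 1 \<Longrightarrow> lnplus x = 0"
  by (auto simp: lnplus_def max_def ln_le_zero_iff)

lemma (in prob_space) nn_L1_real_version:
  assumes "nn_L1 M a"
  shows "integrable M (\<lambda>\<omega>. enn2real (a \<omega>))" "AE \<omega> in M. a \<omega> = ennreal (enn2real (a \<omega>))"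
proof -
  have [measurable]: "a \<in> borel_measurable M" and fin: "(\<integral>\<^sup>+\<omega>. a \<omega> \<partial>M) < \<infinity>"
    using assms by (auto simp: nn_L1_def)
  have "AE \<omega> in M. a \<omega> \<noteq> \<infinity>" using fin by (intro nn_integral_PInf_AE) auto
  then show AE: "AE \<omega> in M. a \<omega> = ennreal (enn2real (a \<omega>))"
    by eventually_elim (simp add: less_top)
  have "(\<integral>\<^sup>+\<omega>. ennreal (enn2real (a \<omega>)) \<partial>M) = (\<integral>\<^sup>+\<omega>. a \<omega> \<partial>M)"
  proof (rule nn_integral_cong_AE)
    show "AE \<omega> in M. ennreal (enn2real (a \<omega>)) = a \<omega>"
      using AE by eventually_elim (rule sym)
  qed
  then show "integrable M (\<lambda>\<omega>. enn2real (a \<omega>))"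
    using fin by (intro integrableI_nonneg) auto
qed

lemma (in prob_space) ext_integral_restrict:
  assumes "F \<in> sets M" "AE \<omega> in M. \<omega> \<in> F" "\<And>\<omega>. \<omega> \<in> F \<Longrightarrow> f \<omega> = h \<omega>"
  shows "ext_integral (restrict_space M F) f = ext_integral M h"
proof -
  have *: "(\<integral>\<^sup>+\<omega>. k (f \<omega>) \<partial>restrict_space M F) = (\<integral>\<^sup>+\<omega>. k (h \<omega>) \<partial>M)" for k :: "real \<Rightarrow> ennreal"
  proof -
    have "(\<integral>\<^sup>+\<omega>. k (f \<omega>) \<partial>restrict_space M F) = (\<integral>\<^sup>+\<omega>. k (f \<omega>) * indicator F \<omega> \<partial>M)"
      using assms(1) by (intro nn_integral_restrict_space) simp
    also have "\<dots> = (\<integral>\<^sup>+\<omega>. k (h \<omega>) \<partial>M)"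
    proof (rule nn_integral_cong_AE)
      show "AE \<omega> in M. k (f \<omega>) * indicator F \<omega> = k (h \<omega>)"
        using assms(2) by eventually_elim (simp add: assms(3))
    qed
    finally show ?thesis .
  qed
  show ?thesis
    unfolding ext_integral_def by (simp only: *[of ennreal] *[of "\<lambda>x. ennreal (- x)"])
qed

context focusing_flow
begin

lemma direction_measurable:
  assumes F: "F \<in> sets M" "F \<subseteq> regular"
  shows "direction \<in> borel_measurable (restrict_space M F)"
proof (rule borel_measurable_LIMSEQ_metric)
  fix n :: nat
  have "(\<lambda>\<omega>. U (\<theta> (- real n) \<omega>) (real n) e) \<in> borel_measurable M"
    by (intro U_measurable flow_measurable) auto
  from measurable_compose[OF this sgn_borel_measurable]
  show "(\<lambda>\<omega>. sgn (U (\<theta> (- real n) \<omega>) (real n) e)) \<in> borel_measurable (restrict_space M F)"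
    by (rule measurable_restrict_space1)
next
  fix \<omega> assume "\<omega> \<in> space (restrict_space M F)"
  then have "\<omega> \<in> regular" using F by (auto simp: space_restrict_space)
  then show "(\<lambda>n. sgn (U (\<theta> (- real n) \<omega>) (real n) e)) \<longlonglongrightarrow> direction \<omega>"
    using regular_space regular_contracting by (intro direction_limit) auto
qed

abbreviation \<rho> :: "real \<Rightarrow> 'w \<Rightarrow> real" where
  "\<rho> \<equiv> growth \<theta> U direction"

lemma U_direction:
  assumes "\<omega> \<in> regular" "t \<in> T" "0 \<le> t"
  shows "U \<omega> t (direction \<omega>) = \<rho> t \<omega> *\<^sub>R direction (\<theta> t \<omega>)" and "0 < \<rho> t \<omega>"
proof -
  have "U \<omega> t (direction \<omega>) \<in> C - {0}"
    using assms regular_space regular_contracting by (intro U_nonzero direction_cone) auto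
  then show "U \<omega> t (direction \<omega>) = \<rho> t \<omega> *\<^sub>R direction (\<theta> t \<omega>)" and "0 < \<rho> t \<omega>"
    using assms by (simp_all add: direction_flow growth_def sgn_div_norm)
qed

lemma growth_add_nonneg:
  assumes \<omega>: "\<omega> \<in> regular" and st: "s \<in> T" "0 \<le> s" "t \<in> T" "0 \<le> t"
  shows "\<rho> (t + s) \<omega> = \<rho> t \<omega> * \<rho> s (\<theta> t \<omega>)"
proof -
  have "U \<omega> (t + s) (direction \<omega>) = U (\<theta> t \<omega>) s (U \<omega> t (direction \<omega>))"
    using \<omega> st regular_space by (subst U_add) auto
  also have "\<dots> = \<rho> t \<omega> *\<^sub>R U (\<theta> t \<omega>) s (direction (\<theta> t \<omega>))"
    using U_direction(1)[OF \<omega> st(3,4)] by (simp add: blinfun.scaleR_right)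
  finally have "norm (U \<omega> (t + s) (direction \<omega>)) = \<rho> t \<omega> * norm (U (\<theta> t \<omega>) s (direction (\<theta> t \<omega>)))"
    using U_direction(2)[OF \<omega> st(3,4)] by simp
  then show ?thesis using st by (simp add: growth_def)
qed

text \<open>Growth factors at negative times are quotients of growth factors at nonnegative times seen
  from a sufficiently remote past; this reduces the cocycle identity for all times to the
  semigroup case.\<close>

lemma growth_from_past:
  assumes \<omega>: "\<omega> \<in> regular" and t: "t \<in> T" and m: "m \<in> T" "0 \<le> m" "0 \<le> m + t"
  shows "\<rho> t \<omega> * \<rho> m (\<theta> (- m) \<omega>) = \<rho> (m + t) (\<theta> (- m) \<omega>)"
proof -
  have \<omega>m: "\<theta> (- m) \<omega> \<in> regular" and sp: "\<omega> \<in> space M" using \<omega> m regular_flow regular_space by auto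
  show ?thesis
  proof (cases "0 \<le> t")
    case True
    then have "\<rho> (m + t) (\<theta> (- m) \<omega>) = \<rho> m (\<theta> (- m) \<omega>) * \<rho> t (\<theta> m (\<theta> (- m) \<omega>))"
      using \<omega>m t m by (intro growth_add_nonneg) auto
    then show ?thesis using sp m by (simp add: flow_flow)
  next
    case False
    then have "\<rho> ((m + t) + - t) (\<theta> (- m) \<omega>) = \<rho> (m + t) (\<theta> (- m) \<omega>) * \<rho> (- t) (\<theta> (m + t) (\<theta> (- m) \<omega>))"
      using \<omega>m t m by (intro growth_add_nonneg) auto
    moreover have "\<theta> (m + t) (\<theta> (- m) \<omega>) = \<theta> t \<omega>" using sp m t by (simp add: flow_flow)
    moreover have "\<rho> t \<omega> = 1 / \<rho> (- t) (\<theta> t \<omega>)" using False by (simp add: growth_def)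
    moreover have "0 < \<rho> (- t) (\<theta> t \<omega>)" using False \<omega> t by (intro U_direction regular_flow) auto
    ultimately show ?thesis by simp
  qed
qed

lemma growth_pos: "\<omega> \<in> regular \<Longrightarrow> t \<in> T \<Longrightarrow> 0 < \<rho> t \<omega>"
proof -
  assume \<omega>: "\<omega> \<in> regular" and t: "t \<in> T"
  show ?thesis
  proof (cases "0 \<le> t")
    case False
    then have "0 < \<rho> (- t) (\<theta> t \<omega>)" using \<omega> t by (intro U_direction regular_flow) auto
    then show ?thesis using False by (simp add: growth_def)
  qed (use \<omega> t in \<open>rule U_direction(2)\<close>)
qed

lemma growth_cocycle:
  assumes \<omega>: "\<omega> \<in> regular" and st: "s \<in> T" "t \<in> T"
  shows "ln (\<rho> (s + t) \<omega>) = ln (\<rho> t \<omega>) + ln (\<rho> s (\<theta> t \<omega>))"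
proof -
  obtain m :: nat where m: "\<bar>s\<bar> + \<bar>t\<bar> \<le> real m" using real_arch_simple by blast
  let ?\<omega>' = "\<theta> (- real m) \<omega>"
  have sp: "\<omega> \<in> space M" "?\<omega>' \<in> regular" "\<theta> t \<omega> \<in> regular" using \<omega> st regular_space regular_flow by auto
  have past: "\<theta> (- (real m + t)) (\<theta> t \<omega>) = ?\<omega>'"
    using sp st by (subst flow_flow) (auto simp del: minus_add_distrib)
  have 1: "\<rho> (s + t) \<omega> * \<rho> (real m) ?\<omega>' = \<rho> (real m + (s + t)) ?\<omega>'"
    using \<omega> st m by (intro growth_from_past) auto
  have 2: "\<rho> t \<omega> * \<rho> (real m) ?\<omega>' = \<rho> (real m + t) ?\<omega>'"
    using \<omega> st m by (intro growth_from_past) auto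
  have 3: "\<rho> s (\<theta> t \<omega>) * \<rho> (real m + t) ?\<omega>' = \<rho> (real m + t + s) ?\<omega>'"
    using growth_from_past[OF sp(3) st(1), of "real m + t"] st m unfolding past by auto
  have pos: "0 < \<rho> (real m) ?\<omega>'" "0 < \<rho> t \<omega>" "0 < \<rho> s (\<theta> t \<omega>)"
    using \<omega> st sp by (auto intro: growth_pos)
  have "\<rho> (s + t) \<omega> * \<rho> (real m) ?\<omega>' = (\<rho> t \<omega> * \<rho> s (\<theta> t \<omega>)) * \<rho> (real m) ?\<omega>'"
  proof -
    have "real m + (s + t) = real m + t + s" by simp
    then have "\<rho> (s + t) \<omega> * \<rho> (real m) ?\<omega>' = \<rho> s (\<theta> t \<omega>) * (\<rho> t \<omega> * \<rho> (real m) ?\<omega>')"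
      using 1 3 unfolding 2 by metis
    then show ?thesis by (simp add: ac_simps)
  qed
  then have "\<rho> (s + t) \<omega> = \<rho> t \<omega> * \<rho> s (\<theta> t \<omega>)" using pos by simp
  then show ?thesis using pos by (simp add: ln_mult)
qed

text \<open>For real time this is the integrability assumption with the suprema replaced by real-valued
  versions; for integer time only the trivial values \<open>s = 0\<close> and \<open>s = 1\<close> occur.\<close>

lemma integrable_time_one_bound:
  obtains c where "integrable M c"
    "AE \<omega> in M. \<forall>s\<in>T \<inter> {0..1}. lnplus (norm (U \<omega> s)) \<le> c \<omega> \<and> lnplus (norm (U (\<theta> s \<omega>) (1 - s))) \<le> c \<omega>"
proof (cases "T = UNIV")
  case True
  define a where "a \<omega> = (SUP s\<in>{0..1}. ennreal (lnplus (norm (U \<omega> s))))" for \<omega>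
  define b where "b \<omega> = (SUP s\<in>{0..1}. ennreal (lnplus (norm (U (\<theta> s \<omega>) (1 - s)))))" for \<omega>
  have ab: "nn_L1 M a" "nn_L1 M b"
    using integrable_sys True unfolding integrable_system_def a_def b_def by simp_all
  have "AE \<omega> in M. \<forall>s\<in>T \<inter> {0..1}. lnplus (norm (U \<omega> s)) \<le> enn2real (a \<omega>) + enn2real (b \<omega>) \<and>
      lnplus (norm (U (\<theta> s \<omega>) (1 - s))) \<le> enn2real (a \<omega>) + enn2real (b \<omega>)"
    using nn_L1_real_version(2)[OF ab(1)] nn_L1_real_version(2)[OF ab(2)]
  proof eventually_elim
    case (elim \<omega>)
    show ?case
    proof
      fix s assume "s \<in> T \<inter> {0..1}"
      then have s: "s \<in> {0..1}" by simp
      have "ennreal (lnplus (norm (U \<omega> s))) \<le> a \<omega>"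
        unfolding a_def using s by (intro SUP_upper)
      then have 1: "lnplus (norm (U \<omega> s)) \<le> enn2real (a \<omega>)"
        by (subst (asm) elim(1)) simp
      have "ennreal (lnplus (norm (U (\<theta> s \<omega>) (1 - s)))) \<le> b \<omega>"
        unfolding b_def using s by (intro SUP_upper)
      then have 2: "lnplus (norm (U (\<theta> s \<omega>) (1 - s))) \<le> enn2real (b \<omega>)"
        by (subst (asm) elim(2)) simp
      have "0 \<le> enn2real (a \<omega>)" "0 \<le> enn2real (b \<omega>)" by simp_all
      with 1 2 show "lnplus (norm (U \<omega> s)) \<le> enn2real (a \<omega>) + enn2real (b \<omega>) \<and>
          lnplus (norm (U (\<theta> s \<omega>) (1 - s))) \<le> enn2real (a \<omega>) + enn2real (b \<omega>)" by linarith
    qed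
  qed
  moreover have "integrable M (\<lambda>\<omega>. enn2real (a \<omega>) + enn2real (b \<omega>))"
    using nn_L1_real_version(1)[OF ab(1)] nn_L1_real_version(1)[OF ab(2)] by auto
  ultimately show ?thesis using that by blast
next
  case False
  then have Z: "T = \<int>" using time by simp
  have int: "integrable M (\<lambda>\<omega>. lnplus (norm (U \<omega> 1)))"
    using integrable_sys Z by (simp add: integrable_system_def)
  have id: "lnplus (norm (U \<omega> 0)) = 0" if "\<omega> \<in> space M" for \<omega>
    using skew that norm_blinfun_id_le by (intro lnplus_le_1) (auto simp: skew_product_def)
  have "AE \<omega> in M. \<forall>s\<in>T \<inter> {0..1}. lnplus (norm (U \<omega> s)) \<le> lnplus (norm (U \<omega> 1)) \<and>
      lnplus (norm (U (\<theta> s \<omega>) (1 - s))) \<le> lnplus (norm (U \<omega> 1))"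
  proof (rule AE_I2, rule ballI)
    fix \<omega> s assume \<omega>: "\<omega> \<in> space M" and "s \<in> T \<inter> {0..1}"
    then obtain j :: int where "s = of_int j" "0 \<le> j" "j \<le> 1" using Z by (auto elim!: Ints_cases)
    then have "s = 0 \<or> s = 1" by (cases "j = 0") auto
    then show "lnplus (norm (U \<omega> s)) \<le> lnplus (norm (U \<omega> 1)) \<and>
        lnplus (norm (U (\<theta> s \<omega>) (1 - s))) \<le> lnplus (norm (U \<omega> 1))"
      using id[OF \<omega>] id[of "\<theta> 1 \<omega>"] \<omega> lnplus_nonneg by auto
  qed
  with int show ?thesis by (rule that)
qed

lemma ln_growth_le:
  assumes "\<omega> \<in> regular" "t \<in> T" "0 \<le> t"
  shows "ln (\<rho> t \<omega>) \<le> lnplus (norm (U \<omega> t))"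
proof (rule ln_le_lnplus)
  have "norm (direction \<omega>) = 1" using assms regular_space regular_contracting direction_unit by blast
  then show "\<rho> t \<omega> \<le> norm (U \<omega> t)"
    using assms norm_blinfun[of "U \<omega> t" "direction \<omega>"] by (simp add: growth_def)
qed (rule growth_pos[OF assms(1,2)])

text \<open>The logarithm of the growth factor is a cocycle with integrable positive part at time 1, so its
  rate is almost surely the integral. The set where the limits hold is invariant because the cocycle
  changes by a constant along an orbit; \<open>f\<close> is set to \<open>0\<close> off \<open>F\<close> to be measurable on the whole
  space.\<close>

theorem growth_exponent_exists:
  obtains F l where "F \<in> sets M" "invariant_set T M \<theta> F" "measure M F = 1" "F \<subseteq> regular"
    "growth_exponent T M \<theta> U F direction l"
proof -
  obtain F where F: "F \<in> sets M" "invariant_set T M \<theta> F" "F \<subseteq> regular" "measure M F = 1"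
    using invariant_core[OF regular_space AE_regular] regular_flow by blast
  have AE_F: "AE \<omega> in M. \<omega> \<in> F" using F prob_eq_1 by blast
  define g where "g t \<omega> = ln (\<rho> t \<omega>)" for t \<omega>
  define f where "f \<omega> = (if \<omega> \<in> F then ln (norm (U \<omega> 1 (direction \<omega>))) else 0)" for \<omega>
  have fg: "g 1 \<omega> = f \<omega>" if "\<omega> \<in> F" for \<omega> using that by (simp add: f_def g_def growth_def)
  have f_meas: "f \<in> borel_measurable M"
  proof -
    have "(\<lambda>\<omega>. U \<omega> 1 (direction \<omega>)) \<in> borel_measurable (restrict_space M F)"
      using F by (intro U_measurable direction_measurable measurable_restrict_space1 measurable_ident_sets) auto
    then have "(\<lambda>\<omega>. norm (U \<omega> 1 (direction \<omega>))) \<in> borel_measurable (restrict_space M F)"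
      by (rule borel_measurable_continuous_on[rotated]) (intro continuous_intros)
    then have "(\<lambda>\<omega>. ln (norm (U \<omega> 1 (direction \<omega>)))) \<in> borel_measurable (restrict_space M F)"
      by (rule borel_measurable_ln)
    then show ?thesis unfolding f_def
      using F by (subst (asm) measurable_restrict_space_iff[where c = 0]) auto
  qed
  obtain c where c: "integrable M c"
    "AE \<omega> in M. \<forall>s\<in>T \<inter> {0..1}. lnplus (norm (U \<omega> s)) \<le> c \<omega> \<and> lnplus (norm (U (\<theta> s \<omega>) (1 - s))) \<le> c \<omega>"
    by (rule integrable_time_one_bound)
  have bound: "AE \<omega> in M. \<forall>s\<in>T \<inter> {0..1}. g s \<omega> \<le> c \<omega> \<and> g 1 \<omega> - g s \<omega> \<le> c \<omega>"
    using c(2) AE_F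
  proof eventually_elim
    case (elim \<omega>)
    then have \<omega>: "\<omega> \<in> regular" using F by blast
    show ?case
    proof
      fix s assume s: "s \<in> T \<inter> {0..1}"
      have "g s \<omega> \<le> lnplus (norm (U \<omega> s))" unfolding g_def using \<omega> s by (intro ln_growth_le) auto
      moreover have "g (1 - s) (\<theta> s \<omega>) \<le> lnplus (norm (U (\<theta> s \<omega>) (1 - s)))"
        unfolding g_def using \<omega> s by (intro ln_growth_le regular_flow) auto
      moreover have "g ((1 - s) + s) \<omega> = g s \<omega> + g (1 - s) (\<theta> s \<omega>)"
        unfolding g_def using \<omega> s by (intro growth_cocycle) auto
      ultimately show "g s \<omega> \<le> c \<omega> \<and> g 1 \<omega> - g s \<omega> \<le> c \<omega>" using elim(1) s by force
    qed
  qed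
  have f_pos: "(\<integral>\<^sup>+\<omega>. ennreal (f \<omega>) \<partial>M) < \<infinity>"
  proof -
    have "(\<integral>\<^sup>+\<omega>. ennreal (f \<omega>) \<partial>M) \<le> (\<integral>\<^sup>+\<omega>. ennreal (norm (c \<omega>)) \<partial>M)"
    proof (rule nn_integral_mono_AE)
      show "AE \<omega> in M. ennreal (f \<omega>) \<le> ennreal (norm (c \<omega>))"
        using bound AE_F
      proof eventually_elim
        case (elim \<omega>)
        then have "g 1 \<omega> \<le> c \<omega>" by auto
        then show ?case using fg[OF elim(2)] by (intro ennreal_leI) auto
      qed
    qed
    also have "\<dots> < \<infinity>" using c(1) unfolding integrable_iff_bounded by blast
    finally show ?thesis .
  qed
  interpret R: flow_cocycle M T \<theta> F g f c
  proof (intro flow_cocycle.intro flow_cocycle_axioms.intro ergodic_flow_axioms)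
    show "g (s + t) \<omega> = g t \<omega> + g s (\<theta> t \<omega>)" if "s \<in> T" "t \<in> T" "\<omega> \<in> F" for s t \<omega>
      unfolding g_def using that F by (intro growth_cocycle) auto
    show "F \<subseteq> space M" using F(1) by (rule sets.sets_into_space)
    show "\<theta> t \<omega> \<in> F" if "\<omega> \<in> F" "t \<in> T" for \<omega> t using F(2) that by (rule invariant_setD(1))
  qed (fact AE_F f_meas fg f_pos c(1) bound)+
  let ?l = "ext_integral M f"
  let ?lim = "\<lambda>\<omega>. ((\<lambda>t. ereal (1 / t * g t \<omega>)) \<longlongrightarrow> ?l) forward \<and>
     ((\<lambda>t. ereal (1 / t * g t \<omega>)) \<longlongrightarrow> ?l) (inf at_bot (principal T))"
  let ?G = "{\<omega>\<in>F. ?lim \<omega>}"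
  have G_flow: "\<theta> s \<omega> \<in> ?G" if \<omega>: "\<omega> \<in> ?G" and s: "s \<in> T" for \<omega> s
  proof -
    have coc: "g t (\<theta> s \<omega>) = g (t + s) \<omega> + - g s \<omega>" if "t \<in> T" for t
      using R.cocycle[of t s \<omega>] that \<omega> s by simp
    have T: "\<forall>\<^sub>F t in forward. t \<in> T" by (auto simp: eventually_forward)
    have "((\<lambda>t. ereal (1 / t * (g (t + s) \<omega> + - g s \<omega>))) \<longlongrightarrow> ?l) forward"
      using \<omega> s by (intro growth_rate_shift) auto
    then have 1: "((\<lambda>t. ereal (1 / t * g t (\<theta> s \<omega>))) \<longlongrightarrow> ?l) forward"
      by (rule Lim_transform_eventually) (use T in \<open>eventually_elim, simp add: coc\<close>)
    have "((\<lambda>t. ereal (1 / t * - g (- t) \<omega>)) \<longlongrightarrow> ?l) forward"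
      using \<omega> unfolding tendsto_backward_iff by simp
    then have "((\<lambda>t. ereal (1 / t * (- g (- (t + - s)) \<omega> + g s \<omega>))) \<longlongrightarrow> ?l) forward"
      using s by (intro growth_rate_shift) auto
    then have "((\<lambda>t. ereal (1 / (- t) * g (- t) (\<theta> s \<omega>))) \<longlongrightarrow> ?l) forward"
    proof (rule Lim_transform_eventually)
      show "\<forall>\<^sub>F t in forward. ereal (1 / t * (- g (- (t + - s)) \<omega> + g s \<omega>)) = ereal (1 / (- t) * g (- t) (\<theta> s \<omega>))"
        using T by eventually_elim (simp add: coc algebra_simps diff_divide_distrib add_divide_distrib)
    qed
    then have 2: "((\<lambda>t. ereal (1 / t * g t (\<theta> s \<omega>))) \<longlongrightarrow> ?l) (inf at_bot (principal T))"
      unfolding tendsto_backward_iff .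
    show ?thesis using 1 2 \<omega> s R.F_flow by auto
  qed
  have AE_G: "AE \<omega> in M. \<omega> \<in> ?G" using R.AE_two_sided_rate AE_F by eventually_elim simp
  have G_space: "?G \<subseteq> space M" using R.F_space by blast
  obtain E where E: "E \<in> sets M" "invariant_set T M \<theta> E" "E \<subseteq> ?G" "measure M E = 1"
  proof (rule invariant_core[OF G_space AE_G])
    show "\<theta> t \<omega> \<in> ?G" if "T = UNIV" "\<omega> \<in> ?G" for \<omega> t
      using that(2) by (rule G_flow) (simp add: that(1))
  qed (rule that)
  have "?l = ext_integral (restrict_space M E) (\<lambda>\<omega>. ln (\<rho> 1 \<omega>))"
    using E prob_eq_1[OF E(1)] fg by (intro ext_integral_restrict[symmetric]) (auto simp: g_def)
  moreover have "?l < \<infinity>"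
  proof -
    have "enn2ereal (\<integral>\<^sup>+\<omega>. ennreal (f \<omega>) \<partial>M) \<noteq> \<infinity>"
      using f_pos by (metis enn2ereal_top enn2ereal_inject infinity_ennreal_def less_irrefl top_ennreal.rep_eq)
    then show ?thesis unfolding ext_integral_def
      by (cases "enn2ereal (\<integral>\<^sup>+\<omega>. ennreal (f \<omega>) \<partial>M)";
          cases "enn2ereal (\<integral>\<^sup>+\<omega>. ennreal (- f \<omega>) \<partial>M)") (auto simp: less_top)
  qed
  ultimately have "growth_exponent T M \<theta> U E direction ?l"
    using E(3) unfolding growth_exponent_def g_def by blast
  moreover have "E \<subseteq> regular" using E F by blast
  ultimately show ?thesis using E by (intro that[of E ?l])
qed

corollary principal_exponent_exists: "\<exists>l. principal_exponent T M \<theta> U C e l"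
proof -
  obtain F l where F: "F \<in> sets M" "invariant_set T M \<theta> F" "measure M F = 1" "F \<subseteq> regular"
      "growth_exponent T M \<theta> U F direction l"
    by (rule growth_exponent_exists)
  have "direction (\<theta> t \<omega>) = U \<omega> t (direction \<omega>) /\<^sub>R norm (U \<omega> t (direction \<omega>))"
    if "\<omega> \<in> F" "t \<in> T \<inter> {0..}" for \<omega> t
    using that F by (subst direction_flow) (auto simp: sgn_div_norm)
  moreover have "direction \<omega> \<in> cone_component C e \<and> norm (direction \<omega>) = 1" if "\<omega> \<in> F" for \<omega>
    using that F regular_space regular_contracting direction_component direction_unit by blast
  moreover have "direction \<in> borel_measurable (restrict_space M F)"
    using F by (intro direction_measurable)
  ultimately show ?thesis
    unfolding principal_exponent_def using F by blast
qed

end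

section \<open>Equality of the exponents of a system and its dual\<close>

lemma focusing_flowI:
  assumes "T = \<int> \<or> T = UNIV" "prob_space M" "skew_product T M \<theta> U" "normally_ordered_banach C"
    "integrable_system T M \<theta> U" "focusing_system T M \<theta> U C e \<kappa>"
  shows "focusing_flow M T \<theta> C U e \<kappa>"
proof (intro focusing_flow.intro focusing_flow_axioms.intro ergodic_flow.intro
    ergodic_flow_axioms.intro measurable_flow.intro measurable_flow_axioms.intro ordered_cone.intro)
  show "metric_dynamical_system T M \<theta>" using assms by (simp add: skew_product_def)
  show "ergodic T M \<theta>" using assms by (simp add: integrable_system_def)
  show "complete_measure M" if "T = UNIV" using assms that by (simp add: integrable_system_def)
  show "ordered_banach C" "monotonic_norm C" using assms by (simp_all add: normally_ordered_banach_def)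
qed (use assms in auto)

text \<open>Closeness along a subsequence suffices, since both limits are known to exist.\<close>

lemma exponent_le_of_frequently_close:
  fixes x y :: "nat \<Rightarrow> real"
  assumes x: "(\<lambda>n. ereal (x n / real n)) \<longlonglongrightarrow> k" and y: "(\<lambda>n. ereal (y n / real n)) \<longlonglongrightarrow> l"
    and close: "\<exists>\<^sub>F n in sequentially. y n - x n \<le> B"
  shows "l \<le> k"
proof (rule ccontr)
  assume "\<not> l \<le> k"
  then have "k < l" by simp
  then obtain r where r: "k < ereal r" "ereal r < l" using ereal_dense2 by blast
  then obtain s where s': "ereal r < ereal s" "ereal s < l" using ereal_dense2 by blast
  then have s: "r < s" "ereal s < l" by simp_all
  obtain m :: nat where m: "B / (s - r) < real m" using reals_Archimedean2 by blast
  have "\<forall>\<^sub>F n in sequentially. y n - x n > B"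
    using order_tendstoD(2)[OF x r(1)] order_tendstoD(1)[OF y s(2)] eventually_gt_at_top[of m]
  proof eventually_elim
    case (elim n)
    then have n: "0 < real n" "real m < real n" by auto
    have "x n < r * real n" "s * real n < y n" using elim n by (simp_all add: field_simps)
    then have "(s - r) * real n < y n - x n" by (simp add: algebra_simps)
    moreover have "B < real m * (s - r)" using m s(1) by (simp add: pos_divide_less_eq)
    moreover have "real m * (s - r) < real n * (s - r)" using n s(1) by (intro mult_strict_right_mono) auto
    ultimately show ?case by (simp add: mult.commute)
  qed
  then have "\<not> (\<exists>\<^sub>F n in sequentially. y n - x n \<le> B)"
    by (simp add: not_frequently not_le)
  with close show False by simp
qed

lemma (in measurable_flow) growth_rate_sequence:
  assumes "((\<lambda>t. ereal (1 / t * h t)) \<longlongrightarrow> l) forward"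
  shows "(\<lambda>n. ereal (h (real n) / real n)) \<longlonglongrightarrow> l"
proof -
  have "filterlim real forward sequentially"
    by (simp add: filterlim_inf filterlim_real_sequentially filterlim_principal)
  from filterlim_compose[OF assms this] show ?thesis by simp
qed

locale dual_pair =
  P: focusing_flow M T \<theta> C U e \<kappa> +
  D: focusing_flow M T "dual_flow \<theta>" "dual_cone C" "dual_cocycle \<theta> U" es \<kappa>s
  for M :: "'w measure" and T \<theta> and C :: "'x::banach set" and U e \<kappa> es \<kappa>s
begin

text \<open>If \<open>es\<close> vanished at \<open>e\<close> it would vanish on the image of the cone under \<open>U \<omega> 1\<close>, all of whose
  elements are dominated by multiples of \<open>e\<close>. The dual image of \<open>es\<close> would then vanish on the cone,
  although it dominates a positive multiple of \<open>es\<close>.\<close>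

lemma pairing_pos: "0 < es e"
proof (rule ccontr)
  assume neg: "\<not> 0 < es e"
  have es: "0 \<le> es u" if "u \<in> C" for u using D.e_cone that by (auto simp: dual_cone_def)
  obtain \<omega> where \<omega>: "\<omega> \<in> space M" using P.not_empty by blast
  have \<omega>1: "\<theta> 1 \<omega> \<in> space M" using \<omega> by simp
  obtain b where b: "b > 0" "cone_le (dual_cone C) (b *\<^sub>R es) (dual_cocycle \<theta> U (\<theta> 1 \<omega>) 1 es)"
    using D.U_focuses[OF \<omega>1] D.e_cone unfolding D.focuses_def by blast
  have "es u = 0" if u: "u \<in> C" for u
  proof -
    have "\<exists>a\<ge>0. U \<omega> 1 u \<in> C \<and> cone_le C (U \<omega> 1 u) (a *\<^sub>R e)"
    proof (cases "u = 0")
      case True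
      then show ?thesis using P.cone_zero by (intro exI[of _ 0]) (simp add: blinfun.zero_right)
    next
      case False
      then obtain a where "a > 0" "cone_le C (U \<omega> 1 u) ((\<kappa> \<omega> * a) *\<^sub>R e)"
        using P.U_focuses[OF \<omega>] u unfolding P.focuses_def by blast
      moreover have "U \<omega> 1 u \<in> C" using P.positive_map_cone[OF P.U_positive[OF \<omega>]] u by simp
      ultimately show ?thesis using P.\<kappa>_ge_1[OF \<omega>] by (intro exI[of _ "\<kappa> \<omega> * a"]) auto
    qed
    then obtain a where a: "a \<ge> 0" "cone_le C (U \<omega> 1 u) (a *\<^sub>R e)" by blast
    have "0 \<le> es (a *\<^sub>R e - U \<omega> 1 u)" using a by (intro es) (simp add: cone_le_def)
    then have "es (U \<omega> 1 u) \<le> a * es e" by (simp add: blinfun.bilinear_simps)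
    also have "\<dots> \<le> 0" using a neg by (simp add: mult_nonneg_nonpos)
    finally have 1: "es (U \<omega> 1 u) \<le> 0" .
    have m1: "- 1 \<in> T" using P.time_minus[of 1] by simp
    have "\<theta> (- 1) (\<theta> 1 \<omega>) = \<omega>" using \<omega> m1 by (simp add: P.flow_flow)
    then have 2: "dual_cocycle \<theta> U (\<theta> 1 \<omega>) 1 es u = es (U \<omega> 1 u)"
      by (simp add: dual_cocycle_pairing)
    have "0 \<le> (dual_cocycle \<theta> U (\<theta> 1 \<omega>) 1 es - b *\<^sub>R es) u"
      using b u by (auto simp: cone_le_def dual_cone_def)
    then have "b * es u \<le> 0" using 1 2 by (simp add: blinfun.bilinear_simps)
    then show ?thesis using b es[OF u] by (simp add: mult_le_0_iff)
  qed
  then have "- es \<in> dual_cone C" by (auto simp: dual_cone_def blinfun.minus_left)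
  then show False using D.cone_antisym[of es] D.e_cone by auto
qed

text \<open>Pairing the two attracting directions gives a positive function \<open>p\<close> whose logarithmic
  coboundary is the difference of the two growth cocycles. Both directions dominate their focal
  vectors up to the factors \<open>\<kappa>\<close> and \<open>\<kappa>s\<close>, so \<open>p\<close> is bounded away from \<open>0\<close> along infinitely many
  times by recurrence, which is enough to identify two exponents known to be limits.\<close>

lemma exponents_equal:
  assumes l: "principal_exponent T M \<theta> U C e l"
    and G: "G \<in> sets M" "measure M G = 1" "G \<subseteq> D.regular"
    and ls: "growth_exponent T M (dual_flow \<theta>) (dual_cocycle \<theta> U) G D.direction ls"
  shows "l = ls"
proof -
  obtain F w where F: "F \<in> sets M" "invariant_set T M \<theta> F" "measure M F = 1"
    and w_dir: "\<forall>\<omega>\<in>F. w \<omega> \<in> cone_component C e \<and> norm (w \<omega>) = 1"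
    and w_flow: "\<forall>\<omega>\<in>F. \<forall>t\<in>T \<inter> {0..}. w (\<theta> t \<omega>) = U \<omega> t (w \<omega>) /\<^sub>R norm (U \<omega> t (w \<omega>))"
    and exp: "growth_exponent T M \<theta> U F w l"
    using l unfolding principal_exponent_def by blast
  have w: "w \<omega> \<in> cone_component C e" "norm (w \<omega>) = 1" if "\<omega> \<in> F" for \<omega>
    using w_dir that by blast+
  have w_flow: "w (\<theta> t \<omega>) = U \<omega> t (w \<omega>) /\<^sub>R norm (U \<omega> t (w \<omega>))"
    if "\<omega> \<in> F" "t \<in> T" "0 \<le> t" for \<omega> t
    using w_flow that by simp
  have m1: "- 1 \<in> T" using P.time_minus[of 1] by simp
  then have [measurable]: "\<theta> 1 \<in> measurable M M" "\<theta> (- 1) \<in> measurable M M" by simp_all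
  \<comment> \<open>the dual system reaches \<open>\<omega>\<close> from \<open>\<theta> 1 \<omega>\<close>, the system itself from \<open>\<theta> (- 1) \<omega>\<close>\<close>
  let ?k = "\<lambda>\<omega>. \<kappa> (\<theta> (- 1) \<omega>) * \<kappa>s (\<theta> 1 \<omega>)"
  have "?k \<in> borel_measurable M"
    using P.\<kappa>_measurable D.\<kappa>_measurable by measurable
  then have rec: "AE \<omega> in M. \<exists>K. \<exists>\<^sub>F n in sequentially. ?k (\<theta> (real n) \<omega>) \<le> K"
    by (rule P.recurrence) simp
  have "AE \<omega> in M. \<omega> \<in> F" "AE \<omega> in M. \<omega> \<in> G" using F G P.prob_eq_1 by blast+
  with rec have good: "AE \<omega> in M. \<omega> \<in> F \<and> \<omega> \<in> G \<and> (\<exists>K. \<exists>\<^sub>F n in sequentially. ?k (\<theta> (real n) \<omega>) \<le> K)"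
    by eventually_elim simp
  have "\<exists>\<omega>. \<omega> \<in> F \<and> \<omega> \<in> G \<and> (\<exists>K. \<exists>\<^sub>F n in sequentially. ?k (\<theta> (real n) \<omega>) \<le> K)"
  proof (rule ccontr)
    assume none: "\<not> ?thesis"
    from good have "AE \<omega> in M. False" by eventually_elim (use none in blast)
    then show False by simp
  qed
  then obtain \<omega> K where \<omega>: "\<omega> \<in> F" "\<omega> \<in> G" "\<exists>\<^sub>F n in sequentially. ?k (\<theta> (real n) \<omega>) \<le> K"
    by blast
  let ?ws = "D.direction"
  have \<omega>reg: "\<omega> \<in> D.regular" "\<omega> \<in> space M" using \<omega> G D.regular_space by blast+
  have orbit: "\<theta> t \<omega> \<in> F" "\<theta> t \<omega> \<in> D.regular" "\<theta> t \<omega> \<in> space M" if "t \<in> T" for t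
  proof -
    show "\<theta> t \<omega> \<in> F" using F(2) \<omega>(1) that by (rule P.invariant_setD(1))
    show "\<theta> t \<omega> \<in> D.regular" using D.regular_flow[OF \<omega>reg(1), of "- t"] that by (simp add: dual_flow_def)
    then show "\<theta> t \<omega> \<in> space M" using D.regular_space by blast
  qed
  define p where "p \<omega> = ?ws \<omega> (w \<omega>)" for \<omega>
  have wC: "w \<omega> \<in> C - {0}" if "\<omega> \<in> F" for \<omega> using w(1)[OF that] by (simp add: cone_component_def)
  have dual_nonneg: "f u \<le> f v" if "f \<in> dual_cone C" "cone_le C u v" for f u v
  proof -
    have "0 \<le> f (v - u)" using that by (simp add: dual_cone_def cone_le_def)
    then show ?thesis by (simp add: blinfun.diff_right)
  qed
  have p_lower: "es e / ?k (\<theta> t \<omega>) \<le> p (\<theta> t \<omega>)" and p_pos: "0 < p (\<theta> t \<omega>)" and p_upper: "p (\<theta> t \<omega>) \<le> 1"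
    and k_ge: "1 \<le> ?k (\<theta> t \<omega>)" if t: "t \<in> T" for t
  proof -
    let ?\<omega>t = "\<theta> t \<omega>"
    let ?a = "\<theta> (- 1) ?\<omega>t" and ?b = "\<theta> 1 ?\<omega>t"
    have a: "?a = \<theta> (t - 1) \<omega>" and b: "?b = \<theta> (t + 1) \<omega>"
      using t \<omega>reg m1 by (simp_all add: P.flow_flow)
    have a': "?a \<in> F" "?a \<in> space M" and b': "?b \<in> D.regular" "?b \<in> space M"
      unfolding a b using orbit t by simp_all
    have ka: "1 \<le> \<kappa> ?a" and kb: "1 \<le> \<kappa>s ?b" using P.\<kappa>_ge_1 D.\<kappa>_ge_1 a' b' by blast+
    then show "1 \<le> ?k ?\<omega>t" using mult_mono[of 1 "\<kappa> ?a" 1 "\<kappa>s ?b"] by simp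
    have "\<theta> 1 ?a = ?\<omega>t" "dual_flow \<theta> 1 ?b = ?\<omega>t"
      using t \<omega>reg m1 orbit[OF t] by (simp_all add: P.flow_flow dual_flow_def)
    then have weq: "w ?\<omega>t = sgn (U ?a 1 (w ?a))" and wseq: "?ws ?\<omega>t = sgn (dual_cocycle \<theta> U ?b 1 (?ws ?b))"
      using w_flow[OF a'(1), of 1] D.direction_flow[OF b'(1), of 1] by (simp_all add: sgn_div_norm)
    have dir: "?ws ?b \<in> dual_cone C - {0}" "?ws ?\<omega>t \<in> dual_cone C - {0}"
      using D.direction_cone D.regular_contracting b' orbit[OF t] by blast+
    have 1: "cone_le C ((1 / \<kappa> ?a) *\<^sub>R e) (w ?\<omega>t)"
      unfolding weq by (rule P.focused_unit_bounds(1)[OF P.U_focuses[OF a'(2)] ka wC[OF a'(1)]])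
    have 2: "cone_le (dual_cone C) ((1 / \<kappa>s ?b) *\<^sub>R es) (?ws ?\<omega>t)"
      unfolding wseq by (rule D.focused_unit_bounds(1)[OF D.U_focuses[OF b'(2)] kb dir(1)])
    have "0 \<le> (?ws ?\<omega>t - (1 / \<kappa>s ?b) *\<^sub>R es) e"
      using 2 P.e_cone by (auto simp: cone_le_def dual_cone_def)
    then have "(1 / \<kappa>s ?b) * es e \<le> ?ws ?\<omega>t e" by (simp add: blinfun.bilinear_simps)
    then have "(1 / \<kappa> ?a) * ((1 / \<kappa>s ?b) * es e) \<le> (1 / \<kappa> ?a) * ?ws ?\<omega>t e"
      using ka by (intro mult_left_mono) auto
    also have "\<dots> = ?ws ?\<omega>t ((1 / \<kappa> ?a) *\<^sub>R e)" by (simp add: blinfun.scaleR_right)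
    also have "\<dots> \<le> p ?\<omega>t" unfolding p_def using 1 dir(2) by (intro dual_nonneg) auto
    finally show lower: "es e / ?k ?\<omega>t \<le> p ?\<omega>t" by simp
    have "0 < es e / ?k ?\<omega>t" using pairing_pos ka kb by simp
    with lower show "0 < p ?\<omega>t" by linarith
    have "norm (?ws ?\<omega>t) = 1" using D.direction_unit D.regular_contracting orbit[OF t] by blast
    then show "p ?\<omega>t \<le> 1"
      using norm_blinfun[of "?ws ?\<omega>t" "w ?\<omega>t"] w(2)[OF orbit(1)[OF t]] by (simp add: p_def)
  qed
  let ?x = "\<lambda>n. ln (growth \<theta> U w (real n) \<omega>)"
  let ?y = "\<lambda>n. - ln (growth (dual_flow \<theta>) (dual_cocycle \<theta> U) ?ws (- real n) \<omega>)"
  have diff: "?x n - ?y n = ln (p \<omega>) - ln (p (\<theta> (real n) \<omega>))" if n: "0 < n" for n :: nat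
  proof -
    let ?\<omega>n = "\<theta> (real n) \<omega>"
    define r where "r = norm (U \<omega> (real n) (w \<omega>))"
    define rs where "rs = norm (dual_cocycle \<theta> U ?\<omega>n (real n) (?ws ?\<omega>n))"
    have \<omega>n: "?\<omega>n \<in> space M" "?\<omega>n \<in> D.regular" using orbit by simp_all
    have ret: "\<theta> (- real n) ?\<omega>n = \<omega>" using \<omega>reg by (simp add: P.flow_flow)
    have r: "r > 0" unfolding r_def
      using P.U_nonzero[OF \<omega>reg(2) _ _ wC[OF \<omega>(1)], of "real n"] by simp
    have "?ws ?\<omega>n \<in> dual_cone C - {0}" using D.direction_cone D.regular_contracting \<omega>n by blast
    then have rs: "rs > 0" unfolding rs_def using D.U_nonzero[OF \<omega>n(1), of "real n"] by simp
    have "w ?\<omega>n = U \<omega> (real n) (w \<omega>) /\<^sub>R r" using w_flow[OF \<omega>(1), of "real n"] by (simp add: r_def)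
    then have 1: "U \<omega> (real n) (w \<omega>) = r *\<^sub>R w ?\<omega>n" using r by simp
    have "?ws \<omega> = dual_cocycle \<theta> U ?\<omega>n (real n) (?ws ?\<omega>n) /\<^sub>R rs"
      using D.direction_flow[OF \<omega>n(2), of "real n"] by (simp add: dual_flow_def ret sgn_div_norm rs_def)
    then have 2: "dual_cocycle \<theta> U ?\<omega>n (real n) (?ws ?\<omega>n) = rs *\<^sub>R ?ws \<omega>" using rs by simp
    have "r * p ?\<omega>n = ?ws ?\<omega>n (U \<omega> (real n) (w \<omega>))"
      unfolding 1 by (simp add: p_def blinfun.scaleR_right)
    also have "\<dots> = dual_cocycle \<theta> U ?\<omega>n (real n) (?ws ?\<omega>n) (w \<omega>)"
      by (simp add: dual_cocycle_pairing ret)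
    also have "\<dots> = rs * p \<omega>" unfolding 2 by (simp add: p_def blinfun.scaleR_left)
    finally have "ln (r * p ?\<omega>n) = ln (rs * p \<omega>)" by simp
    then have "ln r + ln (p ?\<omega>n) = ln rs + ln (p \<omega>)"
      using r rs p_pos[of "real n"] p_pos[of 0] \<omega>reg by (simp add: ln_mult)
    moreover have "?x n = ln r" by (simp add: growth_def r_def)
    moreover have "?y n = ln rs"
      using n rs by (simp add: growth_def rs_def dual_flow_def ln_div)
    ultimately show ?thesis by simp
  qed
  have X: "(\<lambda>n. ereal (?x n / real n)) \<longlonglongrightarrow> l"
    using exp \<omega>(1) unfolding growth_exponent_def by (intro P.growth_rate_sequence) auto
  have "((\<lambda>t. ereal (1 / t * ln (growth (dual_flow \<theta>) (dual_cocycle \<theta> U) ?ws t \<omega>))) \<longlongrightarrow> ls) (inf at_bot (principal T))"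
    using ls \<omega>(2) unfolding growth_exponent_def by blast
  then have "((\<lambda>t. ereal (1 / t * - ln (growth (dual_flow \<theta>) (dual_cocycle \<theta> U) ?ws (- t) \<omega>))) \<longlongrightarrow> ls) P.forward"
    unfolding P.tendsto_backward_iff by simp
  then have Y: "(\<lambda>n. ereal (?y n / real n)) \<longlonglongrightarrow> ls" by (rule P.growth_rate_sequence)
  have freq: "\<exists>\<^sub>F n in sequentially. 0 < n \<and> ?k (\<theta> (real n) \<omega>) \<le> K"
    using frequently_eventually_frequently[OF \<omega>(3) eventually_gt_at_top[of 0]]
    by (rule frequently_elim1) simp
  let ?B = "\<bar>ln (p \<omega>)\<bar> + \<bar>ln (es e / K)\<bar>"
  have close: "?x n - ?y n \<le> ?B" "?y n - ?x n \<le> ?B"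
    if "0 < n" "?k (\<theta> (real n) \<omega>) \<le> K" for n :: nat
  proof -
    have t: "real n \<in> T" by simp
    have "es e / K \<le> es e / ?k (\<theta> (real n) \<omega>)"
      using that(2) k_ge[OF t] pairing_pos by (intro divide_left_mono) (auto intro!: mult_pos_pos)
    then have 1: "es e / K \<le> p (\<theta> (real n) \<omega>)" using p_lower[OF t] by linarith
    have "0 < es e / K" using that(2) k_ge[OF t] pairing_pos by simp
    then have "ln (es e / K) \<le> ln (p (\<theta> (real n) \<omega>))" using 1 p_pos[OF t] by simp
    moreover have "ln (p (\<theta> (real n) \<omega>)) \<le> 0" using p_pos[OF t] p_upper[OF t] by simp
    ultimately show "?x n - ?y n \<le> ?B" "?y n - ?x n \<le> ?B" using diff[OF that(1)] by linarith+
  qed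
  show ?thesis
  proof (rule antisym)
    show "l \<le> ls"
    proof (rule exponent_le_of_frequently_close[OF Y X])
      show "\<exists>\<^sub>F n in sequentially. ?x n - ?y n \<le> ?B"
        using freq by (rule frequently_elim1) (use close in blast)
    qed
    show "ls \<le> l"
    proof (rule exponent_le_of_frequently_close[OF X Y])
      show "\<exists>\<^sub>F n in sequentially. ?y n - ?x n \<le> ?B"
        using freq by (rule frequently_elim1) (use close in blast)
    qed
  qed
qed

end

theorem theorem3p7:
  fixes T :: "real set"
    and M :: "'w measure"
    and \<theta> :: "real \<Rightarrow> 'w \<Rightarrow> 'w"
    and U :: "'w \<Rightarrow> real \<Rightarrow> 'x::banach \<Rightarrow>\<^sub>L 'x"
    and Xp :: "'x set"
    and es :: "'x \<Rightarrow>\<^sub>L real"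
    and \<kappa>s :: "'w \<Rightarrow> real"
  assumes "T = \<int> \<or> T = UNIV"
    and "prob_space M"
    and "ordered_banach Xp"
    and "normally_ordered_banach (dual_cone Xp)"
    and "separable_space (euclidean :: ('x \<Rightarrow>\<^sub>L real) topology)"
    and "dim_ge 2 (UNIV :: ('x \<Rightarrow>\<^sub>L real) set)"
    and "skew_product T M \<theta> U"
    and "skew_product T M (dual_flow \<theta>) (dual_cocycle \<theta> U)"
    and "integrable_system T M (dual_flow \<theta>) (dual_cocycle \<theta> U)"
    and "positive_system T M (dual_flow \<theta>) (dual_cocycle \<theta> U) (dual_cone Xp)"
    and "focusing_system T M (dual_flow \<theta>) (dual_cocycle \<theta> U) (dual_cone Xp) es \<kappa>s"
  shows "\<exists>\<Omega>s ws.
    \<Omega>s \<in> sets M \<and> invariant_set T M \<theta> \<Omega>s \<and> measure M \<Omega>s = 1 \<and>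
    ws \<in> measurable (restrict_space M \<Omega>s) borel \<and>
    (\<forall>\<omega>\<in>\<Omega>s. ws \<omega> \<in> cone_component (dual_cone Xp) es \<and> norm (ws \<omega>) = 1) \<and>
    (\<forall>\<omega>\<in>\<Omega>s. \<forall>t\<in>T \<inter> {0..}.
       ws (\<theta> (- t) \<omega>)
         = dual_cocycle \<theta> U \<omega> t (ws \<omega>) /\<^sub>R norm (dual_cocycle \<theta> U \<omega> t (ws \<omega>))) \<and>
    (\<forall>\<omega>\<in>\<Omega>s. \<forall>vs :: real \<Rightarrow> 'x \<Rightarrow>\<^sub>L real.
       (\<forall>t\<in>T. vs t \<in> dual_cone Xp - {0}) \<and>
       entire_orbit T (dual_flow \<theta>) (dual_cocycle \<theta> U) \<omega> vs \<longrightarrow>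
       (\<forall>t\<in>T. vs t = norm (vs 0) *\<^sub>R principal_orbit (dual_flow \<theta>) (dual_cocycle \<theta> U) ws \<omega> t)) \<and>
    (\<exists>lams. growth_exponent T M (dual_flow \<theta>) (dual_cocycle \<theta> U) \<Omega>s ws lams \<and>
       (\<forall>e \<kappa>.
          normally_ordered_banach Xp \<and>
          separable_space (euclidean :: 'x topology) \<and>
          dim_ge 2 (UNIV :: 'x set) \<and>
          integrable_system T M \<theta> U \<and>
          positive_system T M \<theta> U Xp \<and>
          focusing_system T M \<theta> U Xp e \<kappa> \<longrightarrow>
          (\<exists>lam1. principal_exponent T M \<theta> U Xp e lam1) \<and>
          (\<forall>lam1. principal_exponent T M \<theta> U Xp e lam1 \<longrightarrow> lam1 = lams)))"
proof -
  interpret O: measurable_flow M T \<theta>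
    using assms(1,2,7) by (simp add: measurable_flow_def measurable_flow_axioms_def skew_product_def)
  interpret D: focusing_flow M T "dual_flow \<theta>" "dual_cone Xp" "dual_cocycle \<theta> U" es \<kappa>s
    by (rule focusing_flowI) (fact assms)+
  obtain F l where F: "F \<in> sets M" "invariant_set T M (dual_flow \<theta>) F" "measure M F = 1"
      "F \<subseteq> D.regular" and exp: "growth_exponent T M (dual_flow \<theta>) (dual_cocycle \<theta> U) F D.direction l"
    by (rule D.growth_exponent_exists)
  have "invariant_set T M \<theta> F" using F(2) by (simp add: O.invariant_set_reverse)
  moreover have "D.direction \<in> borel_measurable (restrict_space M F)"
    using F by (intro D.direction_measurable)
  moreover have "\<forall>\<omega>\<in>F. D.direction \<omega> \<in> cone_component (dual_cone Xp) es \<and> norm (D.direction \<omega>) = 1"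
    using F D.regular_space D.regular_contracting D.direction_component D.direction_unit by blast
  moreover have "\<forall>\<omega>\<in>F. \<forall>t\<in>T \<inter> {0..}. D.direction (\<theta> (- t) \<omega>)
         = dual_cocycle \<theta> U \<omega> t (D.direction \<omega>) /\<^sub>R norm (dual_cocycle \<theta> U \<omega> t (D.direction \<omega>))"
  proof (intro ballI)
    fix \<omega> t assume "\<omega> \<in> F" "t \<in> T \<inter> {0..}"
    then show "D.direction (\<theta> (- t) \<omega>)
         = dual_cocycle \<theta> U \<omega> t (D.direction \<omega>) /\<^sub>R norm (dual_cocycle \<theta> U \<omega> t (D.direction \<omega>))"
      using D.direction_flow[of \<omega> t] F(4) by (auto simp: dual_flow_def sgn_div_norm)
  qed
  moreover have "\<forall>\<omega>\<in>F. \<forall>vs :: real \<Rightarrow> 'x \<Rightarrow>\<^sub>L real.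
       (\<forall>t\<in>T. vs t \<in> dual_cone Xp - {0}) \<and>
       entire_orbit T (dual_flow \<theta>) (dual_cocycle \<theta> U) \<omega> vs \<longrightarrow>
       (\<forall>t\<in>T. vs t = norm (vs 0) *\<^sub>R principal_orbit (dual_flow \<theta>) (dual_cocycle \<theta> U) D.direction \<omega> t)"
    using D.positive_entire_orbit F(4) by blast
  moreover have "\<forall>e \<kappa>.
          normally_ordered_banach Xp \<and>
          separable_space (euclidean :: 'x topology) \<and>
          dim_ge 2 (UNIV :: 'x set) \<and>
          integrable_system T M \<theta> U \<and>
          positive_system T M \<theta> U Xp \<and>
          focusing_system T M \<theta> U Xp e \<kappa> \<longrightarrow>
          (\<exists>lam1. principal_exponent T M \<theta> U Xp e lam1) \<and>
          (\<forall>lam1. principal_exponent T M \<theta> U Xp e lam1 \<longrightarrow> lam1 = l)"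
  proof (rule allI, rule allI, rule impI)
    fix e \<kappa>
    assume X: "normally_ordered_banach Xp \<and> separable_space (euclidean :: 'x topology) \<and>
          dim_ge 2 (UNIV :: 'x set) \<and> integrable_system T M \<theta> U \<and>
          positive_system T M \<theta> U Xp \<and> focusing_system T M \<theta> U Xp e \<kappa>"
    interpret P: focusing_flow M T \<theta> Xp U e \<kappa>
      by (rule focusing_flowI) (use assms(1,2,7) X in simp_all)
    interpret dual_pair M T \<theta> Xp U e \<kappa> es \<kappa>s
      by (intro dual_pair.intro P.focusing_flow_axioms D.focusing_flow_axioms)
    have "lam1 = l" if "principal_exponent T M \<theta> U Xp e lam1" for lam1
      using that F(1,3,4) exp by (rule exponents_equal)
    then show "(\<exists>lam1. principal_exponent T M \<theta> U Xp e lam1) \<and>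
          (\<forall>lam1. principal_exponent T M \<theta> U Xp e lam1 \<longrightarrow> lam1 = l)"
      using P.principal_exponent_exists by blast
  qed
  ultimately show ?thesis
    using F(1,3) exp by (intro exI[of _ F] exI[of _ D.direction] exI[of _ l] conjI)
qed

end
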